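(* Let $\Sigma$ be a compact Riemann surface, possibly with boundary $\partial\Sigma$, let $D\subset\Sigma$ be a finite subset not meeting $\partial\Sigma$, and let $\omega\in\mathcal A^2(\Sigma,\star D)$. For each $p_i\in D$ let $z_i$ be a local holomorphic coordinate around $p_i$ such that $z_i(p_i)=0$, and let $B_\epsilon^i=\{|z_i|\le\epsilon\}$ be a small $\epsilon$-ball centered at $p_i$. Then $$\operatorname{Reg}\!\int_\Sigma\omega=\lim_{\epsilon\to0}\int_{\Sigma-\bigcup_iB_\epsilon^i}\omega.$$ In particular, the limit on the right-hand side exists and does not depend on the choice of the local coordinates $z_i$.
   Context: $\mathcal A^{p,q}(\Sigma,\star D)$ is the space of complex-valued $(p,q)$-forms which are smooth on $\Sigma\setminus D$ and which near each $p\in D$ have the form $\alpha_0/z^N$, where $z$ is a local holomorphic coordinate with $z(p)=0$, $N\ge0$ is an integer and $\alpha_0$ is a smooth form near $p$. $\mathcal A^2(\Sigma,\star D)=\mathcal A^{1,1}(\Sigma,\star D)$. $\mathcal A^2(\Sigma,\log D)$ is the subspace of forms which near each $p\in D$ have the form $\frac{dz}z\wedge\beta_0$ with $\beta_0$ a smooth $(0,1)$-form. $\partial$ is the holomorphic de Rham differential. Every $\omega\in\mathcal A^2(\Sigma,\star D)$ can be written $\omega=\alpha+\partial\beta$ with $\alpha\in\mathcal A^2(\Sigma,\log D)$, $\beta\in\mathcal A^{0,1}(\Sigma,\star D)$, and the regularized integral is $\operatorname{Reg}\!\int_\Sigma\omega:=\int_\Sigma\alpha+\int_{\partial\Sigma}\beta$,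 which is well defined and independent of the choice of $\alpha,\beta$. *)

theory Defs
  imports "HOL-Analysis.Analysis"
begin

section \<open>Smooth functions on subsets of the plane\<close>

text \<open>\<open>Ck k V f\<close>: for open \<open>V\<close>, the function \<open>f\<close> is \<open>k\<close> times continuously real-differentiable on \<open>V\<close>;
  \<open>fx\<close> and \<open>fy\<close> are the two partial derivatives.\<close>

primrec Ck :: "nat \<Rightarrow> complex set \<Rightarrow> (complex \<Rightarrow> 'b::real_normed_vector) \<Rightarrow> bool" where
  "Ck 0 V f \<longleftrightarrow> continuous_on V f"
| "Ck (Suc k) V f \<longleftrightarrow>
     (\<exists>fx fy. (\<forall>z\<in>V. (f has_derivative (\<lambda>h. Re h *\<^sub>R fx z + Im h *\<^sub>R fy z)) (at z)) \<and>
              Ck k V fx \<and> Ck k V fy)"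

text \<open>On a set that need not be open (a relatively open part of the closed half-plane), smoothness
  means that \<open>f\<close> extends, locally, to a smooth function on an open subset of the plane.\<close>

definition smooth_on :: "complex set \<Rightarrow> (complex \<Rightarrow> 'b::real_normed_vector) \<Rightarrow> bool" where
  "smooth_on W f \<longleftrightarrow>
     (\<forall>z\<in>W. \<exists>V g. open V \<and> z \<in> V \<and> (\<forall>k. Ck k V g) \<and> (\<forall>w\<in>V \<inter> W. g w = f w))"

text \<open>The derivative $\partial f/\partial z = (f_x - i f_y)/2$ at a point of \<open>W\<close>.\<close>

definition dz_deriv :: "complex set \<Rightarrow> (complex \<Rightarrow> complex) \<Rightarrow> complex \<Rightarrow> complex" where
  "dz_deriv W f z =
     (frechet_derivative f (at z within W) 1 - \<i> * frechet_derivative f (at z within W) \<i>) / 2"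


section \<open>Riemann surfaces with boundary\<close>

text \<open>A chart is a pair of its domain and its coordinate function; the values of the
  coordinate function outside the domain are irrelevant.\<close>

type_synonym 'a chart = "'a set \<times> ('a \<Rightarrow> complex)"

abbreviation dom :: "'a chart \<Rightarrow> 'a set" where "dom c \<equiv> fst c"
abbreviation coord :: "'a chart \<Rightarrow> 'a \<Rightarrow> complex" where "coord c \<equiv> snd c"
abbreviation img :: "'a chart \<Rightarrow> complex set" where "img c \<equiv> coord c ` dom c"
abbreviation param :: "'a chart \<Rightarrow> complex \<Rightarrow> 'a" where "param c \<equiv> inv_into (dom c) (coord c)"

definition half_plane :: "complex set" where
  "half_plane = {z. 0 \<le> Im z}"

text \<open>Charts onto open subsets of the plane are admitted besides charts onto relatively open subsets
  of the closed upper half-plane, so that an interior point can have coordinate 0.\<close>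

definition is_chart :: "'a topology \<Rightarrow> 'a chart \<Rightarrow> bool" where
  "is_chart X c \<longleftrightarrow>
     openin X (dom c) \<and>
     homeomorphic_map (subtopology X (dom c)) (top_of_set (img c)) (coord c) \<and>
     (open (img c) \<or> openin (top_of_set half_plane) (img c))"

text \<open>The change of coordinates from \<open>c\<close> to \<open>c'\<close> is holomorphic, which at boundary points means
  that it extends holomorphically to a neighbourhood in the plane.\<close>

definition holomorphic_transition :: "'a chart \<Rightarrow> 'a chart \<Rightarrow> bool" where
  "holomorphic_transition c c' \<longleftrightarrow>
     (\<forall>x\<in>dom c \<inter> dom c'. \<exists>V g. open V \<and> coord c x \<in> V \<and> g holomorphic_on V \<and>
        (\<forall>y\<in>dom c \<inter> dom c'. coord c y \<in> V \<longrightarrow> g (coord c y) = coord c' y))"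

text \<open>\<open>A\<close> is a maximal holomorphic atlas on \<open>X\<close>, so its members are exactly the local holomorphic
  coordinates. Connectedness is not required. A compact surface in this sense is automatically
  second countable.\<close>

definition riemann_surface_with_boundary :: "'a topology \<Rightarrow> 'a chart set \<Rightarrow> bool" where
  "riemann_surface_with_boundary X A \<longleftrightarrow>
     Hausdorff_space X \<and>
     (\<forall>c\<in>A. is_chart X c) \<and>
     (\<Union>c\<in>A. dom c) = topspace X \<and>
     (\<forall>c\<in>A. \<forall>c'\<in>A. holomorphic_transition c c') \<and>
     (\<forall>c. is_chart X c \<and>
          (\<forall>c'\<in>A. holomorphic_transition c c' \<and> holomorphic_transition c' c) \<longrightarrow> c \<in> A)"

text \<open>A point is a boundary point when some chart maps it to a non-interior point of the chart's
  image, i.e. to a real point of a half-plane chart. By the open mapping theorem this does not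
  depend on the chart.\<close>

definition surface_boundary :: "'a chart set \<Rightarrow> 'a set" where
  "surface_boundary A = {x. \<exists>c\<in>A. x \<in> dom c \<and> coord c x \<notin> interior (img c)}"

definition coordinate_at :: "'a chart set \<Rightarrow> 'a \<Rightarrow> 'a chart \<Rightarrow> bool" where
  "coordinate_at A p c \<longleftrightarrow> c \<in> A \<and> p \<in> dom c \<and> coord c p = 0"

definition coordinate_ball :: "'a chart \<Rightarrow> real \<Rightarrow> 'a set" where
  "coordinate_ball c \<epsilon> = {x \<in> dom c. norm (coord c x) \<le> \<epsilon>}"


section \<open>Differential forms\<close>

text \<open>A form is given by its coefficient functions: \<open>\<omega> c x\<close> is the coefficient at the point \<open>x\<close>
  with respect to the chart \<open>c\<close> with coordinate $z$, of $dz\wedge d\bar z$ for a (1,1)-form and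
  of $d\bar z$ for a (0,1)-form. A form with poles in \<open>D\<close> has irrelevant values at the points of \<open>D\<close>.\<close>

type_synonym 'a form = "'a chart \<Rightarrow> 'a \<Rightarrow> complex"

text \<open>Transformation law of the coefficients of $(p,q)$-forms, $p, q \le 1$, and smoothness, both
  away from \<open>D\<close>. Here \<open>d\<close> is the derivative of the change of coordinates from \<open>c\<close> to \<open>c'\<close>.\<close>

definition smooth_form_off :: "'a chart set \<Rightarrow> nat \<Rightarrow> nat \<Rightarrow> 'a set \<Rightarrow> 'a form \<Rightarrow> bool" where
  "smooth_form_off A p q D \<omega> \<longleftrightarrow>
     (\<forall>c\<in>A. \<forall>c'\<in>A. \<forall>x\<in>dom c \<inter> dom c' - D. \<forall>d.
        ((\<lambda>w. coord c' (param c w)) has_field_derivative d)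
            (at (coord c x) within coord c ` (dom c \<inter> dom c')) \<longrightarrow>
        \<omega> c x = \<omega> c' x * d ^ p * cnj d ^ q) \<and>
     (\<forall>c\<in>A. smooth_on (coord c ` (dom c - D)) (\<lambda>w. \<omega> c (param c w)))"

text \<open>Near \<open>p\<close>, the form is a smooth form divided by $z^N$, for a coordinate $z$ centred at \<open>p\<close>.\<close>

definition pole_le :: "'a topology \<Rightarrow> 'a chart set \<Rightarrow> 'a set \<Rightarrow> 'a form \<Rightarrow> 'a \<Rightarrow> nat \<Rightarrow> bool" where
  "pole_le X A D \<omega> p N \<longleftrightarrow>
     (\<exists>c V a. coordinate_at A p c \<and> openin X V \<and> p \<in> V \<and> V \<subseteq> dom c \<and>
        smooth_on (coord c ` V) a \<and>
        (\<forall>x\<in>V - D. \<omega> c x = a (coord c x) / coord c x ^ N))"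

text \<open>$\mathcal A^{p,q}(\Sigma,\star D)$\<close>

definition forms_pole :: "'a topology \<Rightarrow> 'a chart set \<Rightarrow> nat \<Rightarrow> nat \<Rightarrow> 'a set \<Rightarrow> 'a form set" where
  "forms_pole X A p q D =
     {\<omega>. smooth_form_off A p q D \<omega> \<and> (\<forall>x\<in>D. \<exists>N. pole_le X A D \<omega> x N)}"

text \<open>$\mathcal A^2(\Sigma,\log D)$: the coefficient of $\frac{dz}{z}\wedge b\,d\bar z$ with
  respect to $dz\wedge d\bar z$ is $b/z$, so the condition is a pole bound with $N = 1$.\<close>

definition forms_log :: "'a topology \<Rightarrow> 'a chart set \<Rightarrow> 'a set \<Rightarrow> 'a form set" where
  "forms_log X A D = {\<omega> \<in> forms_pole X A 1 1 D. \<forall>x\<in>D. pole_le X A D \<omega> x 1}"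

text \<open>The operator $\partial$ on (0,1)-forms:
  $\partial (g\,d\bar z) = \frac{\partial g}{\partial z}\,dz\wedge d\bar z$.\<close>

definition hol_d :: "'a form \<Rightarrow> 'a form" where
  "hol_d \<beta> = (\<lambda>c x. dz_deriv (img c) (\<lambda>w. \<beta> c (param c w)) (coord c x))"


section \<open>Integration\<close>

definition partition_of_unity ::
    "'a topology \<Rightarrow> 'a chart set \<Rightarrow> ('a chart \<times> ('a \<Rightarrow> real)) set \<Rightarrow> bool" where
  "partition_of_unity X A P \<longleftrightarrow>
     finite P \<and>
     (\<forall>(c, \<rho>)\<in>P. c \<in> A \<and>
        (\<forall>x\<in>topspace X. 0 \<le> \<rho> x) \<and>
        X closure_of {x \<in> topspace X. \<rho> x \<noteq> 0} \<subseteq> dom c \<and>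
        (\<forall>c'\<in>A. smooth_on (img c') (\<lambda>w. \<rho> (param c' w)))) \<and>
     (\<forall>x\<in>topspace X. (\<Sum>(c, \<rho>)\<in>P. \<rho> x) = 1)"

definition some_partition ::
    "'a topology \<Rightarrow> 'a chart set \<Rightarrow> ('a chart \<times> ('a \<Rightarrow> real)) set" where
  "some_partition X A = (SOME P. partition_of_unity X A P)"

text \<open>Integral of a (1,1)-form over a subset \<open>S\<close> of a compact surface;
  the factor comes from $dz\wedge d\bar z = -2i\,dx\wedge dy$.\<close>

definition surface_integral ::
    "'a topology \<Rightarrow> 'a chart set \<Rightarrow> 'a set \<Rightarrow> 'a form \<Rightarrow> complex" where
  "surface_integral X A S \<omega> =
     (\<Sum>(c, \<rho>)\<in>some_partition X A.
        - 2 * \<i> * (LINT w:coord c ` (dom c \<inter> S)|lborel.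
                      of_real (\<rho> (param c w)) * \<omega> c (param c w)))"

text \<open>Integral of a (0,1)-form over the boundary. In a half-plane chart the boundary is the real line,
  its boundary orientation is the usual orientation of the line, and $d\bar z$ restricts to $dx$.\<close>

definition boundary_integral ::
    "'a topology \<Rightarrow> 'a chart set \<Rightarrow> 'a form \<Rightarrow> complex" where
  "boundary_integral X A \<beta> =
     (\<Sum>(c, \<rho>)\<in>some_partition X A.
        (LINT t:{t. complex_of_real t \<in> coord c ` (dom c \<inter> surface_boundary A)}|lborel.
            of_real (\<rho> (param c (of_real t))) * \<beta> c (param c (of_real t))))"

definition reg_integral ::
    "'a topology \<Rightarrow> 'a chart set \<Rightarrow> 'a set \<Rightarrow> 'a form \<Rightarrow> complex" where
  "reg_integral X A D \<omega> =
     (THE r. \<exists>\<alpha> \<beta>. \<alpha> \<in> forms_log X A D \<and> \<beta> \<in> forms_pole X A 0 1 D \<and>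
        (\<forall>c\<in>A. \<forall>x\<in>dom c - D. \<omega> c x = \<alpha> c x + hol_d \<beta> c x) \<and>
        r = surface_integral X A (topspace X) \<alpha> + boundary_integral X A \<beta>)"

end

theory Submission
  imports Defs "HOL-Complex_Analysis.Conformal_Mappings"
begin

text \<open>
Write $\omega = \alpha + \partial\beta$ with a logarithmic form $\alpha$ and a form $\beta$ with poles.
Outside small coordinate discs about the poles everything is smooth, so the integral of $\omega$ there is
the sum of the integrals of $\alpha$ and of $\partial\beta$. A coefficient of size $1/|z|$ is integrable in the
plane, and therefore the first summand tends to $\int_\Sigma\alpha$ by dominated convergence
(\<open>log_form_integrable\<close>, \<open>holed_limit\<close>). The second summand tends to $\int_{\partial\Sigma}\beta$, whatever coordinates define
the discs (\<open>stokes_pole\<close>). So the limit exists and equals the value of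
each decomposition; in particular all decompositions give the same value. That there is a
decomposition at all is \<open>decomposition_exists\<close>: the identity behind \<open>pole_reduction\<close> lowers the order of a pole
modulo exact forms until a simple pole remains.

For the limit of $\int\partial\beta$, the form $\beta$ is split with cutoff functions into a smooth form, for which
Stokes' theorem is proved with a partition of unity (\<open>stokes_smooth\<close>), and one form $h\,d\bar z/z^N$
with smooth, compactly supported $h$ for each pole, where $z$ is the coordinate that defines the disc. By
Stokes in the coordinate $\log z$ the integral of the differential of the latter over $|z| > \epsilon$ is, up to
a constant factor, $\epsilon^2$ times the mean of $h z^{-N-1}$ over the circle $|z| = \epsilon$. Since
$\bar z = \epsilon^2/z$ there, repeated integration by parts along the circle shows that this mean stays
bounded as $\epsilon \to 0$ (\<open>circle_coefficient_bound\<close>), so the limit is 0 for a pole of any order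
(\<open>punctured_plane_limit\<close>).

The integral over the surface is defined by a partition of unity chosen arbitrarily. Two things are needed to
work with it: a partition exists (\<open>partition_exists\<close>), and the integral of a form supported in one chart can be
computed in that chart (\<open>surface_integral_in_chart\<close>), by the holomorphic change of variables
(\<open>complex_change_of_variables\<close>). Boundary points need no separate treatment as long as derivatives are taken within
the image of a chart, where they are unique (\<open>chart_open_fat\<close>).
\<close>

section \<open>Smooth functions of a complex variable\<close>

definition pdx :: "(complex \<Rightarrow> 'b::real_normed_vector) \<Rightarrow> complex \<Rightarrow> 'b"
  where "pdx f z = frechet_derivative f (at z) 1"

definition pdy :: "(complex \<Rightarrow> 'b::real_normed_vector) \<Rightarrow> complex \<Rightarrow> 'b"
  where "pdy f z = frechet_derivative f (at z) \<i>"

lemma has_derivative_partials: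
  assumes "(f has_derivative F) (at z within W)"
  shows "F = (\<lambda>h. Re h *\<^sub>R F 1 + Im h *\<^sub>R F \<i>)"
proof
  fix h
  have "h = Re h *\<^sub>R 1 + Im h *\<^sub>R \<i>"
    by (simp add: complex_eq_iff)
  then have "F h = F (Re h *\<^sub>R 1 + Im h *\<^sub>R \<i>)" by simp
  also have "\<dots> = Re h *\<^sub>R F 1 + Im h *\<^sub>R F \<i>"
    using has_derivative_linear[OF assms] by (simp add: linear_add linear_scale)
  finally show "F h = Re h *\<^sub>R F 1 + Im h *\<^sub>R F \<i>" .
qed

lemma pdx_pdy_eqI:
  assumes "(f has_derivative (\<lambda>h. Re h *\<^sub>R a + Im h *\<^sub>R b)) (at z)"
  shows "pdx f z = a" "pdy f z = b"
  unfolding pdx_def pdy_def frechet_derivative_at[OF assms, symmetric] by auto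

lemma differentiable_partials:
  assumes "f differentiable (at z)"
  shows "(f has_derivative (\<lambda>h. Re h *\<^sub>R pdx f z + Im h *\<^sub>R pdy f z)) (at z)"
proof -
  have *: "(f has_derivative frechet_derivative f (at z)) (at z)"
    using assms frechet_derivative_works by blast
  show ?thesis
    using * has_derivative_partials[OF *] unfolding pdx_def pdy_def by simp
qed

lemma Ck_cong:
  assumes "open V" "\<And>z. z \<in> V \<Longrightarrow> f z = g z" "Ck k V f"
  shows "Ck k V g"
  using assms(2,3)
proof (induction k arbitrary: f g)
  case 0
  then show ?case using continuous_on_cong by (metis Ck.simps(1))
next
  case (Suc k)
  then obtain fx fy where "\<forall>z\<in>V. (f has_derivative (\<lambda>h. Re h *\<^sub>R fx z + Im h *\<^sub>R fy z)) (at z)"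
    "Ck k V fx" "Ck k V fy" by auto
  moreover have "(g has_derivative (\<lambda>h. Re h *\<^sub>R fx z + Im h *\<^sub>R fy z)) (at z)" if "z \<in> V" for z
    using has_derivative_transform_within_open[of f _ z UNIV V g] assms(1) that calculation(1) Suc.prems(1) by auto
  ultimately show ?case by auto
qed

lemma Ck_SucI:
  assumes "\<And>z. z \<in> V \<Longrightarrow> (f has_derivative (\<lambda>h. Re h *\<^sub>R fx z + Im h *\<^sub>R fy z)) (at z)"
    "Ck k V fx" "Ck k V fy"
  shows "Ck (Suc k) V f"
  using assms by auto

declare Ck.simps(2) [simp del]

text \<open>The partial derivatives in the definition of \<open>Ck\<close> are existentially quantified. On an open set
they are unique, and this form, in which they are chosen once and for all, is what makes smoothness a
local property.\<close>

lemma Ck_Suc_iff: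
  assumes "open V"
  shows "Ck (Suc k) V f \<longleftrightarrow>
    (\<forall>z\<in>V. f differentiable (at z)) \<and> Ck k V (pdx f) \<and> Ck k V (pdy f)"
proof
  assume "Ck (Suc k) V f"
  then obtain fx fy where *: "\<forall>z\<in>V. (f has_derivative (\<lambda>h. Re h *\<^sub>R fx z + Im h *\<^sub>R fy z)) (at z)"
    "Ck k V fx" "Ck k V fy" by (auto simp: Ck.simps(2))
  have "pdx f z = fx z" "pdy f z = fy z" if "z \<in> V" for z
    using pdx_pdy_eqI[of f "fx z" "fy z" z] * that by auto
  then show "(\<forall>z\<in>V. f differentiable (at z)) \<and> Ck k V (pdx f) \<and> Ck k V (pdy f)"
    using * Ck_cong[OF assms, of fx "pdx f"] Ck_cong[OF assms, of fy "pdy f"]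
    by (auto intro: differentiableI)
next
  assume "(\<forall>z\<in>V. f differentiable (at z)) \<and> Ck k V (pdx f) \<and> Ck k V (pdy f)"
  then show "Ck (Suc k) V f"
    using differentiable_partials by (intro Ck_SucI[where fx = "pdx f" and fy = "pdy f"]) auto
qed

lemma Ck_subset: "Ck k V f \<Longrightarrow> V' \<subseteq> V \<Longrightarrow> Ck k V' f"
proof (induction k arbitrary: f)
  case (Suc k)
  then obtain fx fy where *: "\<forall>z\<in>V. (f has_derivative (\<lambda>h. Re h *\<^sub>R fx z + Im h *\<^sub>R fy z)) (at z)"
    "Ck k V fx" "Ck k V fy" by (auto simp: Ck.simps(2))
  with Suc show ?case by (intro Ck_SucI[where fx = fx and fy = fy]) auto
qed (auto intro: continuous_on_subset)

lemma Ck_imp_continuous_on: "Ck k V f \<Longrightarrow> continuous_on V f"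
proof (cases k)
  case (Suc n)
  assume "Ck k V f"
  then obtain fx fy where "\<forall>z\<in>V. (f has_derivative (\<lambda>h. Re h *\<^sub>R fx z + Im h *\<^sub>R fy z)) (at z)"
    using Suc by (auto simp: Ck.simps(2))
  then show ?thesis
    using continuous_at_imp_continuous_on has_derivative_continuous by metis
qed simp

lemma Ck_SucD: "Ck (Suc k) V f \<Longrightarrow> Ck k V f"
proof (induction k arbitrary: f)
  case 0 then show ?case using Ck_imp_continuous_on by (metis Ck.simps(1))
next
  case (Suc k)
  then obtain fx fy where *: "\<forall>z\<in>V. (f has_derivative (\<lambda>h. Re h *\<^sub>R fx z + Im h *\<^sub>R fy z)) (at z)"
    "Ck (Suc k) V fx" "Ck (Suc k) V fy" using Ck.simps(2)[of "Suc k" V f] by blast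
  then show ?case using Suc.IH[of fx] Suc.IH[of fy] using Ck.simps(2) by blast
qed

text \<open>Smoothness is proved below by patching: a product of a cutoff with a locally defined function is treated
on the support of the cutoff and on its complement separately.\<close>

lemma Ck_local:
  assumes "open V" "\<And>z. z \<in> V \<Longrightarrow> \<exists>U. open U \<and> z \<in> U \<and> Ck k U f"
  shows "Ck k V f"
  using assms(2)
proof (induction k arbitrary: f)
  case 0
  show ?case
    unfolding Ck.simps
    by (intro continuous_at_imp_continuous_on ballI)
       (use 0 in \<open>fastforce simp: continuous_on_eq_continuous_at\<close>)
next
  case (Suc k)
  have *: "\<exists>U. open U \<and> z \<in> U \<and> (\<forall>z\<in>U. f differentiable (at z)) \<and> Ck k U (pdx f) \<and> Ck k U (pdy f)"
    if "z \<in> V" for z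
    using Suc.prems[OF that] Ck_Suc_iff by blast
  show ?case
    unfolding Ck_Suc_iff[OF assms(1)]
    by (intro conjI Suc.IH) (use * in blast)+
qed

lemma Ck_const: "Ck k V (\<lambda>_. c)"
proof (induction k arbitrary: c)
  case (Suc k)
  show ?case
    by (rule Ck_SucI[where fx = "\<lambda>_. 0" and fy = "\<lambda>_. 0"]) (use Suc in auto)
qed auto

lemma Ck_add: "Ck k V f \<Longrightarrow> Ck k V g \<Longrightarrow> Ck k V (\<lambda>z. f z + g z)"
proof (induction k arbitrary: f g)
  case 0 then show ?case by (auto intro: continuous_intros)
next
  case (Suc k)
  then obtain fx fy gx gy where
    "\<forall>z\<in>V. (f has_derivative (\<lambda>h. Re h *\<^sub>R fx z + Im h *\<^sub>R fy z)) (at z)"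
    "\<forall>z\<in>V. (g has_derivative (\<lambda>h. Re h *\<^sub>R gx z + Im h *\<^sub>R gy z)) (at z)"
    "Ck k V fx" "Ck k V fy" "Ck k V gx" "Ck k V gy" by (auto simp: Ck.simps(2))
  then show ?case
    by (intro Ck_SucI[where fx = "\<lambda>z. fx z + gx z" and fy = "\<lambda>z. fy z + gy z"] )
       (auto intro!: Suc.IH derivative_eq_intros simp: algebra_simps)
qed

lemma Ck_mult:
  fixes f g :: "complex \<Rightarrow> 'b::real_normed_algebra"
  shows "Ck k V f \<Longrightarrow> Ck k V g \<Longrightarrow> Ck k V (\<lambda>z. f z * g z)"
proof (induction k arbitrary: f g)
  case 0 then show ?case by (auto intro: continuous_intros)
next
  case (Suc k)
  then obtain fx fy gx gy where *:
    "\<forall>z\<in>V. (f has_derivative (\<lambda>h. Re h *\<^sub>R fx z + Im h *\<^sub>R fy z)) (at z)"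
    "\<forall>z\<in>V. (g has_derivative (\<lambda>h. Re h *\<^sub>R gx z + Im h *\<^sub>R gy z)) (at z)"
    "Ck k V fx" "Ck k V fy" "Ck k V gx" "Ck k V gy" by (auto simp: Ck.simps(2))
  then show ?case
    by (intro Ck_SucI[where fx = "\<lambda>z. f z * gx z + fx z * g z" and fy = "\<lambda>z. f z * gy z + fy z * g z"] )
       (use Suc.prems in \<open>auto intro!: Suc.IH Ck_add derivative_eq_intros dest: Ck_SucD simp: algebra_simps\<close>)
qed

lemma Ck_bounded_linear:
  assumes "bounded_linear L"
  shows "Ck k V f \<Longrightarrow> Ck k V (\<lambda>z. L (f z))"
proof (induction k arbitrary: f)
  case 0 then show ?case using assms by (auto intro: bounded_linear.continuous_on)
next
  case (Suc k)
  then obtain fx fy where *: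
    "\<forall>z\<in>V. (f has_derivative (\<lambda>h. Re h *\<^sub>R fx z + Im h *\<^sub>R fy z)) (at z)"
    "Ck k V fx" "Ck k V fy" by (auto simp: Ck.simps(2))
  interpret bounded_linear L by fact
  have "((\<lambda>z. L (f z)) has_derivative (\<lambda>h. Re h *\<^sub>R L (fx z) + Im h *\<^sub>R L (fy z))) (at z)"
    if "z \<in> V" for z
    using has_derivative[OF *(1)[rule_format, OF that]] by (simp add: add scaleR)
  with * show ?case
    by (intro Ck_SucI[where fx = "\<lambda>z. L (fx z)" and fy = "\<lambda>z. L (fy z)"] )
       (auto intro!: Suc.IH)
qed

lemma Ck_minus: "Ck k V f \<Longrightarrow> Ck k V (\<lambda>z. - f z)"
  by (rule Ck_bounded_linear[OF bounded_linear_minus[OF bounded_linear_ident]])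

lemma Ck_diff: "Ck k V f \<Longrightarrow> Ck k V g \<Longrightarrow> Ck k V (\<lambda>z. f z - g z)"
  using Ck_add[OF _ Ck_minus, of k V f g] by simp

lemma Ck_inverse:
  fixes f :: "complex \<Rightarrow> 'b::real_normed_field"
  assumes "\<And>z. z \<in> V \<Longrightarrow> f z \<noteq> 0"
  shows "Ck k V f \<Longrightarrow> Ck k V (\<lambda>z. inverse (f z))"
proof (induction k)
  case 0 then show ?case using assms by (auto intro: continuous_intros)
next
  case (Suc k)
  then obtain fx fy where *:
    "\<forall>z\<in>V. (f has_derivative (\<lambda>h. Re h *\<^sub>R fx z + Im h *\<^sub>R fy z)) (at z)"
    "Ck k V fx" "Ck k V fy" by (auto simp: Ck.simps(2))
  have "Ck k V (\<lambda>z. inverse (f z))" using Suc Ck_SucD by blast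
  with * show ?case
    by (intro Ck_SucI[where fx = "\<lambda>z. - (fx z * inverse (f z) * inverse (f z))" and fy = "\<lambda>z. - (fy z * inverse (f z) * inverse (f z))"] )
       (use assms in \<open>auto intro!: Ck_minus Ck_mult derivative_eq_intros simp: algebra_simps\<close>)
qed

lemma Ck_divide:
  fixes f g :: "complex \<Rightarrow> 'b::real_normed_field"
  assumes "\<And>z. z \<in> V \<Longrightarrow> g z \<noteq> 0" "Ck k V f" "Ck k V g"
  shows "Ck k V (\<lambda>z. f z / g z)"
  using Ck_mult[OF assms(2) Ck_inverse[OF assms(1,3)]] by (simp add: divide_inverse)

lemma Ck_power:
  fixes f :: "complex \<Rightarrow> 'b::real_normed_field"
  shows "Ck k V f \<Longrightarrow> Ck k V (\<lambda>z. f z ^ n)"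
  by (induction n) (auto intro: Ck_const Ck_mult)

lemma has_field_derivative_partials:
  "(f has_field_derivative d) (at z within W) \<longleftrightarrow>
   (f has_derivative (\<lambda>h. Re h *\<^sub>R d + Im h *\<^sub>R (\<i> * d))) (at z within W)"
proof -
  have "(\<lambda>h. Re h *\<^sub>R d + Im h *\<^sub>R (\<i> * d)) = (*) d"
    by (auto simp: fun_eq_iff complex_eq_iff algebra_simps)
  then show ?thesis by (simp add: has_field_derivative_def)
qed

lemma Ck_holomorphic: "open V \<Longrightarrow> f holomorphic_on V \<Longrightarrow> Ck k V f"
proof (induction k arbitrary: f)
  case 0 then show ?case by (simp add: holomorphic_on_imp_continuous_on)
next
  case (Suc k)
  have d: "(f has_field_derivative deriv f z) (at z)" if "z \<in> V" for z
    using Suc.prems that holomorphic_derivI by blast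
  have "deriv f holomorphic_on V" using Suc.prems holomorphic_deriv by blast
  moreover from this have "(\<lambda>z. \<i> * deriv f z) holomorphic_on V" by (intro holomorphic_on_mult holomorphic_on_const)
  ultimately have "Ck k V (deriv f)" "Ck k V (\<lambda>z. \<i> * deriv f z)"
    using Suc.IH[OF Suc.prems(1)] by blast+
  then show ?case
    using d[unfolded has_field_derivative_partials] by (intro Ck_SucI[where fx = "deriv f" and fy = "\<lambda>z. \<i> * deriv f z"]) auto
qed

lemma Ck_ident: "Ck k V (\<lambda>z. z)"
  by (rule Ck_subset[OF Ck_holomorphic[of UNIV]]) auto

lemma Ck_scaleR_of_real:
  "Ck k V p \<Longrightarrow> Ck k V f \<Longrightarrow> Ck k V (\<lambda>z. p z *\<^sub>R (f z :: complex))"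
  unfolding scaleR_conv_of_real by (intro Ck_mult Ck_bounded_linear[OF bounded_linear_of_real])

lemma Ck_of_real: "Ck k V f \<Longrightarrow> Ck k V (\<lambda>z. complex_of_real (f z))"
  by (rule Ck_bounded_linear[OF bounded_linear_of_real])

lemma Ck_cnj: "Ck k V f \<Longrightarrow> Ck k V (\<lambda>z. cnj (f z))"
  by (rule Ck_bounded_linear[OF bounded_linear_cnj])

text \<open>The Cauchy--Riemann equations put the derivative of the inner function into the shape of a rotation and
dilation, which acts on the pair of partial derivatives.\<close>

lemma has_derivative_compose_holomorphic:
  assumes "(f has_derivative (\<lambda>h. Re h *\<^sub>R fx + Im h *\<^sub>R fy)) (at (g z))"
    and "(g has_field_derivative d) (at z)"
  shows "((\<lambda>z. f (g z)) has_derivative (\<lambda>h. Re h *\<^sub>R (Re d *\<^sub>R fx + Im d *\<^sub>R fy)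
      + Im h *\<^sub>R (Re d *\<^sub>R fy - Im d *\<^sub>R fx))) (at z)"
  using has_derivative_compose[OF assms(2)[unfolded has_field_derivative_def] assms(1)]
  by (rule has_derivative_eq_rhs) (auto simp: algebra_simps fun_eq_iff)

lemma Ck_compose_holomorphic:
  fixes f :: "complex \<Rightarrow> complex"
  assumes "open V" "g holomorphic_on V" "\<And>z. z \<in> V \<Longrightarrow> g z \<in> V'"
  shows "Ck k V' f \<Longrightarrow> Ck k V (\<lambda>z. f (g z))"
proof (induction k arbitrary: f)
  case 0
  have "continuous_on V g" using assms holomorphic_on_imp_continuous_on by blast
  then show ?case using 0 assms(3) by (auto intro!: continuous_on_compose2[of V' f])
next
  case (Suc k)
  then obtain fx fy where *:
    "\<forall>z\<in>V'. (f has_derivative (\<lambda>h. Re h *\<^sub>R fx z + Im h *\<^sub>R fy z)) (at z)"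
    "Ck k V' fx" "Ck k V' fy" by (auto simp: Ck.simps(2))
  have g: "(g has_field_derivative deriv g z) (at z)" if "z \<in> V" for z
    using assms that holomorphic_derivI by blast
  have dg: "Ck k V (deriv g)" using assms Ck_holomorphic holomorphic_deriv by blast
  show ?case
    by (intro Ck_SucI[where fx = "\<lambda>z. Re (deriv g z) *\<^sub>R fx (g z) + Im (deriv g z) *\<^sub>R fy (g z)" and fy = "\<lambda>z. Re (deriv g z) *\<^sub>R fy (g z) - Im (deriv g z) *\<^sub>R fx (g z)"]
        has_derivative_compose_holomorphic Ck_add Ck_diff Ck_scaleR_of_real Suc.IH
        Ck_bounded_linear[OF bounded_linear_Re] Ck_bounded_linear[OF bounded_linear_Im])
      (use * assms g dg in auto)
qed

lemma Ck_pdx: "open V \<Longrightarrow> Ck (Suc k) V f \<Longrightarrow> Ck k V (pdx f)"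
  and Ck_pdy: "open V \<Longrightarrow> Ck (Suc k) V f \<Longrightarrow> Ck k V (pdy f)"
  by (simp_all add: Ck_Suc_iff)

section \<open>A smooth plateau function\<close>

text \<open>These functions $t^{-m}e^{-1/t}$, extended by 0 to $t \le 0$, contain $e^{-1/t}$ and are closed under
differentiation up to linear combinations. So one induction shows that all of them are smooth.\<close>

definition flat :: "nat \<Rightarrow> real \<Rightarrow> real" where
  "flat m t = (if t > 0 then inverse t ^ m * exp (- inverse t) else 0)"

lemma flat_tendsto_0: "(flat m \<longlongrightarrow> 0) (at_right 0)"
proof -
  have "((\<lambda>t. inverse t ^ m / exp (inverse t)) \<longlongrightarrow> 0) (at_right (0::real))"
    using filterlim_compose[OF tendsto_power_div_exp_0 filterlim_inverse_at_top_right] .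
  then show ?thesis
    by (rule Lim_transform_eventually)
       (auto simp: eventually_at_filter flat_def exp_minus divide_inverse)
qed

lemma flat_has_derivative:
  "(flat m has_field_derivative (flat (m + 2) t - real m * flat (Suc m) t)) (at t)"
proof -
  consider "t < 0" | "t > 0" | "t = 0" by linarith
  then show ?thesis
  proof cases
    case 1
    have "((\<lambda>_. 0) has_field_derivative 0) (at t)" by simp
    then have "(flat m has_field_derivative 0) (at t)"
      by (rule has_field_derivative_transform_within[where d = "-t"]) (use 1 in \<open>auto simp: flat_def dist_real_def abs_if split: if_splits\<close>)
    then show ?thesis using 1 by (simp add: flat_def)
  next
    case 2
    have "((\<lambda>t. inverse t ^ m * exp (- inverse t)) has_field_derivative
       (flat (m + 2) t - real m * flat (Suc m) t)) (at t)"
    proof (cases m)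
      case 0
      then show ?thesis using 2 by (auto intro!: derivative_eq_intros simp: flat_def power2_eq_square)
    next
      case (Suc n)
      then show ?thesis using 2
        by (auto intro!: derivative_eq_intros simp: flat_def) (cases n; simp add: algebra_simps)
    qed
    then show ?thesis
      by (rule has_field_derivative_transform_within[where d = "t"]) (use 2 in \<open>auto simp: flat_def dist_real_def abs_if split: if_splits\<close>)
  next
    case 3
    \<comment> \<open>The difference quotient on the right is the next function of the family.\<close>
    have r: "((\<lambda>h. (flat m (0 + h) - flat m 0) / h) \<longlongrightarrow> 0) (at_right 0)"
      by (rule Lim_transform_eventually[OF flat_tendsto_0[of "Suc m"]])
         (auto simp: eventually_at_filter flat_def field_simps)
    have l: "((\<lambda>h. (flat m (0 + h) - flat m 0) / h) \<longlongrightarrow> 0) (at_left 0)"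
      by (rule Lim_transform_eventually[OF tendsto_const[of 0]])
         (auto simp: eventually_at_filter flat_def field_simps)
    show ?thesis unfolding DERIV_def 3 using filterlim_split_at[OF l r] by (simp add: flat_def)
  qed
qed

lemma Ck_flat: "Ck k V q \<Longrightarrow> Ck k V (\<lambda>z. flat m (q z))"
proof (induction k arbitrary: m)
  case 0
  have "continuous_on UNIV (flat m)"
    by (meson DERIV_continuous_on flat_has_derivative has_field_derivative_at_within)
  then show ?case using 0 by (auto intro!: continuous_on_compose2[of UNIV "flat m"])
next
  case (Suc k)
  then obtain fx fy where *:
    "\<forall>z\<in>V. (q has_derivative (\<lambda>h. Re h *\<^sub>R fx z + Im h *\<^sub>R fy z)) (at z)"
    "Ck k V fx" "Ck k V fy" by (auto simp: Ck.simps(2))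
  let ?D = "\<lambda>z. flat (m + 2) (q z) - real m * flat (Suc m) (q z)"
  have D: "Ck k V ?D"
    using Suc Ck_SucD by (intro Ck_diff Ck_mult Ck_const Suc.IH) auto
  show ?case
  proof (intro Ck_SucI[where fx = "\<lambda>z. ?D z * fx z" and fy = "\<lambda>z. ?D z * fy z"] Ck_mult D *)
    fix z assume "z \<in> V"
    from has_derivative_compose[OF *(1)[rule_format, OF this] flat_has_derivative[unfolded has_field_derivative_def]]
    show "((\<lambda>z. flat m (q z)) has_derivative
           (\<lambda>h. Re h *\<^sub>R (?D z * fx z) + Im h *\<^sub>R (?D z * fy z))) (at z)"
      by (rule has_derivative_eq_rhs) (auto simp: algebra_simps fun_eq_iff)
  qed
qed

lemma Ck_Re: "Ck k V f \<Longrightarrow> Ck k V (\<lambda>z. Re (f z))"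
  by (rule Ck_bounded_linear[OF bounded_linear_Re])

text \<open>The quotient $e_1/(e_1+e_2)$ of two flat exponentials, where $e_1$ lives on the disc of radius $r$
about $a$ and $e_2$ outside the closed disc of radius $r/2$. The square of the distance is written as a
product so that its smoothness follows from the algebraic closure rules.\<close>

definition plateau :: "complex \<Rightarrow> real \<Rightarrow> complex \<Rightarrow> real" where
  "plateau a r z = (let s = Re ((z - a) * cnj (z - a)) in
     flat 0 (r\<^sup>2 - s) / (flat 0 (r\<^sup>2 - s) + flat 0 (s - (r/2)\<^sup>2)))"

lemma flat_0_sign: "flat 0 t \<ge> 0" "flat 0 t > 0 \<longleftrightarrow> t > 0" "flat 0 t = 0 \<longleftrightarrow> t \<le> 0"
  by (auto simp: flat_def)

lemma plateau_props:
  assumes "r > 0"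
  shows "Ck k UNIV (plateau a r)" "0 \<le> plateau a r z" "plateau a r z \<le> 1"
    "norm (z - a) \<le> r/2 \<Longrightarrow> plateau a r z = 1" "norm (z - a) \<ge> r \<Longrightarrow> plateau a r z = 0"
proof -
  have s: "Re ((z - a) * cnj (z - a)) = (norm (z - a))\<^sup>2" for z
    unfolding complex_mult_cnj by (simp add: cmod_power2)
  \<comment> \<open>The two half-lines on which the summands are positive cover the line.\<close>
  have pos: "flat 0 (r\<^sup>2 - t) + flat 0 (t - (r/2)\<^sup>2) > 0" for t
  proof -
    have "(r/2)\<^sup>2 < r\<^sup>2" using assms by (simp add: power_divide)
    then have "r\<^sup>2 - t > 0 \<or> t - (r/2)\<^sup>2 > 0" by linarith
    then show ?thesis using flat_0_sign by (metis add_nonneg_pos add_pos_nonneg)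
  qed
  have "Ck k UNIV (\<lambda>z. let s = Re ((z - a) * cnj (z - a)) in
     flat 0 (r\<^sup>2 - s) / (flat 0 (r\<^sup>2 - s) + flat 0 (s - (r/2)\<^sup>2)))"
    unfolding Let_def
    by (intro Ck_divide Ck_add Ck_flat Ck_diff Ck_const Ck_Re Ck_mult Ck_cnj Ck_ident)
       (use pos in \<open>auto simp: less_le\<close>)
  then show "Ck k UNIV (plateau a r)" by (simp add: plateau_def[abs_def])
  show "0 \<le> plateau a r z" "plateau a r z \<le> 1"
    unfolding plateau_def Let_def s using pos[of "(norm (z - a))\<^sup>2"] flat_0_sign(1)[of "r\<^sup>2 - (norm (z - a))\<^sup>2"]
      flat_0_sign(1)[of "(norm (z - a))\<^sup>2 - (r/2)\<^sup>2"] by (simp_all only: divide_nonneg_pos pos_divide_le_eq) auto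
  show "plateau a r z = 1" if "norm (z - a) \<le> r/2"
  proof -
    have "flat 0 ((norm (z - a))\<^sup>2 - (r/2)\<^sup>2) = 0"
      unfolding flat_0_sign using that by (simp add: power_mono)
    then show ?thesis using pos[of "(norm (z - a))\<^sup>2"] unfolding plateau_def Let_def s by simp
  qed
  show "plateau a r z = 0" if "norm (z - a) \<ge> r"
  proof -
    have "flat 0 (r\<^sup>2 - (norm (z - a))\<^sup>2) = 0"
      unfolding flat_0_sign using that assms by (simp add: power_mono)
    then show ?thesis unfolding plateau_def Let_def s by simp
  qed
qed

section \<open>Change of variables and rectangles in the complex plane\<close>

text \<open>The general change of variables theorem is about integrals over real vectors with a finite index type.
The next few lemmas carry it to the complex plane; integrands are transported too, so that the theorem
for vector-valued functions applies to complex-valued ones.\<close>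

definition vec2_to_complex :: "real^2 \<Rightarrow> complex" where
  "vec2_to_complex v = Complex (v $ 1) (v $ 2)"

definition complex_to_vec2 :: "complex \<Rightarrow> real^2" where
  "complex_to_vec2 z = vector [Re z, Im z]"

lemma vec2_complex_inverse [simp]:
  "vec2_to_complex (complex_to_vec2 z) = z" "complex_to_vec2 (vec2_to_complex v) = v"
  by (auto simp: vec2_to_complex_def complex_to_vec2_def vec_eq_iff forall_2)

lemma bounded_linear_vec2_to_complex: "bounded_linear vec2_to_complex"
  unfolding linear_conv_bounded_linear[symmetric]
  by (rule linearI) (auto simp: vec2_to_complex_def complex_eq_iff)

lemma bounded_linear_complex_to_vec2: "bounded_linear complex_to_vec2"
  unfolding linear_conv_bounded_linear[symmetric]
  by (rule linearI) (auto simp: complex_to_vec2_def vec_eq_iff forall_2)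

lemma image_complex_to_vec2: "complex_to_vec2 ` S = vec2_to_complex -` S"
  by (force simp: image_iff)

lemma Basis_real2: "(Basis :: (real^2) set) = {axis 1 1, axis 2 1}"
  by (auto simp: Basis_vec_def UNIV_2)

lemma lborel_distr_vec2_to_complex: "lborel = distr lborel borel vec2_to_complex"
proof (rule lborel_eqI)
  fix l u :: complex
  assume le: "\<And>b. b \<in> Basis \<Longrightarrow> l \<bullet> b \<le> u \<bullet> b"
  have m [measurable]: "vec2_to_complex \<in> borel_measurable borel"
    by (intro borel_measurable_continuous_onI linear_continuous_on bounded_linear_vec2_to_complex)
  have "vec2_to_complex -` box l u = box (complex_to_vec2 l) (complex_to_vec2 u)"
    by (auto simp: box_def Basis_complex_def Basis_real2 vec2_to_complex_def complex_to_vec2_def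
        inner_axis' inner_axis inner_complex_def)
  moreover have "emeasure lborel (box (complex_to_vec2 l) (complex_to_vec2 u))
      = (\<Prod>b\<in>Basis. (u - l) \<bullet> b)"
    using le[of 1] le[of \<i>]
    by (subst emeasure_lborel_box)
       (auto simp: Basis_complex_def Basis_real2 complex_to_vec2_def inner_axis inner_complex_def axis_eq_axis)
  ultimately show "emeasure (distr lborel borel vec2_to_complex) (box l u) = (\<Prod>b\<in>Basis. (u - l) \<bullet> b)"
    by (subst emeasure_distr) auto
qed simp

lemma set_integrable_vec2:
  fixes F :: "complex \<Rightarrow> complex"
  assumes [measurable]: "(\<lambda>z. indicator S z *\<^sub>R F z) \<in> borel_measurable borel"
  shows "set_integrable lborel S F \<longleftrightarrow>
      (\<lambda>v. complex_to_vec2 (F (vec2_to_complex v))) absolutely_integrable_on (complex_to_vec2 ` S)" (is "_ \<longleftrightarrow> ?R")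
    and "set_integrable lborel S F \<Longrightarrow>
      integral (complex_to_vec2 ` S) (\<lambda>v. complex_to_vec2 (F (vec2_to_complex v))) =
      complex_to_vec2 (LINT z:S|lborel. F z)"
proof -
  have m [measurable]: "vec2_to_complex \<in> borel_measurable borel" "complex_to_vec2 \<in> borel_measurable borel"
    by (intro borel_measurable_continuous_onI linear_continuous_on bounded_linear_vec2_to_complex
       bounded_linear_complex_to_vec2)+
  let ?F = "\<lambda>v. indicator S (vec2_to_complex v) *\<^sub>R F (vec2_to_complex v)"
  let ?G = "\<lambda>v. indicator (complex_to_vec2 ` S) v *\<^sub>R complex_to_vec2 (F (vec2_to_complex v))"
  have ind: "indicator (complex_to_vec2 ` S) v = (indicator S (vec2_to_complex v) :: real)" for v
    unfolding image_complex_to_vec2 by (auto simp: indicator_def)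
  have FG: "?G v = complex_to_vec2 (?F v)" for v
    unfolding ind using bounded_linear.linear[OF bounded_linear_complex_to_vec2] by (simp add: linear_scale)
  have GF: "?F v = vec2_to_complex (?G v)" for v
    by (simp add: FG)
  have mF [measurable]: "?F \<in> borel_measurable borel"
    using measurable_compose[OF m(1) assms] by simp
  have mG [measurable]: "?G \<in> borel_measurable borel" unfolding FG by measurable
  have "set_integrable lborel S F \<longleftrightarrow> integrable (distr lborel borel vec2_to_complex) (\<lambda>z. indicator S z *\<^sub>R F z)"
    by (simp add: set_integrable_def lborel_distr_vec2_to_complex[symmetric])
  also have "\<dots> \<longleftrightarrow> integrable lborel ?F"
    by (subst integrable_distr_eq) auto
  also have "\<dots> \<longleftrightarrow> integrable lborel ?G"
    using integrable_bounded_linear[OF bounded_linear_complex_to_vec2, of lborel ?F]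
      integrable_bounded_linear[OF bounded_linear_vec2_to_complex, of lborel ?G]
    unfolding FG[symmetric] GF[symmetric] by blast
  also have "\<dots> \<longleftrightarrow> ?R"
    unfolding set_integrable_def by (subst integrable_completion) auto
  finally show iff: "set_integrable lborel S F \<longleftrightarrow> ?R" .
  assume int: "set_integrable lborel S F"
  have iF: "integrable lborel ?F"
    using int \<open>set_integrable lborel S F \<longleftrightarrow> integrable (distr lborel borel vec2_to_complex) (\<lambda>z. indicator S z *\<^sub>R F z)\<close>
    by (subst (asm) integrable_distr_eq) auto
  have "complex_to_vec2 (LINT z:S|lborel. F z) = complex_to_vec2 (LINT z|distr lborel borel vec2_to_complex. indicator S z *\<^sub>R F z)"
    by (simp add: set_lebesgue_integral_def lborel_distr_vec2_to_complex[symmetric])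
  also have "\<dots> = complex_to_vec2 (LINT v|lborel. ?F v)"
    by (subst integral_distr) auto
  also have "\<dots> = (LINT v|lborel. ?G v)"
    unfolding FG using integral_bounded_linear[OF bounded_linear_complex_to_vec2 iF] by simp
  also have "\<dots> = (LINT v|lebesgue. ?G v)"
    by (subst integral_completion) auto
  also have "\<dots> = integral (complex_to_vec2 ` S) (\<lambda>v. complex_to_vec2 (F (vec2_to_complex v)))"
    using set_lebesgue_integral_eq_integral(2)[of "complex_to_vec2 ` S"] iff int
    by (auto simp: set_lebesgue_integral_def)
  finally show "integral (complex_to_vec2 ` S) (\<lambda>v. complex_to_vec2 (F (vec2_to_complex v))) =
      complex_to_vec2 (LINT z:S|lborel. F z)" ..
qed

lemma det_complex_mult:
  "det (matrix (\<lambda>h. complex_to_vec2 (d * vec2_to_complex h))) = (cmod d)\<^sup>2"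
  unfolding cmod_power2
  by (simp add: det_2 matrix_def complex_to_vec2_def vec2_to_complex_def axis_def power2_eq_square)

text \<open>The real Jacobian of a complex derivative $d$ is $|d|^2$. The set need not be open: the derivative is taken
within it, which is what allows for boundary points. Measurability is assumed only of the integrands cut
off to the sets, since coordinate representations are arbitrary outside the image of a chart.\<close>

theorem complex_change_of_variables:
  fixes f g :: "complex \<Rightarrow> complex"
  assumes S: "S \<in> sets borel"
    and der: "\<And>z. z \<in> S \<Longrightarrow> (g has_field_derivative g' z) (at z within S)"
    and inj: "inj_on g S"
    and mf: "(\<lambda>z. indicator (g ` S) z *\<^sub>R f z) \<in> borel_measurable borel"
    and mfg: "(\<lambda>z. indicator S z *\<^sub>R (of_real ((cmod (g' z))\<^sup>2) * f (g z))) \<in> borel_measurable borel"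
  shows "set_integrable lborel S (\<lambda>z. of_real ((cmod (g' z))\<^sup>2) * f (g z)) \<longleftrightarrow> set_integrable lborel (g ` S) f"
    and "(LINT z:S|lborel. of_real ((cmod (g' z))\<^sup>2) * f (g z)) = (LINT z:g ` S|lborel. f z)"
proof -
  let ?c = complex_to_vec2 and ?v = vec2_to_complex
  let ?g = "\<lambda>v. ?c (g (?v v))"
  let ?fg = "\<lambda>z. of_real ((cmod (g' z))\<^sup>2) * f (g z)"
  have S': "?c ` S \<in> sets lebesgue"
  proof -
    have m: "?v \<in> borel_measurable borel"
      by (intro borel_measurable_continuous_onI linear_continuous_on bounded_linear_vec2_to_complex)
    have "?c ` S \<in> sets borel"
      unfolding image_complex_to_vec2 using measurable_sets[OF m S] by simp
    then show ?thesis by simp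
  qed
  have "(?g has_derivative (\<lambda>h. ?c (g' (?v v) * ?v h))) (at v within ?c ` S)" if v: "v \<in> ?c ` S" for v
  proof -
    have 1: "(?v has_derivative ?v) (at v within ?c ` S)"
      by (rule bounded_linear_imp_has_derivative[OF bounded_linear_vec2_to_complex])
    have "(g has_derivative (*) (g' (?v v))) (at (?v v) within ?v ` ?c ` S)"
      using der[of "?v v"] v by (auto simp: has_field_derivative_def image_image)
    from diff_chain_within[OF 1 this]
    have "((\<lambda>v. g (?v v)) has_derivative (\<lambda>h. g' (?v v) * ?v h)) (at v within ?c ` S)"
      by (simp add: o_def)
    from bounded_linear.has_derivative[OF bounded_linear_complex_to_vec2 this] show ?thesis .
  qed
  moreover have "inj_on ?g (?c ` S)"
  proof (rule inj_onI)
    fix a b assume "a \<in> ?c ` S" "b \<in> ?c ` S" "?g a = ?g b"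
    then have "g (?v a) = g (?v b)" "?v a \<in> S" "?v b \<in> S"
      by (auto dest: arg_cong[where f = ?v])
    then have "?v a = ?v b" using inj by (auto dest: inj_onD)
    then show "a = b" by (metis vec2_complex_inverse(2))
  qed
  ultimately have cov: "(\<lambda>v. \<bar>det (matrix (\<lambda>h. ?c (g' (?v v) * ?v h)))\<bar> *\<^sub>R ?c (f (?v (?g v)))) absolutely_integrable_on (?c ` S) \<and>
           integral (?c ` S) (\<lambda>v. \<bar>det (matrix (\<lambda>h. ?c (g' (?v v) * ?v h)))\<bar> *\<^sub>R ?c (f (?v (?g v)))) = b
     \<longleftrightarrow> (\<lambda>v. ?c (f (?v v))) absolutely_integrable_on (?g ` ?c ` S) \<and> integral (?g ` ?c ` S) (\<lambda>v. ?c (f (?v v))) = b" for b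
    by (rule has_absolute_integral_change_of_variables[OF S', of ?g _ "\<lambda>v. ?c (f (?v v))" b])
  have 1: "\<bar>det (matrix (\<lambda>h. ?c (g' (?v v) * ?v h)))\<bar> *\<^sub>R ?c (f (?v (?g v))) = ?c (?fg (?v v))" for v
  proof -
    have "?fg (?v v) = (cmod (g' (?v v)))\<^sup>2 *\<^sub>R f (g (?v v))" by (simp add: scaleR_conv_of_real)
    then show ?thesis
      using linear_scale[OF bounded_linear.linear[OF bounded_linear_complex_to_vec2]]
      by (simp add: det_complex_mult)
  qed
  have 2: "?g ` ?c ` S = ?c ` (g ` S)" by (simp add: image_image)
  note cov = cov[unfolded 1 2]
  show iff: "set_integrable lborel S ?fg \<longleftrightarrow> set_integrable lborel (g ` S) f"
    unfolding set_integrable_vec2(1)[OF mf] set_integrable_vec2(1)[OF mfg] using cov by blast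
  show "(LINT z:S|lborel. ?fg z) = (LINT z:g ` S|lborel. f z)"
  proof (cases "set_integrable lborel S ?fg")
    case True
    have "?c (LINT z:S|lborel. ?fg z) = ?c (LINT z:g ` S|lborel. f z)"
      using cov True iff set_integrable_vec2[OF mf] set_integrable_vec2[OF mfg] by metis
    then show ?thesis by (metis vec2_complex_inverse(1))
  next
    case False
    then show ?thesis using iff
      by (simp add: set_integrable_def set_lebesgue_integral_def not_integrable_integral_eq)
  qed
qed

lemma lborel_distr_Complex: "lborel = distr lborel borel (\<lambda>(x, y). Complex x y)"
proof (rule lborel_eqI)
  fix l u :: complex
  assume le: "\<And>b. b \<in> Basis \<Longrightarrow> l \<bullet> b \<le> u \<bullet> b"
  have m [measurable]: "(\<lambda>(x, y). Complex x y) \<in> borel_measurable borel"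
    unfolding Complex_eq split_def by (intro borel_measurable_continuous_onI continuous_intros)
  have "(\<lambda>(x, y). Complex x y) -` box l u = box (Re l, Im l) (Re u, Im u)"
    by (auto simp: box_def Basis_complex_def Basis_prod_def inner_complex_def)
  moreover have "emeasure lborel (box (Re l, Im l) (Re u, Im u)) = (\<Prod>b\<in>Basis. (u - l) \<bullet> b)"
    using le[of 1] le[of \<i>]
    by (subst emeasure_lborel_box)
       (auto simp: Basis_complex_def Basis_prod_def inner_complex_def)
  ultimately show "emeasure (distr lborel borel (\<lambda>(x, y). Complex x y)) (box l u) = (\<Prod>b\<in>Basis. (u - l) \<bullet> b)"
    by (subst emeasure_distr) auto
qed simp

lemma integral_rectangle:
  fixes f :: "complex \<Rightarrow> complex"
  assumes f: "continuous_on (cbox (Complex a c) (Complex b d)) f"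
  shows "(LINT z:cbox (Complex a c) (Complex b d)|lborel. f z) =
       integral {a..b} (\<lambda>x. integral {c..d} (\<lambda>y. f (Complex x y)))" (is ?A)
    and "(LINT z:cbox (Complex a c) (Complex b d)|lborel. f z) =
       integral {c..d} (\<lambda>y. integral {a..b} (\<lambda>x. f (Complex x y)))" (is ?B)
proof -
  let ?C = "\<lambda>p::real \<times> real. Complex (fst p) (snd p)" and ?R = "cbox (Complex a c) (Complex b d)"
  have C: "continuous_on UNIV ?C"
    unfolding Complex_eq by (intro continuous_intros)
  have m [measurable]: "?C \<in> borel_measurable borel"
    using C by (rule borel_measurable_continuous_onI)
  have vim: "?C p \<in> ?R \<longleftrightarrow> p \<in> cbox (a, c) (b, d)" for p
    by (auto simp: in_cbox_complex_iff cbox_Pair_eq mem_Times_iff)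
  have fC: "continuous_on (cbox (a, c) (b, d)) (\<lambda>p. f (?C p))"
    by (rule continuous_on_compose2[OF f continuous_on_subset[OF C]]) (use vim in auto)
  have mf: "(\<lambda>z. indicator ?R z *\<^sub>R f z) \<in> borel_measurable borel"
    using borel_integrable_compact[OF compact_cbox f] by auto
  have "(LINT z:?R|lborel. f z) = (LINT z|distr lborel borel ?C. indicator ?R z *\<^sub>R f z)"
    using lborel_distr_Complex by (simp add: set_lebesgue_integral_def split_def)
  also have "\<dots> = (LINT p:cbox (a, c) (b, d)|lborel. f (?C p))"
    unfolding set_lebesgue_integral_def using mf
    by (subst integral_distr) (auto intro!: Bochner_Integration.integral_cong simp: indicator_def vim)
  also have "\<dots> = integral (cbox (a, c) (b, d)) (\<lambda>p. f (?C p))"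
    by (rule set_borel_integral_eq_integral(2))
       (use borel_integrable_compact[OF compact_cbox fC] in \<open>simp add: set_integrable_def\<close>)
  also have eq: "\<dots> = integral {a..b} (\<lambda>x. integral {c..d} (\<lambda>y. f (Complex x y)))"
    using integral_prod_continuous[OF fC] by simp
  finally show ?A .
  also have "\<dots> = integral {c..d} (\<lambda>y. integral {a..b} (\<lambda>x. f (Complex x y)))"
    using integral_swap_continuous[of a c b d "\<lambda>x y. f (Complex x y)"] fC by (simp add: split_def)
  finally show ?B .
qed

text \<open>Fubini and the fundamental theorem of calculus in each variable. Differentiability is assumed only
in the interior, so that functions known merely to be smooth up to an edge of the rectangle are covered.\<close>

lemma stokes_rectangle:
  fixes F Fx Fy :: "complex \<Rightarrow> complex"
  assumes le: "a \<le> b" "c \<le> d"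
    and cont: "continuous_on (cbox (Complex a c) (Complex b d)) F"
      "continuous_on (cbox (Complex a c) (Complex b d)) Fx"
      "continuous_on (cbox (Complex a c) (Complex b d)) Fy"
    and der: "\<And>z. z \<in> box (Complex a c) (Complex b d) \<Longrightarrow>
       (F has_derivative (\<lambda>h. Re h *\<^sub>R Fx z + Im h *\<^sub>R Fy z)) (at z)"
  shows "(LINT z:cbox (Complex a c) (Complex b d)|lborel. (Fx z - \<i> * Fy z) / 2) =
    (integral {c..d} (\<lambda>y. F (Complex b y)) - integral {c..d} (\<lambda>y. F (Complex a y))
     - \<i> * (integral {a..b} (\<lambda>x. F (Complex x d)) - integral {a..b} (\<lambda>x. F (Complex x c)))) / 2"
proof -
  let ?R = "cbox (Complex a c) (Complex b d)"
  have int: "set_integrable lborel ?R f" if "continuous_on ?R f" for f :: "complex \<Rightarrow> complex"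
    using borel_integrable_compact[OF compact_cbox that] by (simp add: set_integrable_def)
  have cx: "continuous_on {c..d} (\<lambda>y. F (Complex x y))" if "x \<in> {a..b}" for x
    unfolding Complex_eq
    by (rule continuous_on_compose2[OF cont(1)])
       (use that in \<open>auto intro!: continuous_intros simp: in_cbox_complex_iff\<close>)
  have cy: "continuous_on {a..b} (\<lambda>x. F (Complex x y))" if "y \<in> {c..d}" for y
    unfolding Complex_eq
    by (rule continuous_on_compose2[OF cont(1)])
       (use that in \<open>auto intro!: continuous_intros simp: in_cbox_complex_iff\<close>)
  have ftcy: "integral {c..d} (\<lambda>y. Fy (Complex x y)) = F (Complex x d) - F (Complex x c)" if x: "x \<in> {a<..<b}" for x
  proof (rule integral_unique, rule fundamental_theorem_of_calculus_interior[OF le(2) cx])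
    fix y assume y: "y \<in> {c<..<d}"
    have D: "((\<lambda>y. Complex x y) has_derivative (\<lambda>h. \<i> * of_real h)) (at y)"
      unfolding Complex_eq by (auto intro!: derivative_eq_intros)
    from has_derivative_compose[OF D der[of "Complex x y"]] x y
    show "((\<lambda>y. F (Complex x y)) has_vector_derivative Fy (Complex x y)) (at y)"
      by (simp add: has_vector_derivative_def in_box_complex_iff)
  qed (use x in auto)
  have ftcx: "integral {a..b} (\<lambda>x. Fx (Complex x y)) = F (Complex b y) - F (Complex a y)" if y: "y \<in> {c<..<d}" for y
  proof (rule integral_unique, rule fundamental_theorem_of_calculus_interior[OF le(1) cy])
    fix x assume x: "x \<in> {a<..<b}"
    have D: "((\<lambda>x. Complex x y) has_derivative (\<lambda>h. of_real h)) (at x)"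
      unfolding Complex_eq by (auto intro!: derivative_eq_intros)
    from has_derivative_compose[OF D der[of "Complex x y"]] x y
    show "((\<lambda>x. F (Complex x y)) has_vector_derivative Fx (Complex x y)) (at x)"
      by (simp add: has_vector_derivative_def in_box_complex_iff)
  qed (use y in auto)
  have X: "(LINT z:?R|lborel. Fx z) = integral {c..d} (\<lambda>y. F (Complex b y)) - integral {c..d} (\<lambda>y. F (Complex a y))"
  proof -
    have "(LINT z:?R|lborel. Fx z) = integral {c..d} (\<lambda>y. integral {a..b} (\<lambda>x. Fx (Complex x y)))"
      by (rule integral_rectangle(2)[OF cont(2)])
    also have "\<dots> = integral {c..d} (\<lambda>y. F (Complex b y) - F (Complex a y))"
      \<comment> \<open>On the two horizontal sides the derivative is not assumed to exist.\<close>
      by (rule integral_spike[of "{c, d}"]) (use ftcx in auto)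
    also have "\<dots> = integral {c..d} (\<lambda>y. F (Complex b y)) - integral {c..d} (\<lambda>y. F (Complex a y))"
      by (rule integral_diff) (use cx le in \<open>auto intro: integrable_continuous_real\<close>)
    finally show ?thesis .
  qed
  have Y: "(LINT z:?R|lborel. Fy z) = integral {a..b} (\<lambda>x. F (Complex x d)) - integral {a..b} (\<lambda>x. F (Complex x c))"
  proof -
    have "(LINT z:?R|lborel. Fy z) = integral {a..b} (\<lambda>x. integral {c..d} (\<lambda>y. Fy (Complex x y)))"
      by (rule integral_rectangle(1)[OF cont(3)])
    also have "\<dots> = integral {a..b} (\<lambda>x. F (Complex x d) - F (Complex x c))"
      by (rule integral_spike[of "{a, b}"]) (use ftcy in auto)
    also have "\<dots> = integral {a..b} (\<lambda>x. F (Complex x d)) - integral {a..b} (\<lambda>x. F (Complex x c))"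
      by (rule integral_diff) (use cy le in \<open>auto intro: integrable_continuous_real\<close>)
    finally show ?thesis .
  qed
  have "(LINT z:?R|lborel. (Fx z - \<i> * Fy z) / 2) = ((LINT z:?R|lborel. Fx z) - \<i> * (LINT z:?R|lborel. Fy z)) / 2"
    using int[OF cont(2)] int[OF cont(3)] by (simp add: set_integral_diff)
  then show ?thesis unfolding X Y .
qed

text \<open>This is why logarithmic poles are harmless for integration. On the dyadic annulus of outer radius
$r/2^n$ the function is at most $2^{n+1}/r$ while the area is of order $r^2/4^n$, so the contributions form
a geometric series.\<close>

lemma inverse_norm_integrable:
  assumes r: "r > 0"
  shows "set_integrable lborel (cball 0 r) (\<lambda>z::complex. 1 / norm z)"
proof -
  let ?f = "\<lambda>z::complex. indicator (cball 0 r) z * (1 / norm z)"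
  let ?T = "\<lambda>n z. ennreal (2 ^ Suc n / r) * indicator (cball (0::complex) (r / 2 ^ n)) z"
  have [measurable]: "cball (0::complex) e \<in> sets borel" for e by (simp add: borel_closed)
  have pt: "ennreal (?f z) \<le> (\<Sum>n. ?T n z)" for z
  proof (cases "z \<noteq> 0 \<and> norm z \<le> r")
    case True
    have "\<exists>n. r / 2 ^ n < norm z"
      using True r real_arch_pow_inv[of "norm z / r" "1/2"] by (auto simp: field_simps power_divide)
    \<comment> \<open>The annulus that contains the point.\<close>
    define n where "n = (LEAST n. r / 2 ^ n < norm z)"
    have n: "r / 2 ^ n < norm z" unfolding n_def by (rule LeastI_ex) fact
    then obtain m where m: "n = Suc m" using True by (cases n) auto
    have "\<not> r / 2 ^ m < norm z" using not_less_Least[of m "\<lambda>n. r / 2 ^ n < norm z"] m n_def by auto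
    then have ind: "indicator (cball (0::complex) (r / 2 ^ m)) z = (1::ennreal)" by (auto simp: indicator_def)
    have "1 / norm z \<le> 2 ^ Suc m / r" using n m r True by (simp add: field_simps)
    then have "ennreal (?f z) \<le> ?T m z" using True unfolding ind by (simp add: ennreal_leI)
    also have "\<dots> = sum (\<lambda>n. ?T n z) {m}" by (subst sum.insert) (auto simp del: sum_mult_indicator)
    also have "\<dots> \<le> (\<Sum>n. ?T n z)" by (rule sum_le_suminf) auto
    finally show ?thesis .
  qed (auto simp: indicator_def)
  have "(\<integral>\<^sup>+z. ennreal (norm (?f z)) \<partial>lborel) \<le> (\<integral>\<^sup>+z. (\<Sum>n. ?T n z) \<partial>lborel)"
    by (rule nn_integral_mono) (use pt in auto)
  also have "\<dots> = (\<Sum>n. ennreal (2 ^ Suc n / r) * emeasure lborel (cball (0::complex) (r / 2 ^ n)))"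
    by (subst nn_integral_suminf) (simp_all add: nn_integral_cmult_indicator)
  also have "\<dots> = (\<Sum>n. ennreal (2 * unit_ball_vol 2 * r * (1/2) ^ n))"
  proof (rule suminf_cong)
    fix n
    have "emeasure lborel (cball (0::complex) (r / 2 ^ n)) = ennreal (unit_ball_vol 2 * (r / 2 ^ n)\<^sup>2)"
      using r emeasure_cball[of "r / 2 ^ n" "0::complex"] by simp
    then have "ennreal (2 ^ Suc n / r) * emeasure lborel (cball (0::complex) (r / 2 ^ n)) =
       ennreal (2 ^ Suc n / r * (unit_ball_vol 2 * (r / 2 ^ n)\<^sup>2))"
      by (simp only:) (rule ennreal_mult'[symmetric], use r in auto)
    also have "2 ^ Suc n / r * (unit_ball_vol 2 * (r / 2 ^ n)\<^sup>2) = 2 * unit_ball_vol 2 * r * (1/2) ^ n"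
      using r by (simp add: field_simps power2_eq_square)
    finally show "ennreal (2 ^ Suc n / r) * emeasure lborel (cball (0::complex) (r / 2 ^ n)) =
       ennreal (2 * unit_ball_vol 2 * r * (1/2) ^ n)" .
  qed
  also have "\<dots> = ennreal (\<Sum>n. 2 * unit_ball_vol 2 * r * (1/2) ^ n)"
    by (rule suminf_ennreal2) (use r in \<open>auto intro!: summable_mult summable_geometric\<close>)
  also have "\<dots> < \<infinity>" by simp
  finally have "integrable lborel ?f"
    by (intro integrableI_bounded) auto
  then show ?thesis by (simp add: set_integrable_def)
qed

section \<open>Removing a disc about a pole in the plane\<close>

text \<open>The Wirtinger derivatives $\partial/\partial z$ and $\partial/\partial\bar z$.\<close>

definition dz_part :: "(complex \<Rightarrow> complex) \<Rightarrow> complex \<Rightarrow> complex" where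
  "dz_part h z = (pdx h z - \<i> * pdy h z) / 2"

definition dzbar_part :: "(complex \<Rightarrow> complex) \<Rightarrow> complex \<Rightarrow> complex" where
  "dzbar_part h z = (pdx h z + \<i> * pdy h z) / 2"

lemma Ck_dz_part:
  assumes "open V" "\<forall>k. Ck k V h"
  shows "Ck k V (dz_part h)" "Ck k V (dzbar_part h)"
proof -
  have "Ck (Suc k) V h" using assms(2) by blast
  note * = Ck_pdx[OF assms(1) this] Ck_pdy[OF assms(1) this]
  have "Ck k V (\<lambda>z. (1/2) * (pdx h z - \<i> * pdy h z))" "Ck k V (\<lambda>z. (1/2) * (pdx h z + \<i> * pdy h z))"
    by (intro Ck_mult Ck_const Ck_diff Ck_add *)+
  then show "Ck k V (dz_part h)" "Ck k V (dzbar_part h)"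
    by (auto simp: dz_part_def[abs_def] dzbar_part_def[abs_def])
qed

lemma Ck_has_derivative_partials:
  assumes "open V" "Ck (Suc k) V h" "z \<in> V"
  shows "(h has_derivative (\<lambda>k. Re k *\<^sub>R pdx h z + Im k *\<^sub>R pdy h z)) (at z)"
  using assms by (simp add: Ck_Suc_iff differentiable_partials)

text \<open>The total derivative of $h(e^w)e^{-mw}$ in terms of the Wirtinger derivatives of $h$.
It serves both for differentiating along a circle and for Stokes in logarithmic coordinates.\<close>

lemma has_derivative_exp_twisted:
  fixes h :: "complex \<Rightarrow> complex"
  assumes "Ck 1 UNIV h"
  shows "((\<lambda>w. h (exp w) * exp (- of_nat m * w)) has_derivative
    (\<lambda>k. Re k *\<^sub>R ((dz_part h (exp w) * exp w + dzbar_part h (exp w) * exp (cnj w)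
                  - of_nat m * h (exp w)) * exp (- of_nat m * w)) +
         Im k *\<^sub>R (\<i> * (dz_part h (exp w) * exp w - dzbar_part h (exp w) * exp (cnj w)
                  - of_nat m * h (exp w)) * exp (- of_nat m * w)))) (at w)"
proof -
  let ?d = "exp w"
  have h: "(h has_derivative (\<lambda>k. Re k *\<^sub>R pdx h ?d + Im k *\<^sub>R pdy h ?d)) (at ?d)"
    using assms Ck_has_derivative_partials[of UNIV 0 h ?d] by simp
  have 1: "((\<lambda>w. h (exp w)) has_derivative (\<lambda>k. Re k *\<^sub>R (Re ?d *\<^sub>R pdx h ?d + Im ?d *\<^sub>R pdy h ?d)
      + Im k *\<^sub>R (Re ?d *\<^sub>R pdy h ?d - Im ?d *\<^sub>R pdx h ?d))) (at w)"
    by (rule has_derivative_compose_holomorphic[OF h DERIV_exp])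
  have 2: "((\<lambda>w. exp (- of_nat m * w)) has_derivative (\<lambda>k. - of_nat m * exp (- of_nat m * w) * k)) (at w)"
    unfolding has_field_derivative_def[symmetric] by (auto intro!: derivative_eq_intros)
  have e: "exp (cnj w) = cnj ?d" by (simp add: exp_cnj)
  have X: "Re ?d *\<^sub>R pdx h ?d + Im ?d *\<^sub>R pdy h ?d = dz_part h ?d * ?d + dzbar_part h ?d * cnj ?d"
    and Y: "Re ?d *\<^sub>R pdy h ?d - Im ?d *\<^sub>R pdx h ?d = \<i> * (dz_part h ?d * ?d - dzbar_part h ?d * cnj ?d)"
    by (auto simp: complex_eq_iff dz_part_def dzbar_part_def field_simps)
  show ?thesis
    by (rule has_derivative_eq_rhs[OF has_derivative_mult[OF 1[unfolded X Y] 2]])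
       (auto simp: fun_eq_iff e complex_eq_iff algebra_simps)
qed

text \<open>With $z = e^{s+it}$ this is $-i\oint h(z)\,z^{-m-1}\,dz$ over the circle of radius $e^s$.\<close>

definition circle_coefficient :: "(complex \<Rightarrow> complex) \<Rightarrow> nat \<Rightarrow> real \<Rightarrow> complex" where
  "circle_coefficient h m s = integral {0..2 * pi} (\<lambda>t. h (exp (Complex s t)) * exp (- of_nat m * Complex s t))"

lemma continuous_on_circle_coefficient:
  assumes "continuous_on UNIV h"
  shows "continuous_on T (\<lambda>t. h (exp (Complex s t)) * exp (- of_nat m * Complex s t))"
  unfolding Complex_eq
  by (intro continuous_intros continuous_on_compose2[OF assms]) auto

lemma exp_Complex_2pi: "exp (Complex s (2 * pi)) = exp (Complex s 0)"
  by (simp add: exp_eq_polar)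

text \<open>The integral of $\frac{d}{dt}\bigl(h(e^w)e^{-mw}\bigr)$ over a full turn vanishes; on the circle
$e^{\bar w} = e^{2s}e^{-w}$.\<close>

lemma circle_coefficient_by_parts:
  assumes h: "\<forall>k. Ck k UNIV h" and m: "m \<ge> 1"
  shows "of_nat m * circle_coefficient h m s = circle_coefficient (dz_part h) (m - 1) s -
           of_real (exp (2 * s)) * circle_coefficient (dzbar_part h) (m + 1) s"
proof -
  have c: "continuous_on UNIV h" "continuous_on UNIV (dz_part h)" "continuous_on UNIV (dzbar_part h)"
    using h Ck_dz_part[OF _ h] Ck_imp_continuous_on by blast+
  note i = continuous_on_circle_coefficient[THEN integrable_continuous_real]
  let ?H = "\<lambda>t. h (exp (Complex s t)) * exp (- of_nat m * Complex s t)"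
  let ?D = "\<lambda>t. \<i> * (dz_part h (exp (Complex s t)) * exp (- of_nat (m - 1) * Complex s t)
        - of_real (exp (2 * s)) * (dzbar_part h (exp (Complex s t)) * exp (- of_nat (m + 1) * Complex s t))
        - of_nat m * ?H t)"
  have H: "(?H has_vector_derivative ?D t) (at t within {0..2 * pi})" for t
  proof -
    let ?w = "Complex s t"
    have D: "((\<lambda>t. Complex s t) has_derivative (\<lambda>h. \<i> * of_real h)) (at t within {0..2 * pi})"
      unfolding Complex_eq by (auto intro!: derivative_eq_intros)
    have "Ck 1 UNIV h" using h by blast
    from has_derivative_compose[OF D has_derivative_exp_twisted[OF this]]
    have "(?H has_vector_derivative \<i> * (dz_part h (exp ?w) * exp ?w - dzbar_part h (exp ?w) * exp (cnj ?w)
                  - of_nat m * h (exp ?w)) * exp (- of_nat m * ?w)) (at t within {0..2 * pi})"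
      by (simp add: has_vector_derivative_def)
    have E1: "exp ?w * exp (- of_nat m * ?w) = exp (- of_nat (m - 1) * ?w)"
      unfolding exp_add[symmetric] using m by (simp add: of_nat_diff algebra_simps)
    have E2: "exp (cnj ?w) * exp (- of_nat m * ?w) = of_real (exp (2 * s)) * exp (- of_nat (m + 1) * ?w)"
      unfolding exp_of_real[symmetric] exp_add[symmetric]
      by (rule arg_cong[where f = exp]) (simp add: complex_eq_iff algebra_simps)
    define e0 e1 e2 r where "e0 = exp (- of_nat m * ?w)" "e1 = exp (- of_nat (m - 1) * ?w)"
      "e2 = exp (- of_nat (m + 1) * ?w)" "r = complex_of_real (exp (2 * s))"
    have E: "e1 = exp ?w * e0" "r * e2 = exp (cnj ?w) * e0"
      using E1 E2 by (simp_all only: e0_e1_e2_r_def)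
    have "?D t = \<i> * (dz_part h (exp ?w) * e1 - dzbar_part h (exp ?w) * (r * e2) - of_nat m * (h (exp ?w) * e0))"
      unfolding e0_e1_e2_r_def[symmetric] by (simp only: mult.left_commute)
    also have "\<dots> = \<i> * (dz_part h (exp ?w) * exp ?w - dzbar_part h (exp ?w) * exp (cnj ?w)
                  - of_nat m * h (exp ?w)) * e0"
      unfolding E by (simp add: algebra_simps)
    finally show ?thesis using \<open>(?H has_vector_derivative \<i> * (dz_part h (exp ?w) * exp ?w - dzbar_part h (exp ?w) * exp (cnj ?w)
                  - of_nat m * h (exp ?w)) * exp (- of_nat m * ?w)) (at t within {0..2 * pi})\<close>
      unfolding e0_e1_e2_r_def(1) by (simp only:)
  qed
  have "(?D has_integral (?H (2 * pi) - ?H 0)) {0..2 * pi}"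
    by (rule fundamental_theorem_of_calculus[OF _ H]) simp
  moreover have "?H (2 * pi) = ?H 0"
  proof -
    have "exp (- of_nat m * Complex s (2 * pi)) = exp (- of_nat m * Complex s 0)"
      using exp_Complex_2pi[of s] by (simp add: exp_minus exp_of_nat_mult)
    then show ?thesis by (simp add: exp_Complex_2pi)
  qed
  ultimately have "(?D has_integral 0) {0..2 * pi}" by (simp only: diff_self)
  then have "integral {0..2 * pi} ?D = 0" by (rule integral_unique)
  moreover have "integral {0..2 * pi} ?D = \<i> * (circle_coefficient (dz_part h) (m - 1) s -
           of_real (exp (2 * s)) * circle_coefficient (dzbar_part h) (m + 1) s - of_nat m * circle_coefficient h m s)"
    unfolding circle_coefficient_def integral_mult_right
    by (subst integral_diff integral_mult_right, (intro integrable_diff integrable_on_mult_right i c)+)+ simp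
  ultimately show ?thesis by simp
qed

text \<open>The trivial bound is $e^{-ms}$. Each integration by parts gains a factor $e^s$, because it lowers
$m$ by one or raises it by one at the price of $e^{2s}$, and it is possible as long as $m \ge 1$.
After $m$ steps the coefficient is seen to be bounded as the circle shrinks, without expanding $h$ into
a Taylor polynomial.\<close>

lemma circle_coefficient_bound:
  assumes "k \<le> m" "\<forall>k. Ck k UNIV h"
  shows "\<exists>C. \<forall>s\<le>0. norm (circle_coefficient h m s) \<le> C * exp ((real k - real m) * s)"
  using assms
proof (induction k arbitrary: h m)
  case 0
  have c: "continuous_on UNIV h" using 0 Ck_imp_continuous_on by blast
  then have "compact (h ` cball 0 1)" by (intro compact_continuous_image) (auto intro: continuous_on_subset)
  then obtain C where "\<forall>x\<in>h ` cball 0 1. norm x \<le> C"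
    using compact_imp_bounded bounded_iff by metis
  then have C: "norm (h z) \<le> C" if "norm z \<le> 1" for z using that by simp
  have "norm (circle_coefficient h m s) \<le> (C * 2 * pi) * exp ((real 0 - real m) * s)" if s: "s \<le> 0" for s
  proof -
    have "norm (circle_coefficient h m s) \<le> integral {0..2 * pi} (\<lambda>t. C * exp (- real m * s))"
      unfolding circle_coefficient_def
    proof (rule integral_norm_bound_integral)
      show "norm (h (exp (Complex s t)) * exp (- of_nat m * Complex s t)) \<le> C * exp (- real m * s)" for t
        using C[of "exp (Complex s t)"] s by (simp add: norm_mult mult_right_mono)
    qed (rule integrable_continuous_real continuous_on_circle_coefficient[OF c] continuous_on_const)+
    then show ?thesis by (simp add: algebra_simps)
  qed
  then show ?case by blast
next
  case (Suc k)
  then have m: "m \<ge> 1" "k \<le> m - 1" "k \<le> m + 1" by auto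
  have d: "\<forall>k. Ck k UNIV (dz_part h)" "\<forall>k. Ck k UNIV (dzbar_part h)"
    using Ck_dz_part[OF open_UNIV] Suc.prems by blast+
  obtain C1 where C1: "\<And>s. s \<le> 0 \<Longrightarrow> norm (circle_coefficient (dz_part h) (m - 1) s) \<le> C1 * exp ((real k - real (m - 1)) * s)"
    using Suc.IH[OF m(2) d(1)] by blast
  obtain C2 where C2: "\<And>s. s \<le> 0 \<Longrightarrow> norm (circle_coefficient (dzbar_part h) (m + 1) s) \<le> C2 * exp ((real k - real (m + 1)) * s)"
    using Suc.IH[OF m(3) d(2)] by blast
  have "norm (circle_coefficient h m s) \<le> (C1 + C2) * exp ((real (Suc k) - real m) * s)" if s: "s \<le> 0" for s
  proof -
    have e: "exp ((real k - real (m - 1)) * s) = exp ((real (Suc k) - real m) * s)"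
      using m by (simp add: of_nat_diff algebra_simps)
    have e2: "exp (2 * s) * exp ((real k - real (m + 1)) * s) = exp ((real (Suc k) - real m) * s)"
      unfolding exp_add[symmetric] by (simp add: algebra_simps)
    have "norm (circle_coefficient h m s) \<le> norm (of_nat m * circle_coefficient h m s)"
      using m by (auto simp: norm_mult mult_le_cancel_right1)
    also have "\<dots> \<le> norm (circle_coefficient (dz_part h) (m - 1) s) + exp (2 * s) * norm (circle_coefficient (dzbar_part h) (m + 1) s)"
      unfolding circle_coefficient_by_parts[OF Suc.prems(2) m(1)]
      by (rule order_trans[OF norm_triangle_ineq4]) (simp add: norm_mult)
    also have "\<dots> \<le> C1 * exp ((real k - real (m - 1)) * s) + exp (2 * s) * (C2 * exp ((real k - real (m + 1)) * s))"
      by (intro add_mono mult_left_mono C1 C2 s) auto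
    also have "\<dots> = (C1 + C2) * exp ((real (Suc k) - real m) * s)"
      using e e2 by (simp add: algebra_simps)
    finally show ?thesis .
  qed
  then show ?case by blast
qed

lemma set_integral_cong_AE_sets:
  fixes f g :: "complex \<Rightarrow> complex"
  assumes "(\<lambda>x. indicator A x *\<^sub>R f x) \<in> borel_measurable borel"
    "(\<lambda>x. indicator B x *\<^sub>R g x) \<in> borel_measurable borel"
    "AE x in lborel. indicator A x *\<^sub>R f x = indicator B x *\<^sub>R g x"
  shows "(LINT x:A|lborel. f x) = (LINT x:B|lborel. g x)"
  unfolding set_lebesgue_integral_def using assms by (intro integral_cong_AE) auto

lemma AE_Re_Im_neq: "AE z in lborel. Re z \<noteq> c" "AE z in lborel. Im z \<noteq> c"
  using AE_lborel_inner_neq[of "1::complex" c] AE_lborel_inner_neq[of \<i> c]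
  by (simp_all add: Basis_complex_def inner_complex_def)

text \<open>The exponential maps the open strip bijectively onto the annulus cut along the positive real axis, and the
cut is a null set.\<close>

lemma integral_exp_strip:
  fixes D :: "complex \<Rightarrow> complex"
  assumes r: "0 < r" "r < R" and D: "continuous_on (- {0}) D" and D0: "\<And>z. norm z \<ge> R \<Longrightarrow> D z = 0"
  shows "(LINT z:{z. r < norm z}|lborel. D z) =
    (LINT w:cbox (Complex (ln r) 0) (Complex (ln R) (2 * pi))|lborel. of_real ((cmod (exp w))\<^sup>2) * D (exp w))"
proof -
  let ?S = "box (Complex (ln r) 0) (Complex (ln R) (2 * pi))"
  let ?C = "cbox (Complex (ln r) 0) (Complex (ln R) (2 * pi))"
  let ?F = "\<lambda>w. of_real ((cmod (exp w))\<^sup>2) * D (exp w)"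
  have inj: "inj_on exp ?S"
    by (rule inj_onI, rule exp_complex_eqI) (auto simp: in_box_complex_iff)
  have op: "open (exp ` ?S)"
    by (rule open_mapping_thm3) (auto simp: inj intro!: holomorphic_intros)
  have im: "z \<in> exp ` ?S" if "r < norm z" "norm z < R" "Im z \<noteq> 0" for z
  proof -
    have "norm z > 0" using that r by linarith
    have "is_Arg z (Arg2pi z)" using Arg2pi[of z] by simp
    then have z1: "z = norm z * cis (Arg2pi z)" by (simp add: is_Arg_def cis_conv_exp)
    then have z: "z = exp (Complex (ln (norm z)) (Arg2pi z))"
      using \<open>norm z > 0\<close> by (simp add: exp_eq_polar)
    have "Arg2pi z \<noteq> 0"
    proof
      assume "Arg2pi z = 0"
      with z1 have "z = of_real (norm z)" by simp
      with that(3) show False by (metis Im_complex_of_real)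
    qed
    then have "Complex (ln (norm z)) (Arg2pi z) \<in> ?S"
      using that r \<open>norm z > 0\<close> Arg2pi[of z] by (auto simp: in_box_complex_iff less_le)
    then show ?thesis using z by blast
  qed
  have im2: "r < norm z" "norm z < R" if z: "z \<in> exp ` ?S" for z
  proof -
    obtain w where w: "z = exp w" "ln r < Re w" "Re w < ln R" using z by (auto simp: in_box_complex_iff)
    then have "exp (ln r) < exp (Re w)" "exp (Re w) < exp (ln R)" by simp_all
    then show "r < norm z" "norm z < R" using r w by simp_all
  qed
  have cF: "continuous_on UNIV ?F"
    by (intro continuous_intros continuous_on_compose2[OF D]) auto
  have mf: "(\<lambda>z. indicator (exp ` ?S) z *\<^sub>R D z) \<in> borel_measurable borel"
    by (rule borel_measurable_continuous_on_indicator) (use op D r im2 in \<open>force intro: continuous_on_subset\<close>)+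
  have mA: "(\<lambda>z. indicator {z. r < norm z} z *\<^sub>R D z) \<in> borel_measurable borel"
  proof (rule borel_measurable_continuous_on_indicator)
    show "{z::complex. r < cmod z} \<in> sets borel"
      by (intro borel_open open_Collect_less continuous_intros)
  qed (use D r in \<open>auto intro: continuous_on_subset\<close>)
  have "(LINT z:{z. r < norm z}|lborel. D z) = (LINT z:exp ` ?S|lborel. D z)"
  proof (rule set_integral_cong_AE_sets[OF mA mf])
    show "AE z in lborel. indicator {z. r < norm z} z *\<^sub>R D z = indicator (exp ` ?S) z *\<^sub>R D z"
      using AE_Re_Im_neq(2)[of 0]
    proof eventually_elim
      case (elim z)
      consider "r < norm z" "norm z < R" | "norm z \<ge> R" | "norm z \<le> r" by linarith
      then show ?case
        by cases (use elim im[of z] im2[of z] D0[of z] in \<open>auto simp: indicator_def\<close>)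
    qed
  qed
  also have "\<dots> = (LINT w:?S|lborel. ?F w)"
  proof (rule complex_change_of_variables(2)[symmetric, where g' = exp, OF _ _ inj mf])
    show "(\<lambda>z. indicator ?S z *\<^sub>R ?F z) \<in> borel_measurable borel"
      by (rule borel_measurable_continuous_on_indicator) (use cF in \<open>auto intro: continuous_on_subset\<close>)
  qed (auto intro!: derivative_eq_intros)
  also have "\<dots> = (LINT w:?C|lborel. ?F w)"
  proof (rule set_integral_cong_AE_sets)
    show "AE w in lborel. indicator ?S w *\<^sub>R ?F w = indicator ?C w *\<^sub>R ?F w"
      using AE_Re_Im_neq(1)[of "ln r"] AE_Re_Im_neq(1)[of "ln R"] AE_Re_Im_neq(2)[of 0] AE_Re_Im_neq(2)[of "2 * pi"]
      by eventually_elim (auto simp: indicator_def in_box_complex_iff in_cbox_complex_iff less_le)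
  qed (rule borel_measurable_continuous_on_indicator; use cF in \<open>auto intro: continuous_on_subset\<close>)+
  finally show ?thesis .
qed

text \<open>In the coordinate $w = \log z$ the form $\partial\bigl(h z^{-N}d\bar z\bigr)$ becomes the $\partial_w$-derivative of
$h(e^w)e^{-Nw}e^{\bar w}$. Stokes on the rectangle leaves only the side that corresponds to the
inner circle: the two horizontal sides cancel by periodicity and the outer side lies off the support.\<close>

lemma punctured_plane_integral:
  fixes h :: "complex \<Rightarrow> complex"
  assumes h: "\<forall>k. Ck k UNIV h" and h0: "\<And>z. norm z \<ge> R \<Longrightarrow> h z = 0" and r: "0 < r" "r < R"
  shows "(LINT z:{z. r < norm z}|lborel. dz_part h z / z ^ N - of_nat N * h z / z ^ (N + 1)) =
    - (of_real (r\<^sup>2) * circle_coefficient h (N + 1) (ln r) / 2)"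
proof -
  let ?D = "\<lambda>z. dz_part h z / z ^ N - of_nat N * h z / z ^ (N + 1)"
  have c: "continuous_on UNIV h" "continuous_on UNIV (dz_part h)" "continuous_on UNIV (dzbar_part h)"
    using h Ck_dz_part[OF _ h] Ck_imp_continuous_on by blast+
  have R: "0 < R" using r by linarith
  have dz0: "dz_part h z = 0" if "norm z > R" for z
  proof -
    have "((\<lambda>_. 0) has_derivative (\<lambda>k. Re k *\<^sub>R 0 + Im k *\<^sub>R 0)) (at z)" by simp
    then have "(h has_derivative (\<lambda>k. Re k *\<^sub>R 0 + Im k *\<^sub>R 0)) (at z)"
      by (rule has_derivative_transform_within_open[of "\<lambda>_. 0" _ z UNIV "{z. norm z > R}" h])
         (use that h0 in \<open>auto intro!: open_Collect_less continuous_intros\<close>)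
    from pdx_pdy_eqI[OF this] show ?thesis by (simp add: dz_part_def)
  qed
  \<comment> \<open>Slightly larger than R, so that the derivative vanishes on the outer side as well.\<close>
  define R' where "R' = R + 1"
  have R': "r < R'" "0 < R'" "R < R'" using r by (auto simp: R'_def)
  let ?w = "\<lambda>x y. Complex x y"
  let ?m = "of_nat N :: complex"
  let ?V = "\<lambda>w. h (exp w) * exp (- ?m * w) * exp (cnj w)"
  let ?Vx = "\<lambda>w. ((dz_part h (exp w) * exp w + dzbar_part h (exp w) * exp (cnj w)
                  - ?m * h (exp w)) * exp (- ?m * w) + h (exp w) * exp (- ?m * w)) * exp (cnj w)"
  let ?Vy = "\<lambda>w. (\<i> * (dz_part h (exp w) * exp w - dzbar_part h (exp w) * exp (cnj w)
                  - ?m * h (exp w)) * exp (- ?m * w) - \<i> * (h (exp w) * exp (- ?m * w))) * exp (cnj w)"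
  have V: "(?V has_derivative (\<lambda>k. Re k *\<^sub>R ?Vx w + Im k *\<^sub>R ?Vy w)) (at w)" for w
  proof -
    have "Ck 1 UNIV h" using h by blast
    note 1 = has_derivative_exp_twisted[OF this, of N w]
    have "((\<lambda>w. exp (cnj w)) has_derivative (\<lambda>k. exp (cnj w) * cnj k)) (at w)"
      by (rule has_derivative_compose[OF has_derivative_cnj[OF has_derivative_ident] DERIV_exp[unfolded has_field_derivative_def]])
    from has_derivative_mult[OF 1 this] show ?thesis
      by (rule has_derivative_eq_rhs) (auto simp: fun_eq_iff complex_eq_iff algebra_simps)
  qed
  have DV: "of_real ((cmod (exp w))\<^sup>2) * ?D (exp w) = (?Vx w - \<i> * ?Vy w) / 2" for w
  proof -
    have e: "of_real ((cmod (exp w))\<^sup>2) = exp w * exp (cnj w)"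
      unfolding complex_norm_square by (simp add: exp_cnj)
    have e2: "exp (- ?m * w) = 1 / exp w ^ N"
      by (simp add: exp_minus exp_of_nat_mult divide_inverse)
    have "of_real ((cmod (exp w))\<^sup>2) * ?D (exp w) =
      (dz_part h (exp w) * exp w - ?m * h (exp w)) * (1 / exp w ^ N) * exp (cnj w)"
      unfolding e by (simp add: field_simps)
    also have "\<dots> = (?Vx w - \<i> * ?Vy w) / 2"
      unfolding e2[symmetric] by (simp add: algebra_simps)
    finally show ?thesis .
  qed
  have "(LINT z:{z. r < norm z}|lborel. ?D z) =
    (LINT w:cbox (Complex (ln r) 0) (Complex (ln R') (2 * pi))|lborel. of_real ((cmod (exp w))\<^sup>2) * ?D (exp w))"
  proof (rule integral_exp_strip[OF r(1) R'(1)])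
    show "continuous_on (- {0}) ?D"
      by (intro continuous_intros continuous_on_subset[OF c(1)] continuous_on_subset[OF c(2)]) auto
    show "?D z = 0" if "R' \<le> norm z" for z using h0[of z] dz0[of z] that R' by simp
  qed
  also have "\<dots> = (LINT w:cbox (Complex (ln r) 0) (Complex (ln R') (2 * pi))|lborel. (?Vx w - \<i> * ?Vy w) / 2)"
    unfolding DV ..
  also have "\<dots> = (integral {0..2 * pi} (\<lambda>y. ?V (?w (ln R') y)) - integral {0..2 * pi} (\<lambda>y. ?V (?w (ln r) y))
     - \<i> * (integral {ln r..ln R'} (\<lambda>x. ?V (?w x (2 * pi))) - integral {ln r..ln R'} (\<lambda>x. ?V (?w x 0)))) / 2"
    by (rule stokes_rectangle[OF _ _ _ _ _ V])
       (use r R' in \<open>auto intro!: continuous_intros continuous_on_compose2[OF c(1)]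
         continuous_on_compose2[OF c(2)] continuous_on_compose2[OF c(3)]\<close>)
  finally have L: "(LINT z:{z. r < norm z}|lborel. ?D z) = \<dots>" .
  have V0: "?V (?w (ln R') y) = 0" for y
    using h0[of "exp (?w (ln R') y)"] R' by simp
  have V1: "?V (?w x (2 * pi)) = ?V (?w x 0)" for x
  proof -
    have "exp (- ?m * Complex x (2 * pi)) = exp (- ?m * Complex x 0)"
      using exp_Complex_2pi[of x] by (simp add: exp_minus exp_of_nat_mult)
    moreover have "exp (cnj (Complex x (2 * pi))) = exp (cnj (Complex x 0))"
      by (simp only: exp_cnj[symmetric] exp_Complex_2pi)
    ultimately show ?thesis by (simp add: exp_Complex_2pi)
  qed
  have V2: "integral {0..2 * pi} (\<lambda>y. ?V (?w (ln r) y)) = of_real (r\<^sup>2) * circle_coefficient h (N + 1) (ln r)"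
  proof -
    have "exp (- ?m * Complex (ln r) y) * exp (cnj (Complex (ln r) y)) =
       of_real (r\<^sup>2) * exp (- of_nat (N + 1) * Complex (ln r) y)" for y
    proof -
      have "of_real (r\<^sup>2) = exp (of_real (2 * ln r) :: complex)"
      proof -
        have "exp (2 * ln r) = r\<^sup>2" using r exp_double[of "ln r"] by simp
        then show ?thesis by (simp only: exp_of_real)
      qed
      then have "of_real (r\<^sup>2) * exp (- of_nat (N + 1) * Complex (ln r) y)
          = exp (of_real (2 * ln r) + (- of_nat (N + 1) * Complex (ln r) y))"
        by (simp only: exp_add)
      then show ?thesis unfolding exp_add[symmetric]
        by (simp only:) (intro arg_cong[where f = exp], simp add: complex_eq_iff algebra_simps)
    qed
    then have "?V (?w (ln r) y) = of_real (r\<^sup>2) * (h (exp (?w (ln r) y)) * exp (- of_nat (N + 1) * ?w (ln r) y))" for y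
      by (simp add: algebra_simps)
    then show ?thesis unfolding circle_coefficient_def integral_mult_right[symmetric] by (simp only:)
  qed
  show ?thesis unfolding L V0 V1 V2 by simp
qed

text \<open>The analytic heart of the matter: removing a round disc about a pole of any order contributes nothing in
the limit. The boundary term is the square of the radius times a bounded circle coefficient.\<close>

theorem punctured_plane_limit:
  fixes h :: "complex \<Rightarrow> complex"
  assumes h: "\<forall>k. Ck k UNIV h" and h0: "\<And>z. norm z \<ge> R \<Longrightarrow> h z = 0" and R: "0 < R"
  shows "((\<lambda>r. LINT z:{z. r < norm z}|lborel. dz_part h z / z ^ N - of_nat N * h z / z ^ (N + 1)) \<longlongrightarrow> 0)
    (at_right 0)"
proof -
  obtain C where C: "\<And>s. s \<le> 0 \<Longrightarrow> norm (circle_coefficient h (N + 1) s) \<le> C"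
    using circle_coefficient_bound[OF order_refl h, of "N + 1"] by auto
  have lim: "((\<lambda>r. r\<^sup>2 * C / 2) \<longlongrightarrow> 0) (at_right (0::real))"
    by (auto intro!: tendsto_eq_intros)
  show ?thesis
  proof (rule Lim_null_comparison[OF _ lim])
    have "eventually (\<lambda>r. r \<in> {0<..<min R 1}) (at_right (0::real))"
      by (rule eventually_at_right_real) (use R in auto)
    then show "eventually (\<lambda>r. norm (LINT z:{z. r < norm z}|lborel. dz_part h z / z ^ N - of_nat N * h z / z ^ (N + 1))
       \<le> r\<^sup>2 * C / 2) (at_right 0)"
    proof eventually_elim
      case (elim r)
      then have "norm (circle_coefficient h (N + 1) (ln r)) \<le> C" by (intro C) auto
      then have "r\<^sup>2 * norm (circle_coefficient h (N + 1) (ln r)) \<le> r\<^sup>2 * C"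
        by (intro mult_left_mono) auto
      moreover have "norm (- (of_real (r\<^sup>2) * circle_coefficient h (N + 1) (ln r) / 2)) = r\<^sup>2 * norm (circle_coefficient h (N + 1) (ln r)) / 2"
        by (simp add: norm_mult norm_divide norm_power)
      moreover have "(LINT z:{z. r < norm z}|lborel. dz_part h z / z ^ N - of_nat N * h z / z ^ (N + 1)) =
        - (of_real (r\<^sup>2) * circle_coefficient h (N + 1) (ln r) / 2)"
        by (rule punctured_plane_integral[OF h h0]) (use elim in auto)
      ultimately show ?case by simp
    qed
  qed
qed

section \<open>Open subsets of the plane and of the half-plane\<close>

text \<open>The possible images of charts.\<close>

definition chart_open :: "complex set \<Rightarrow> bool" where
  "chart_open W \<longleftrightarrow> open W \<or> openin (top_of_set half_plane) W"

lemma closed_half_plane: "closed half_plane"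
  unfolding half_plane_def by (rule closed_halfspace_Im_ge)

lemma chart_open_subset: "chart_open W \<Longrightarrow> openin (top_of_set W) T \<Longrightarrow> chart_open T"
  unfolding chart_open_def using openin_open_trans openin_trans by blast

lemma chart_open_borel: "chart_open W \<Longrightarrow> W \<in> sets borel"
proof -
  assume "chart_open W"
  then consider "open W" | T where "open T" "W = half_plane \<inter> T"
    unfolding chart_open_def openin_open by blast
  then show ?thesis
    by cases (use closed_half_plane in \<open>simp_all add: borel_closed borel_open sets.Int\<close>)
qed

text \<open>From each point there are arbitrarily short steps along both coordinate axes that stay inside. This is all
that is needed for derivatives within the set to be unique.\<close>

lemma chart_open_fat:
  assumes "chart_open W" "z \<in> W" "i \<in> Basis" "e > 0"
  shows "\<exists>d. 0 < \<bar>d\<bar> \<and> \<bar>d\<bar> < e \<and> z + d *\<^sub>R i \<in> W"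
proof -
  obtain V where V: "open V" "z \<in> V" "V \<inter> half_plane \<subseteq> W" "z \<in> half_plane \<or> V \<subseteq> W"
    using assms(1,2) unfolding chart_open_def openin_open by blast
  then obtain r where r: "r > 0" "ball z r \<subseteq> V" using open_contains_ball by blast
  define d where "d = min e r / 2"
  have d: "0 < d" "d < e" "d < r" using r assms by (auto simp: d_def)
  have "z + d *\<^sub>R i \<in> ball z r" using d assms(3) by (auto simp: dist_norm)
  moreover have "z + d *\<^sub>R i \<in> half_plane" if "z \<in> half_plane"
    using that assms(3) d by (auto simp: half_plane_def Basis_complex_def)
  ultimately have "z + d *\<^sub>R i \<in> W" using V r by blast
  then show ?thesis using d by (intro exI[of _ d]) auto
qed

lemma chart_open_derivative_unique:
  assumes "chart_open W" "z \<in> W" "(f has_derivative F) (at z within W)" "(f has_derivative G) (at z within W)"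
  shows "F = G"
  by (rule frechet_derivative_unique_within[OF assms(3,4)]) (use chart_open_fat assms in auto)

lemma chart_open_field_derivative_unique:
  assumes "chart_open W" "z \<in> W" "(f has_field_derivative d) (at z within W)" "(f has_field_derivative e) (at z within W)"
  shows "d = e"
  using fun_cong[OF chart_open_derivative_unique[OF assms(1,2) assms(3,4)[unfolded has_field_derivative_def]], of 1]
  by simp

lemma chart_open_frechet_derivative:
  assumes "chart_open W" "z \<in> W" "(f has_derivative F) (at z within W)"
  shows "frechet_derivative f (at z within W) = F"
proof -
  have "(f has_derivative frechet_derivative f (at z within W)) (at z within W)"
    using differentiableI[OF assms(3)] frechet_derivative_works by blast
  from chart_open_derivative_unique[OF assms(1,2) this assms(3)] show ?thesis .
qed

lemma interior_half_plane_subset: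
  assumes "W \<subseteq> half_plane" "z \<in> interior W"
  shows "Im z > 0"
proof -
  obtain r where r: "r > 0" "ball z r \<subseteq> W" using assms(2) mem_interior by blast
  have "z - of_real (r/2) * \<i> \<in> ball z r" using r by (auto simp: dist_norm norm_mult)
  then have "z - of_real (r/2) * \<i> \<in> half_plane" using r assms by blast
  then show ?thesis using r by (simp add: half_plane_def)
qed

section \<open>Differentiation with respect to z\<close>

text \<open>A relational form of \<open>dz_deriv\<close>, at interior and boundary points alike, for which the rules of
calculus can be stated. As usual, products obey the Leibniz rule, and an antiholomorphic function has
derivative 0.\<close>

definition has_dz :: "(complex \<Rightarrow> complex) \<Rightarrow> complex \<Rightarrow> complex \<Rightarrow> complex set \<Rightarrow> bool" where
  "has_dz f d z W \<longleftrightarrow> (\<exists>fx fy. (f has_derivative (\<lambda>h. Re h *\<^sub>R fx + Im h *\<^sub>R fy)) (at z within W)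
     \<and> d = (fx - \<i> * fy) / 2)"

lemma has_dzI:
  "(f has_derivative (\<lambda>h. Re h *\<^sub>R fx + Im h *\<^sub>R fy)) (at z within W) \<Longrightarrow> d = (fx - \<i> * fy) / 2 \<Longrightarrow> has_dz f d z W"
  unfolding has_dz_def by blast

lemma has_dz_imp_dz_deriv: "chart_open W \<Longrightarrow> z \<in> W \<Longrightarrow> has_dz f d z W \<Longrightarrow> dz_deriv W f z = d"
  unfolding has_dz_def
proof clarify
  fix fx fy
  assume W: "chart_open W" "z \<in> W" and f: "(f has_derivative (\<lambda>h. Re h *\<^sub>R fx + Im h *\<^sub>R fy)) (at z within W)"
  show "dz_deriv W f z = (fx - \<i> * fy) / 2"
    unfolding dz_deriv_def chart_open_frechet_derivative[OF W f] by simp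
qed

lemma differentiable_has_dz:
  assumes "f differentiable (at z within W)"
  shows "has_dz f (dz_deriv W f z) z W"
proof -
  have "(f has_derivative frechet_derivative f (at z within W)) (at z within W)"
    using assms frechet_derivative_works by blast
  with has_derivative_partials[OF this]
  have "(f has_derivative (\<lambda>h. Re h *\<^sub>R frechet_derivative f (at z within W) 1 +
     Im h *\<^sub>R frechet_derivative f (at z within W) \<i>)) (at z within W)" by simp
  then show ?thesis by (rule has_dzI) (simp add: dz_deriv_def)
qed

lemma has_dz_eq_rhs: "has_dz f d z W \<Longrightarrow> d = e \<Longrightarrow> has_dz f e z W" by simp

lemma has_dz_subset: "has_dz f d z W \<Longrightarrow> W' \<subseteq> W \<Longrightarrow> has_dz f d z W'"
  unfolding has_dz_def using has_derivative_subset by blast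

lemma has_dz_transform:
  assumes "has_dz f d z W" "open U" "z \<in> U" "z \<in> W" "\<And>w. w \<in> U \<inter> W \<Longrightarrow> f w = g w"
  shows "has_dz g d z W"
proof -
  obtain fx fy where f: "(f has_derivative (\<lambda>h. Re h *\<^sub>R fx + Im h *\<^sub>R fy)) (at z within W)"
    "d = (fx - \<i> * fy) / 2" using assms(1) by (auto simp: has_dz_def)
  obtain e where e: "e > 0" "\<And>y. dist y z < e \<Longrightarrow> y \<in> U" using assms(2,3) unfolding open_dist by blast
  have "(g has_derivative (\<lambda>h. Re h *\<^sub>R fx + Im h *\<^sub>R fy)) (at z within W)"
    by (rule has_derivative_transform_within[OF f(1) e(1) assms(4)]) (use assms(5) e in \<open>auto simp: dist_commute\<close>)
  then show ?thesis using f(2) by (auto simp: has_dz_def)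
qed

lemma has_dz_localize:
  assumes "has_dz f d z (W \<inter> U)" "open U" "z \<in> U"
  shows "has_dz f d z W"
proof -
  have "at z within (W \<inter> U) = at z within W"
    by (rule at_within_nhd[of z U]) (use assms in auto)
  then show ?thesis using assms(1) unfolding has_dz_def by simp
qed

lemma has_dz_const: "has_dz (\<lambda>_. c) 0 z W"
  unfolding has_dz_def by (rule exI[of _ 0], rule exI[of _ 0]) auto

lemma has_dz_add:
  assumes "has_dz f d z W" "has_dz g e z W"
  shows "has_dz (\<lambda>w. f w + g w) (d + e) z W"
proof -
  obtain fx fy gx gy where
    *: "(f has_derivative (\<lambda>h. Re h *\<^sub>R fx + Im h *\<^sub>R fy)) (at z within W)"
    "(g has_derivative (\<lambda>h. Re h *\<^sub>R gx + Im h *\<^sub>R gy)) (at z within W)"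
    "d = (fx - \<i> * fy) / 2" "e = (gx - \<i> * gy) / 2"
    using assms unfolding has_dz_def by blast
  have "((\<lambda>w. f w + g w) has_derivative (\<lambda>h. Re h *\<^sub>R (fx + gx) + Im h *\<^sub>R (fy + gy))) (at z within W)"
    by (rule has_derivative_eq_rhs[OF has_derivative_add[OF *(1,2)]]) (auto simp: algebra_simps)
  then show ?thesis by (rule has_dzI) (auto simp: * field_simps)
qed

lemma has_dz_mult:
  assumes "has_dz f d z W" "has_dz g e z W"
  shows "has_dz (\<lambda>w. f w * g w) (d * g z + f z * e) z W"
proof -
  obtain fx fy gx gy where
    *: "(f has_derivative (\<lambda>h. Re h *\<^sub>R fx + Im h *\<^sub>R fy)) (at z within W)"
    "(g has_derivative (\<lambda>h. Re h *\<^sub>R gx + Im h *\<^sub>R gy)) (at z within W)"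
    "d = (fx - \<i> * fy) / 2" "e = (gx - \<i> * gy) / 2"
    using assms unfolding has_dz_def by blast
  have "((\<lambda>w. f w * g w) has_derivative (\<lambda>h. Re h *\<^sub>R (fx * g z + f z * gx) + Im h *\<^sub>R (fy * g z + f z * gy))) (at z within W)"
    by (rule has_derivative_eq_rhs[OF has_derivative_mult[OF *(1,2)]]) (auto simp: algebra_simps)
  then show ?thesis by (rule has_dzI) (auto simp: * field_simps)
qed

lemma has_dz_sum:
  assumes "\<And>i. i \<in> I \<Longrightarrow> has_dz (f i) (d i) z W"
  shows "has_dz (\<lambda>w. \<Sum>i\<in>I. f i w) (\<Sum>i\<in>I. d i) z W"
  using assms by (induction I rule: infinite_finite_induct) (auto intro: has_dz_const has_dz_add)

lemma has_dz_field_derivative: "(f has_field_derivative d) (at z within W) \<Longrightarrow> has_dz f d z W"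
  unfolding has_field_derivative_partials by (erule has_dzI) (simp add: complex_eq_iff)

lemma has_dz_cnj_field_derivative:
  assumes "(f has_field_derivative d) (at z within W)"
  shows "has_dz (\<lambda>w. cnj (f w)) 0 z W"
proof -
  have "((\<lambda>w. cnj (f w)) has_derivative (\<lambda>h. Re h *\<^sub>R cnj d + Im h *\<^sub>R (- \<i> * cnj d))) (at z within W)"
    by (rule has_derivative_eq_rhs[OF has_derivative_cnj[OF assms[unfolded has_field_derivative_partials]]])
       (auto simp: scaleR_conv_of_real)
  then show ?thesis by (rule has_dzI) (simp add: complex_eq_iff)
qed

lemma has_dz_compose:
  assumes "has_dz f d (g z) (g ` W)" "(g has_field_derivative t) (at z within W)"
  shows "has_dz (\<lambda>w. f (g w)) (d * t) z W"
proof -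
  obtain fx fy where f: "(f has_derivative (\<lambda>h. Re h *\<^sub>R fx + Im h *\<^sub>R fy)) (at (g z) within g ` W)"
    "d = (fx - \<i> * fy) / 2" using assms(1) by (auto simp: has_dz_def)
  from has_derivative_in_compose[OF assms(2)[unfolded has_field_derivative_def] f(1)]
  have "((\<lambda>w. f (g w)) has_derivative (\<lambda>h. Re h *\<^sub>R (Re t *\<^sub>R fx + Im t *\<^sub>R fy) + Im h *\<^sub>R (Re t *\<^sub>R fy - Im t *\<^sub>R fx))) (at z within W)"
    by (rule has_derivative_eq_rhs) (auto simp: algebra_simps fun_eq_iff)
  moreover have "d * t = ((Re t *\<^sub>R fx + Im t *\<^sub>R fy) - \<i> * (Re t *\<^sub>R fy - Im t *\<^sub>R fx)) / 2"
    unfolding f(2) by (auto simp: complex_eq_iff field_simps)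
  ultimately show ?thesis unfolding has_dz_def by blast
qed

lemma Ck_has_dz: "open V \<Longrightarrow> Ck 1 V f \<Longrightarrow> z \<in> V \<Longrightarrow> has_dz f (dz_part f z) z W"
proof -
  assume "open V" "Ck 1 V f" "z \<in> V"
  then have "(f has_derivative (\<lambda>h. Re h *\<^sub>R pdx f z + Im h *\<^sub>R pdy f z)) (at z within W)"
    using Ck_has_derivative_partials[of V 0 f z] by (auto intro: has_derivative_at_withinI)
  then show ?thesis unfolding has_dz_def dz_part_def by blast
qed

lemma has_dz_UNIV_dz_part: "has_dz f d z UNIV \<Longrightarrow> dz_part f z = d"
  unfolding has_dz_def dz_part_def by (auto simp: pdx_pdy_eqI)

lemma has_dz_inverse_power:
  assumes "z \<noteq> 0"
  shows "has_dz (\<lambda>w. 1 / w ^ N) (- of_nat N / z ^ (N + 1)) z W"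
  by (rule has_dz_field_derivative, rule has_field_derivative_at_within)
     (use assms in \<open>auto intro!: derivative_eq_intros simp: field_simps power_add[symmetric]
        split: nat_diff_split\<close>)

lemma has_dz_divide_power:
  assumes "has_dz f d z W" "z \<noteq> 0"
  shows "has_dz (\<lambda>w. f w / w ^ N) (d / z ^ N - of_nat N * f z / z ^ (N + 1)) z W"
  using has_dz_mult[OF assms(1) has_dz_inverse_power[OF assms(2), of N W]] by (simp add: mult.commute)

section \<open>Lowering the order of a pole\<close>

text \<open>For $N \ge 2$ the identity
$\frac{a}{z^N} = \partial_z\Bigl(\frac{-a}{(N-1)z^{N-1}}\Bigr) + \frac{\partial_z a}{(N-1)z^{N-1}}$
lowers the order of the pole by one. Repeating it reaches a simple pole. The
primitive is given the same exponent $N$ for uniformity, at the cost of a factor $z$ in the numerator.\<close>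

theorem pole_reduction:
  assumes "open V" "\<forall>k. Ck k V a"
  shows "\<exists>b a1. (\<forall>k. Ck k V b) \<and> (\<forall>k. Ck k V a1) \<and>
     (\<forall>z\<in>V - {0}. has_dz (\<lambda>w. b w / w ^ N) (a z / z ^ N - a1 z / z) z UNIV)"
  using assms(2)
proof (induction N arbitrary: a rule: less_induct)
  case (less N)
  consider "N = 0" | "N = 1" | n where "N = Suc (Suc n)" by (metis One_nat_def not0_implies_Suc)
  then show ?case
  proof cases
    case 1
    show ?thesis
    proof (intro exI conjI ballI allI)
      show "has_dz (\<lambda>w. 0 / w ^ N) (a z / z ^ N - a z * z / z) z UNIV" if "z \<in> V - {0}" for z
        using has_dz_const[of 0 z UNIV] that 1 by simp
    qed (use less.prems in \<open>auto intro: Ck_const Ck_mult Ck_ident\<close>)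
  next
    case 2
    show ?thesis
    proof (intro exI conjI ballI allI)
      show "has_dz (\<lambda>w. 0 / w ^ N) (a z / z ^ N - a z / z) z UNIV" if "z \<in> V - {0}" for z
        using has_dz_const[of 0 z UNIV] that 2 by simp
    qed (use less.prems in \<open>auto intro: Ck_const\<close>)
  next
    case 3
    define c where "c = complex_of_nat (Suc n)"
    have c: "c \<noteq> 0" unfolding c_def by (simp del: of_nat_Suc)
    have "\<forall>k. Ck k V (\<lambda>z. (1/c) * dz_part a z)"
      using Ck_dz_part(1)[OF assms(1) less.prems] by (intro allI Ck_mult Ck_const) blast
    from less.IH[OF _ this, of "Suc n"] obtain b' a1 where IH: "\<forall>k. Ck k V b'" "\<forall>k. Ck k V a1"
      "\<forall>z\<in>V - {0}. has_dz (\<lambda>w. b' w / w ^ Suc n) ((1/c) * dz_part a z / z ^ Suc n - a1 z / z) z UNIV"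
      using 3 by auto
    \<comment> \<open>The sum of the primitive from the induction hypothesis and of the one from the identity.\<close>
    let ?b = "\<lambda>z. (b' z + (-1/c) * a z) * z"
    show ?thesis
    proof (intro exI conjI ballI allI)
      show "Ck k V ?b" for k
        by (intro Ck_mult Ck_add Ck_const Ck_ident) (use less.prems IH in auto)
      show "Ck k V a1" for k using IH by blast
      show "has_dz (\<lambda>w. ?b w / w ^ N) (a z / z ^ N - a1 z / z) z UNIV" if z: "z \<in> V - {0}" for z
      proof -
        have "has_dz a (dz_part a z) z UNIV"
          using Ck_has_dz[OF assms(1) _ _, of a z UNIV] less.prems z by blast
        from has_dz_mult[OF has_dz_const[of "-1/c"] this]
        have "has_dz (\<lambda>w. (-1/c) * a w) ((-1/c) * dz_part a z) z UNIV" by simp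
        from has_dz_divide_power[OF this, of "Suc n"] z
        have "has_dz (\<lambda>w. (-1/c) * a w / w ^ Suc n) ((-1/c) * dz_part a z / z ^ Suc n -
           c * ((-1/c) * a z) / z ^ (Suc n + 1)) z UNIV" by (simp add: c_def)
        from has_dz_add[OF IH(3)[rule_format, OF z] this]
        have "has_dz (\<lambda>w. b' w / w ^ Suc n + (-1/c) * a w / w ^ Suc n) (a z / z ^ N - a1 z / z) z UNIV"
          by (rule has_dz_eq_rhs) (use c z 3 in \<open>auto simp: field_simps\<close>)
        then show ?thesis
          by (rule has_dz_transform[where U = "- {0}"]) (use z 3 in \<open>auto simp: diff_divide_distrib\<close>)
      qed
    qed
  qed
qed

section \<open>Germs of smooth functions\<close>

text \<open>The condition that \<open>smooth_on\<close> imposes at a single point. The extension to a neighbourhood in the plane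
is part of the definition, so the closure properties of \<open>Ck\<close> carry over to boundary points.\<close>

definition smooth_germ :: "complex set \<Rightarrow> (complex \<Rightarrow> 'b::real_normed_vector) \<Rightarrow> complex \<Rightarrow> bool" where
  "smooth_germ W f z \<longleftrightarrow> (\<exists>V g. open V \<and> z \<in> V \<and> (\<forall>k. Ck k V g) \<and> (\<forall>w\<in>V \<inter> W. g w = f w))"

lemma smooth_on_germ: "smooth_on W f \<longleftrightarrow> (\<forall>z\<in>W. smooth_germ W f z)"
  unfolding smooth_on_def smooth_germ_def ..

lemma smooth_germ_mono: "smooth_germ W f z \<Longrightarrow> W' \<subseteq> W \<Longrightarrow> smooth_germ W' f z"
  unfolding smooth_germ_def by blast

lemma smooth_germ_cong:
  assumes "smooth_germ W f z" "open U" "z \<in> U" "\<And>w. w \<in> U \<inter> W' \<Longrightarrow> w \<in> W \<and> f w = g w"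
  shows "smooth_germ W' g z"
proof -
  obtain V h where V: "open V" "z \<in> V" "\<forall>k. Ck k V h" "\<forall>w\<in>V \<inter> W. h w = f w"
    using assms(1) by (auto simp: smooth_germ_def)
  show ?thesis unfolding smooth_germ_def
  proof (intro exI conjI ballI allI)
    show "open (V \<inter> U)" "z \<in> V \<inter> U" using V assms by auto
    show "Ck k (V \<inter> U) h" for k using V by (auto intro: Ck_subset)
    show "h w = g w" if "w \<in> V \<inter> U \<inter> W'" for w using that assms(4)[of w] V by auto
  qed
qed

lemma smooth_germ_Ck: "open V \<Longrightarrow> z \<in> V \<Longrightarrow> \<forall>k. Ck k V f \<Longrightarrow> smooth_germ W f z"
  unfolding smooth_germ_def by blast

lemma smooth_germ_const: "smooth_germ W (\<lambda>_. c) z"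
  by (rule smooth_germ_Ck[OF open_UNIV]) (auto intro: Ck_const)

lemma smooth_germ_bounded_linear:
  assumes "bounded_linear L" "smooth_germ W f z"
  shows "smooth_germ W (\<lambda>w. L (f w)) z"
proof -
  obtain V g where V: "open V" "z \<in> V" "\<forall>k. Ck k V g" "\<forall>w\<in>V \<inter> W. g w = f w"
    using assms(2) by (auto simp: smooth_germ_def)
  then show ?thesis unfolding smooth_germ_def
    by (intro exI[of _ V] exI[of _ "\<lambda>w. L (g w)"]) (auto intro: Ck_bounded_linear[OF assms(1)])
qed

text \<open>Two germs are combined on the intersection of the domains of their extensions.\<close>

lemma smooth_germ_binary:
  assumes "smooth_germ W f z" "smooth_germ W g z"
    and "\<And>V f g k. open V \<Longrightarrow> \<forall>k. Ck k V f \<Longrightarrow> \<forall>k. Ck k V g \<Longrightarrow> Ck k V (\<lambda>w. B (f w) (g w))"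
  shows "smooth_germ W (\<lambda>w. B (f w) (g w)) z"
proof -
  obtain V f' where V: "open V" "z \<in> V" "\<forall>k. Ck k V f'" "\<forall>w\<in>V \<inter> W. f' w = f w"
    using assms(1) by (auto simp: smooth_germ_def)
  obtain U g' where U: "open U" "z \<in> U" "\<forall>k. Ck k U g'" "\<forall>w\<in>U \<inter> W. g' w = g w"
    using assms(2) by (auto simp: smooth_germ_def)
  have o: "open (V \<inter> U)" using V U by blast
  have "\<forall>k. Ck k (V \<inter> U) f'" "\<forall>k. Ck k (V \<inter> U) g'" using V U by (auto intro: Ck_subset)
  from assms(3)[OF o this] show ?thesis unfolding smooth_germ_def using V U o
    by (intro exI[of _ "V \<inter> U"] exI[of _ "\<lambda>w. B (f' w) (g' w)"]) auto
qed

lemma smooth_germ_add: "smooth_germ W f z \<Longrightarrow> smooth_germ W g z \<Longrightarrow> smooth_germ W (\<lambda>w. f w + g w) z"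
  by (rule smooth_germ_binary) (auto intro: Ck_add)

lemma smooth_germ_diff: "smooth_germ W f z \<Longrightarrow> smooth_germ W g z \<Longrightarrow> smooth_germ W (\<lambda>w. f w - g w) z"
  by (rule smooth_germ_binary) (auto intro: Ck_diff)

lemma smooth_germ_mult:
  fixes f g :: "complex \<Rightarrow> 'b::real_normed_algebra"
  shows "smooth_germ W f z \<Longrightarrow> smooth_germ W g z \<Longrightarrow> smooth_germ W (\<lambda>w. f w * g w) z"
  by (rule smooth_germ_binary) (auto intro: Ck_mult)

lemma smooth_germ_sum: "(\<And>i. i \<in> I \<Longrightarrow> smooth_germ W (f i) z) \<Longrightarrow> smooth_germ W (\<lambda>w. \<Sum>i\<in>I. f i w) z"
  by (induction I rule: infinite_finite_induct) (auto intro: smooth_germ_const smooth_germ_add)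

lemma smooth_germ_inverse:
  fixes f :: "complex \<Rightarrow> 'b::real_normed_field"
  assumes "smooth_germ W f z" "z \<in> W" "f z \<noteq> 0"
  shows "smooth_germ W (\<lambda>w. inverse (f w)) z"
proof -
  obtain V g where V: "open V" "z \<in> V" "\<forall>k. Ck k V g" "\<forall>w\<in>V \<inter> W. g w = f w"
    using assms(1) by (auto simp: smooth_germ_def)
  have "continuous_on V g" using V Ck_imp_continuous_on by blast
  then have "open (V \<inter> g -` (- {0}))" using V(1) by (intro continuous_open_preimage) auto
  moreover have "z \<in> V \<inter> g -` (- {0})" using V assms by auto
  moreover have "Ck k (V \<inter> g -` (- {0})) (\<lambda>w. inverse (g w))" for k
    using V by (intro Ck_inverse) (auto intro: Ck_subset)
  ultimately show ?thesis unfolding smooth_germ_def using V(4)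
    by (intro exI[of _ "V \<inter> g -` (- {0})"] exI[of _ "\<lambda>w. inverse (g w)"]) auto
qed

lemma smooth_germ_divide:
  fixes f :: "complex \<Rightarrow> 'b::real_normed_field"
  assumes "smooth_germ W f z" "smooth_germ W g z" "z \<in> W" "g z \<noteq> 0"
  shows "smooth_germ W (\<lambda>w. f w / g w) z"
  unfolding divide_inverse by (intro smooth_germ_mult smooth_germ_inverse assms)

lemma smooth_germ_of_real: "smooth_germ W f z \<Longrightarrow> smooth_germ W (\<lambda>w. complex_of_real (f w)) z"
  by (rule smooth_germ_bounded_linear[OF bounded_linear_of_real])

lemma smooth_germ_cnj: "smooth_germ W f z \<Longrightarrow> smooth_germ W (\<lambda>w. cnj (f w)) z"
  by (rule smooth_germ_bounded_linear[OF bounded_linear_cnj])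

lemma smooth_germ_holomorphic: "open V \<Longrightarrow> z \<in> V \<Longrightarrow> f holomorphic_on V \<Longrightarrow> smooth_germ W f z"
  using smooth_germ_Ck Ck_holomorphic by blast

lemma smooth_germ_power:
  fixes f :: "complex \<Rightarrow> 'b::real_normed_field"
  shows "smooth_germ W f z \<Longrightarrow> smooth_germ W (\<lambda>w. f w ^ n) z"
  by (induction n) (auto intro: smooth_germ_const smooth_germ_mult)

lemma smooth_germ_compose:
  fixes f :: "complex \<Rightarrow> complex"
  assumes "smooth_germ W' f (g z)" "open V" "z \<in> V" "g holomorphic_on V" "\<And>w. w \<in> V \<inter> W \<Longrightarrow> g w \<in> W'"
  shows "smooth_germ W (\<lambda>w. f (g w)) z"
proof -
  obtain U h where U: "open U" "g z \<in> U" "\<forall>k. Ck k U h" "\<forall>w\<in>U \<inter> W'. h w = f w"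
    using assms(1) by (auto simp: smooth_germ_def)
  have "continuous_on V g" using assms holomorphic_on_imp_continuous_on by blast
  then have o: "open (V \<inter> g -` U)" using assms U by (intro continuous_open_preimage) auto
  have hg: "g holomorphic_on V \<inter> g -` U" using assms(4) holomorphic_on_subset by blast
  show ?thesis unfolding smooth_germ_def
  proof (intro exI conjI ballI allI)
    show "Ck k (V \<inter> g -` U) (\<lambda>w. h (g w))" for k
      by (rule Ck_compose_holomorphic[OF o hg]) (use U in auto)
  qed (use o U assms in auto)
qed

lemma smooth_germ_continuous:
  assumes "smooth_germ W f z" "z \<in> W"
  shows "continuous (at z within W) f"
proof -
  obtain V g where V: "open V" "z \<in> V" "\<forall>k. Ck k V g" "\<forall>w\<in>V \<inter> W. g w = f w"
    using assms(1) by (auto simp: smooth_germ_def)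
  have "continuous_on V g" using V Ck_imp_continuous_on by blast
  then have "continuous (at z within W) g"
    using V by (meson continuous_at_imp_continuous_within continuous_on_eq_continuous_at)
  obtain e where e: "e > 0" "\<And>y. dist y z < e \<Longrightarrow> y \<in> V" using V(1,2) unfolding open_dist by blast
  show ?thesis
    by (rule continuous_transform_within[OF \<open>continuous (at z within W) g\<close> e(1) assms(2)])
       (use V e in \<open>auto simp: dist_commute\<close>)
qed

lemma smooth_on_continuous: "smooth_on W f \<Longrightarrow> continuous_on W f"
  unfolding smooth_on_germ continuous_on_eq_continuous_within using smooth_germ_continuous by blast

text \<open>Derivatives within the set agree with those of any smooth extension, by uniqueness; hence they are smooth
themselves.\<close>

lemma smooth_germ_derivatives:
  assumes W: "chart_open W" "z \<in> W" and f: "smooth_germ W f z"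
  shows "f differentiable (at z within W)"
    and "smooth_germ W (\<lambda>w. frechet_derivative f (at w within W) 1) z"
    and "smooth_germ W (\<lambda>w. frechet_derivative f (at w within W) \<i>) z"
proof -
  obtain V g where V: "open V" "z \<in> V" "\<forall>k. Ck k V g" "\<forall>w\<in>V \<inter> W. g w = f w"
    using f by (auto simp: smooth_germ_def)
  have *: "(f has_derivative (\<lambda>k. Re k *\<^sub>R pdx g w + Im k *\<^sub>R pdy g w)) (at w within W)" if w: "w \<in> V \<inter> W" for w
  proof -
    have "Ck (Suc 0) V g" using V by blast
    from Ck_has_derivative_partials[OF V(1) this] w
    have 1: "(g has_derivative (\<lambda>k. Re k *\<^sub>R pdx g w + Im k *\<^sub>R pdy g w)) (at w within W)"
      using has_derivative_at_withinI by blast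
    obtain e where e: "e > 0" "\<And>y. dist y w < e \<Longrightarrow> y \<in> V" using V(1) w unfolding open_dist by blast
    show ?thesis
      by (rule has_derivative_transform_within[OF 1 e(1)]) (use w V e in \<open>auto simp: dist_commute\<close>)
  qed
  show "f differentiable (at z within W)" using * V W by (auto intro: differentiableI)
  have "frechet_derivative f (at w within W) = (\<lambda>k. Re k *\<^sub>R pdx g w + Im k *\<^sub>R pdy g w)" if w: "w \<in> V \<inter> W" for w
    using chart_open_frechet_derivative[OF W(1) _ *[OF w]] w by blast
  moreover have "\<forall>k. Ck k V (pdx g)" "\<forall>k. Ck k V (pdy g)"
    using Ck_pdx[OF V(1)] Ck_pdy[OF V(1)] V(3) by blast+
  ultimately show "smooth_germ W (\<lambda>w. frechet_derivative f (at w within W) 1) z"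
    "smooth_germ W (\<lambda>w. frechet_derivative f (at w within W) \<i>) z"
    unfolding smooth_germ_def using V(1,2)
    by (intro exI[of _ V], intro exI[of _ "pdx g"] exI[of _ "pdy g"]; force)+
qed

lemma smooth_germ_has_dz:
  "chart_open W \<Longrightarrow> z \<in> W \<Longrightarrow> smooth_germ W f z \<Longrightarrow> has_dz f (dz_deriv W f z) z W"
  by (intro differentiable_has_dz smooth_germ_derivatives)

lemma smooth_germ_dz_deriv:
  assumes "chart_open W" "z \<in> W" "smooth_germ W f z"
  shows "smooth_germ W (dz_deriv W f) z"
proof -
  have "smooth_germ W (\<lambda>w. (1/2) * (frechet_derivative f (at w within W) 1 - \<i> * frechet_derivative f (at w within W) \<i>)) z"
    by (intro smooth_germ_mult smooth_germ_const smooth_germ_diff smooth_germ_derivatives assms)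
  then show ?thesis by (simp add: dz_deriv_def[abs_def])
qed

section \<open>Stokes' theorem in a chart\<close>

lemma has_dz_zero:
  assumes "chart_open W" "z \<in> W" "open U" "z \<in> U" "\<And>w. w \<in> U \<inter> W \<Longrightarrow> f w = 0"
  shows "dz_deriv W f z = 0"
  by (rule has_dz_imp_dz_deriv[OF assms(1,2)], rule has_dz_transform[OF has_dz_const[of 0] assms(3,4,2)])
     (use assms(5) in auto)

lemma stokes_rectangle_smooth:
  assumes H: "chart_open H" "cbox (Complex (-R) c) (Complex R R) \<subseteq> H" and le: "0 \<le> R" "c \<le> R"
    and G: "smooth_on H G" and zero: "\<And>z. z \<in> H \<Longrightarrow> G z \<noteq> 0 \<Longrightarrow> \<bar>Re z\<bar> < R \<and> Im z < R"
  shows "(LINT z:cbox (Complex (-R) c) (Complex R R)|lborel. dz_deriv H G z) =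
     (\<i> / 2) * integral {-R..R} (\<lambda>x. G (Complex x c))"
proof -
  let ?C = "cbox (Complex (-R) c) (Complex R R)"
  let ?Fx = "\<lambda>w. frechet_derivative G (at w within H) 1"
  let ?Fy = "\<lambda>w. frechet_derivative G (at w within H) \<i>"
  have germ: "smooth_germ H G z" if "z \<in> H" for z using G that by (simp add: smooth_on_germ)
  have "smooth_on H ?Fx" "smooth_on H ?Fy"
    unfolding smooth_on_germ using smooth_germ_derivatives(2,3)[OF H(1) _ germ] by blast+
  then have c: "continuous_on ?C G" "continuous_on ?C ?Fx" "continuous_on ?C ?Fy"
    using smooth_on_continuous G continuous_on_subset[OF _ H(2)] by blast+
  have D: "(G has_derivative (\<lambda>h. Re h *\<^sub>R ?Fx z + Im h *\<^sub>R ?Fy z)) (at z)"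
    if z: "z \<in> box (Complex (-R) c) (Complex R R)" for z
  proof -
    have zH: "z \<in> interior H"
      using z H(2) by (meson box_subset_cbox interior_maximal open_box order_trans subsetD)
    then have a: "at z within H = at z" "z \<in> H"
      using at_within_interior[OF zH] subsetD[OF interior_subset zH] by blast+
    have "(G has_derivative frechet_derivative G (at z within H)) (at z within H)"
      using smooth_germ_derivatives(1)[OF H(1) a(2) germ[OF a(2)]] frechet_derivative_works by blast
    from has_derivative_partials[OF this] this show ?thesis unfolding a(1) by simp
  qed
  have z1: "G (Complex R y) = 0" "G (Complex (-R) y) = 0" if "y \<in> {c..R}" for y
  proof -
    have "Complex R y \<in> H" "Complex (-R) y \<in> H" using that le H(2) by (auto simp: in_cbox_complex_iff)
    then show "G (Complex R y) = 0" "G (Complex (-R) y) = 0" using zero by fastforce+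
  qed
  have z2: "G (Complex x R) = 0" if "x \<in> {-R..R}" for x
  proof -
    have "Complex x R \<in> H" using that le H(2) by (auto simp: in_cbox_complex_iff)
    then show ?thesis using zero by fastforce
  qed
  have "integral {c..R} (\<lambda>y. G (Complex R y)) = 0" "integral {c..R} (\<lambda>y. G (Complex (-R) y)) = 0"
    "integral {-R..R} (\<lambda>x. G (Complex x R)) = 0"
    by (rule integral_unique, rule has_integral_is_0, use z1 z2 in blast)+
  with stokes_rectangle[OF _ le(2) c D] le(1)
  show ?thesis by (simp add: dz_deriv_def)
qed

text \<open>A function with compact support in the image of a chart is extended by 0 to the whole plane or half-plane.
Stokes on a large rectangle then gives 0 in the first case; in the second the side on the real axis
remains. The factor $-2i$ comes from $dz\wedge d\bar z = -2i\,dx\wedge dy$.\<close>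

theorem stokes_chart:
  assumes W: "chart_open W" and g: "smooth_on W g" and K: "compact K" "K \<subseteq> W" "\<And>w. w \<in> W - K \<Longrightarrow> g w = 0"
  shows "- 2 * \<i> * (LINT w:W|lborel. dz_deriv W g w) =
    (LINT t:{t. complex_of_real t \<in> W \<and> complex_of_real t \<notin> interior W}|lborel. g (of_real t))"
proof -
  obtain R where R: "R > 0" "K \<subseteq> ball 0 R"
    using compact_imp_bounded[OF K(1)] bounded_subset_ballD by blast
  have KR: "\<bar>Re z\<bar> < R \<and> \<bar>Im z\<bar> < R" if "z \<in> K" for z
    using R(2) that abs_Re_le_cmod[of z] abs_Im_le_cmod[of z] by (auto simp: subset_eq)
  \<comment> \<open>The ambient space of the image, and the height of the bottom side of the rectangle.\<close>
  obtain H c where H: "chart_open H" "openin (top_of_set H) W" "cbox (Complex (-R) c) (Complex R R) \<subseteq> H"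
    "c \<le> R" "H = half_plane \<and> c = 0 \<or> open W \<and> c = -R" "\<And>z. z \<in> H \<Longrightarrow> c \<le> Im z \<or> c = -R"
  proof (cases "open W")
    case True
    show ?thesis by (rule that[of UNIV "-R"]) (use True R in \<open>auto simp: chart_open_def\<close>)
  next
    case False
    then have "openin (top_of_set half_plane) W" using W by (auto simp: chart_open_def)
    then show ?thesis
      by (intro that[of half_plane 0]) (use R in \<open>auto simp: chart_open_def half_plane_def in_cbox_complex_iff\<close>)
  qed
  obtain T where T: "open T" "W = H \<inter> T" using H(2) by (auto simp: openin_open)
  define G where "G = (\<lambda>w. if w \<in> W then g w else 0)"
  have oK: "open (- K)" using K(1) by (simp add: compact_imp_closed open_Compl)
  have G0: "G w = 0" if "w \<notin> K" for w using K(3)[of w] that by (auto simp: G_def)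
  have sG: "smooth_on H G"
    unfolding smooth_on_germ
  proof
    fix z assume z: "z \<in> H"
    show "smooth_germ H G z"
    proof (cases "z \<in> W")
      case True
      then have "smooth_germ W g z" using g by (simp add: smooth_on_germ)
      then show ?thesis by (rule smooth_germ_cong[OF _ T(1)]) (use T True in \<open>auto simp: G_def\<close>)
    next
      case False
      show ?thesis by (rule smooth_germ_cong[OF smooth_germ_const[of H 0] oK]) (use False K G0 in auto)
    qed
  qed
  have d1: "dz_deriv W g z = dz_deriv H G z" if z: "z \<in> W" for z
  proof -
    have zH: "z \<in> H" "z \<in> T" using z T by auto
    have "has_dz G (dz_deriv H G z) z H"
      using smooth_germ_has_dz[OF H(1) zH(1)] sG zH by (simp add: smooth_on_germ)
    then have "has_dz G (dz_deriv H G z) z W" by (rule has_dz_subset) (use T in auto)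
    then have "has_dz g (dz_deriv H G z) z W"
      by (rule has_dz_transform[OF _ open_UNIV]) (use z in \<open>auto simp: G_def\<close>)
    then show ?thesis by (rule has_dz_imp_dz_deriv[OF W z])
  qed
  have d0: "dz_deriv H G z = 0" if "z \<in> H" "z \<notin> K" for z
    by (rule has_dz_zero[OF H(1) that(1) oK]) (use that G0 in auto)
  let ?C = "cbox (Complex (-R) c) (Complex R R)"
  have KC: "z \<in> ?C" if "z \<in> K" for z
    using KR[OF that] H(6)[of z] K(2) T that R(1) by (force simp: in_cbox_complex_iff)
  have WH: "W \<subseteq> H" using T by auto
  have "(LINT w:W|lborel. dz_deriv W g w) = (LINT z:?C|lborel. dz_deriv H G z)"
    unfolding set_lebesgue_integral_def
  proof (rule Bochner_Integration.integral_cong[OF refl])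
    fix z
    consider "z \<in> W" "z \<in> ?C" | "z \<in> W" "z \<notin> ?C" | "z \<notin> W" "z \<in> ?C" | "z \<notin> W" "z \<notin> ?C" by blast
    then show "indicator W z *\<^sub>R dz_deriv W g z = indicator ?C z *\<^sub>R dz_deriv H G z"
    proof cases
      case 2
      then have "z \<in> H" "z \<notin> K" using KC WH by auto
      then show ?thesis using 2 d0 d1 by simp
    next
      case 3
      then have "z \<in> H" "z \<notin> K" using K(2) H(3) by auto
      then show ?thesis using 3 d0 by simp
    qed (auto simp: d1)
  qed
  also have "\<dots> = (\<i> / 2) * integral {-R..R} (\<lambda>x. G (Complex x c))"
  proof (rule stokes_rectangle_smooth[OF H(1) H(3) _ H(4) sG])
    show "\<bar>Re z\<bar> < R \<and> Im z < R" if "z \<in> H" "G z \<noteq> 0" for z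
      using KR[of z] G0[of z] that by fastforce
  qed (use R in auto)
  finally have L0: "(LINT w:W|lborel. dz_deriv W g w) = (\<i> / 2) * integral {-R..R} (\<lambda>x. G (Complex x c))" .
  have L: "- 2 * \<i> * (LINT w:W|lborel. dz_deriv W g w) = integral {-R..R} (\<lambda>x. G (Complex x c))"
    unfolding L0 by (simp add: complex_eq_iff)
  let ?B = "{t. complex_of_real t \<in> W \<and> complex_of_real t \<notin> interior W}"
  have "integral {-R..R} (\<lambda>x. G (Complex x c)) = (LINT t:?B|lborel. g (of_real t))"
  proof (cases "open W \<and> c = -R")
    case True
    have "G (Complex x c) = 0" for x
    proof (rule G0)
      show "Complex x c \<notin> K" using KR[of "Complex x c"] True R by auto
    qed
    moreover have "?B = {}" using True by (auto simp: interior_open)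
    ultimately show ?thesis by (simp only: integral_0) (simp add: set_lebesgue_integral_def)
  next
    case False
    then have H': "H = half_plane" "c = 0" using H(5) by auto
    have cG: "continuous_on {-R..R} (\<lambda>x. G (of_real x))"
      by (rule continuous_on_compose2[OF smooth_on_continuous[OF sG]])
         (auto intro!: continuous_intros simp: H' half_plane_def)
    have "(LINT t:?B|lborel. g (of_real t)) = (LINT t:{-R..R}|lborel. G (of_real t))"
      unfolding set_lebesgue_integral_def
    proof (rule Bochner_Integration.integral_cong[OF refl])
      fix t :: real
      have "complex_of_real t \<notin> interior W"
        using interior_half_plane_subset[of W "of_real t"] WH H' by auto
      moreover have "G (of_real t) = 0" if "t \<notin> {-R..R}"
        by (rule G0) (use KR[of "of_real t"] that in auto)
      ultimately show "indicator ?B t *\<^sub>R g (of_real t) = indicator {-R..R} t *\<^sub>R G (of_real t)"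
        by (auto simp: indicator_def G_def)
    qed
    also have "\<dots> = integral {-R..R} (\<lambda>x. G (of_real x))"
      by (rule set_borel_integral_eq_integral(2))
         (use borel_integrable_compact[OF compact_Icc cG] in \<open>simp add: set_integrable_def\<close>)
    also have "(\<lambda>x. G (of_real x)) = (\<lambda>x. G (Complex x c))"
      using H' by (auto simp: complex_of_real_def)
    finally show ?thesis by simp
  qed
  with L show ?thesis by simp
qed

lemma smooth_on_imp_Ck:
  assumes "open V" "V \<subseteq> W" "smooth_on W f"
  shows "Ck k V f"
proof (rule Ck_local[OF assms(1)])
  fix z assume z: "z \<in> V"
  then obtain U g where U: "open U" "z \<in> U" "\<forall>k. Ck k U g" "\<forall>w\<in>U \<inter> W. g w = f w"
    using assms(3)[unfolded smooth_on_def, rule_format, OF subsetD[OF assms(2) z]] by auto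
  have "Ck k (U \<inter> V) f"
    by (rule Ck_cong[of _ g]) (use U assms z in \<open>auto intro: Ck_subset\<close>)
  then show "\<exists>U. open U \<and> z \<in> U \<and> Ck k U f" using U assms z by (intro exI[of _ "U \<inter> V"]) auto
qed

section \<open>Charts of a compact surface\<close>

locale compact_surface =
  fixes X :: "'a topology" and A :: "'a chart set"
  assumes surface: "riemann_surface_with_boundary X A" and compact: "compact_space X"
begin

lemma Hausdorff: "Hausdorff_space X"
  and chart: "c \<in> A \<Longrightarrow> is_chart X c"
  and cover: "(\<Union>c\<in>A. dom c) = topspace X"
  and transitions: "c \<in> A \<Longrightarrow> c' \<in> A \<Longrightarrow> holomorphic_transition c c'"
  using surface by (auto simp: riemann_surface_with_boundary_def)

lemma chart_openin: "c \<in> A \<Longrightarrow> openin X (dom c)"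
  and chart_homeo: "c \<in> A \<Longrightarrow> homeomorphic_map (subtopology X (dom c)) (top_of_set (img c)) (coord c)"
  and img_chart_open: "c \<in> A \<Longrightarrow> chart_open (img c)"
  using chart by (auto simp: is_chart_def chart_open_def)

lemma dom_subset: "c \<in> A \<Longrightarrow> dom c \<subseteq> topspace X"
  using chart_openin openin_subset by blast

lemma topspace_sub: "c \<in> A \<Longrightarrow> topspace (subtopology X (dom c)) = dom c"
  using dom_subset by (simp add: inf.absorb2)

lemma coord_inj: "c \<in> A \<Longrightarrow> inj_on (coord c) (dom c)"
  using homeomorphic_imp_injective_map[OF chart_homeo] topspace_sub by metis

lemma param_coord [simp]: "c \<in> A \<Longrightarrow> x \<in> dom c \<Longrightarrow> param c (coord c x) = x"
  using coord_inj by (rule inv_into_f_f)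

lemma coord_param [simp]: "w \<in> img c \<Longrightarrow> coord c (param c w) = w"
  and param_dom [simp]: "w \<in> img c \<Longrightarrow> param c w \<in> dom c"
  by (auto intro: f_inv_into_f inv_into_into)

lemma openin_image:
  assumes "c \<in> A" "openin X U"
  shows "openin (top_of_set (img c)) (coord c ` (dom c \<inter> U))"
proof -
  have "openin (subtopology X (dom c)) (dom c \<inter> U)"
    using assms(2) by (simp add: openin_subtopology_Int2)
  then show ?thesis
    using homeomorphic_imp_open_map[OF chart_homeo[OF assms(1)]] by (simp add: open_map_def)
qed

lemma openin_image_obtain:
  assumes "c \<in> A" "openin X U"
  obtains T where "open T" "coord c ` (dom c \<inter> U) = img c \<inter> T"
  using openin_image[OF assms] by (auto simp: openin_open)

lemma chart_open_image: "c \<in> A \<Longrightarrow> openin X U \<Longrightarrow> chart_open (coord c ` (dom c \<inter> U))"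
  using chart_open_subset img_chart_open openin_image by metis

lemma openin_preimage:
  assumes "c \<in> A" "open T"
  shows "openin X {x \<in> dom c. coord c x \<in> T}"
proof -
  have "continuous_map (subtopology X (dom c)) (top_of_set (img c)) (coord c)"
    using homeomorphic_imp_continuous_map[OF chart_homeo[OF assms(1)]] .
  then have "continuous_map (subtopology X (dom c)) euclidean (coord c)"
    using continuous_map_in_subtopology by blast
  then have "openin (subtopology X (dom c)) {x \<in> topspace (subtopology X (dom c)). coord c x \<in> T}"
    by (rule openin_continuous_map_preimage) (use assms in auto)
  then show ?thesis
    unfolding topspace_sub[OF assms(1)] using openin_open_subtopology[OF chart_openin[OF assms(1)]] by blast
qed

lemma compact_image: "c \<in> A \<Longrightarrow> K \<subseteq> dom c \<Longrightarrow> compact (coord c ` K) \<longleftrightarrow> compactin X K"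
proof -
  assume c: "c \<in> A" "K \<subseteq> dom c"
  have "compactin (top_of_set (img c)) (coord c ` K) \<longleftrightarrow> compactin (subtopology X (dom c)) K"
    by (rule homeomorphic_map_compactness[OF chart_homeo[OF c(1)]]) (use c topspace_sub in auto)
  then show ?thesis using c by (auto simp: compactin_subtopology)
qed

lemma compactin_closedin: "compactin X K \<Longrightarrow> closedin X K"
  using Hausdorff compactin_imp_closedin by blast

lemma closedin_compactin: "closedin X K \<Longrightarrow> compactin X K"
  using compact closedin_compact_space by blast

lemma openin_Compl: "closedin X K \<Longrightarrow> openin X (topspace X - K)"
  by (simp add: openin_diff)

lemma finite_closedin: "finite D \<Longrightarrow> D \<subseteq> topspace X \<Longrightarrow> closedin X D"
  using Hausdorff by (simp add: closedin_Hausdorff_finite)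

section \<open>Changes of coordinates\<close>

lemma transition_extends:
  assumes c: "c \<in> A" "c' \<in> A" "x \<in> dom c" "x \<in> dom c'"
  obtains V g where "open V" "coord c x \<in> V" "g holomorphic_on V"
    "\<And>w. w \<in> V \<inter> img c \<Longrightarrow> param c w \<in> dom c' \<and> g w = coord c' (param c w)"
proof -
  obtain V g where V: "open V" "coord c x \<in> V" "g holomorphic_on V"
    "\<forall>y\<in>dom c \<inter> dom c'. coord c y \<in> V \<longrightarrow> g (coord c y) = coord c' y"
    using transitions[OF c(1,2), unfolded holomorphic_transition_def, rule_format, OF IntI[OF c(3,4)]] by auto
  obtain T where T: "open T" "coord c ` (dom c \<inter> dom c') = img c \<inter> T"
    using openin_image_obtain[OF c(1) chart_openin[OF c(2)]] .
  show ?thesis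
  proof (rule that[of "V \<inter> T" g])
    show "coord c x \<in> V \<inter> T" using V T c by blast
    show "g holomorphic_on V \<inter> T" using V holomorphic_on_subset by blast
    show "param c w \<in> dom c' \<and> g w = coord c' (param c w)" if w: "w \<in> V \<inter> T \<inter> img c" for w
    proof -
      have "w \<in> coord c ` (dom c \<inter> dom c')" using T w by blast
      then obtain y where y: "y \<in> dom c \<inter> dom c'" "w = coord c y" by blast
      then have "g (coord c y) = coord c' y" using V(4) w by blast
      then show ?thesis using y c(1) by simp
    qed
  qed (use V T in auto)
qed

text \<open>The derivative of the change of coordinates from \<open>c\<close> to \<open>c'\<close>, taken at a point of the surface. It is the
factor $d$ in the transformation law of forms.\<close>

definition transition_deriv :: "'a chart \<Rightarrow> 'a chart \<Rightarrow> 'a \<Rightarrow> complex" where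
  "transition_deriv c c' x = (THE d. ((\<lambda>w. coord c' (param c w)) has_field_derivative d)
      (at (coord c x) within coord c ` (dom c \<inter> dom c')))"

lemma chart_open_overlap: "c \<in> A \<Longrightarrow> c' \<in> A \<Longrightarrow> chart_open (coord c ` (dom c \<inter> dom c'))"
  using chart_open_image chart_openin by blast

lemma transition_deriv_eqI:
  assumes "c \<in> A" "c' \<in> A" "x \<in> dom c" "x \<in> dom c'"
    "((\<lambda>w. coord c' (param c w)) has_field_derivative d) (at (coord c x) within coord c ` (dom c \<inter> dom c'))"
  shows "transition_deriv c c' x = d"
  unfolding transition_deriv_def
proof (rule the_equality)
  show "e = d" if "((\<lambda>w. coord c' (param c w)) has_field_derivative e) (at (coord c x) within coord c ` (dom c \<inter> dom c'))" for e
    using chart_open_field_derivative_unique[OF chart_open_overlap[OF assms(1,2)] _ that assms(5)] assms by blast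
qed fact

text \<open>Locally, a change of coordinates is the restriction of a holomorphic function on an open subset of the
plane. The domain is shrunk so far that the chart's image meets it only in points of the overlap.\<close>

lemma transition_extends_deriv:
  assumes c: "c \<in> A" "c' \<in> A" "x \<in> dom c" "x \<in> dom c'"
  obtains V g where "open V" "coord c x \<in> V" "g holomorphic_on V"
    "\<And>w. w \<in> V \<inter> img c \<Longrightarrow> param c w \<in> dom c'" "\<And>w. w \<in> V \<inter> img c \<Longrightarrow> g w = coord c' (param c w)"
    "\<And>w. w \<in> V \<inter> img c \<Longrightarrow> deriv g w = transition_deriv c c' (param c w)"
    "\<And>w. w \<in> V \<inter> img c \<Longrightarrow> ((\<lambda>w. coord c' (param c w)) has_field_derivative transition_deriv c c' (param c w))
         (at w within coord c ` (dom c \<inter> dom c'))"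
proof -
  obtain V g where V: "open V" "coord c x \<in> V" "g holomorphic_on V"
    and g: "\<And>w. w \<in> V \<inter> img c \<Longrightarrow> param c w \<in> dom c' \<and> g w = coord c' (param c w)"
    using transition_extends[OF c] by blast
  have D: "((\<lambda>w. coord c' (param c w)) has_field_derivative deriv g w) (at w within coord c ` (dom c \<inter> dom c'))"
    if w: "w \<in> V \<inter> img c" for w
  proof -
    have 1: "(g has_field_derivative deriv g w) (at w within coord c ` (dom c \<inter> dom c'))"
      using V w holomorphic_derivI by (blast intro: has_field_derivative_at_within)
    obtain e where e: "e > 0" "\<And>y. dist y w < e \<Longrightarrow> y \<in> V" using V(1) w unfolding open_dist by blast
    have wO: "w \<in> coord c ` (dom c \<inter> dom c')"
      using g[OF w] w by (intro image_eqI[of _ _ "param c w"]) auto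
    show ?thesis
    proof (rule has_field_derivative_transform_within[OF 1 e(1) wO])
      show "g y = coord c' (param c y)" if "y \<in> coord c ` (dom c \<inter> dom c')" "dist y w < e" for y
        using g[of y] e(2)[OF that(2)] that(1) by blast
    qed
  qed
  have "deriv g w = transition_deriv c c' (param c w)" if w: "w \<in> V \<inter> img c" for w
    using transition_deriv_eqI[OF c(1,2), of "param c w" "deriv g w"] D[OF w] g[OF w] w by auto
  with that[OF V] g D show ?thesis by metis
qed

lemma transition_deriv_has_derivative:
  assumes "c \<in> A" "c' \<in> A" "x \<in> dom c" "x \<in> dom c'"
  shows "((\<lambda>w. coord c' (param c w)) has_field_derivative transition_deriv c c' x) (at (coord c x) within coord c ` (dom c \<inter> dom c'))"
proof -
  obtain V g where "coord c x \<in> V"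
    "\<And>w. w \<in> V \<inter> img c \<Longrightarrow> ((\<lambda>w. coord c' (param c w)) has_field_derivative transition_deriv c c' (param c w))
         (at w within coord c ` (dom c \<inter> dom c'))"
    using transition_extends_deriv[OF assms] by metis
  then show ?thesis using assms by (metis IntI imageI param_coord)
qed

lemma transition_deriv_cocycle:
  assumes c: "c \<in> A" "c' \<in> A" "c'' \<in> A" and x: "x \<in> dom c" "x \<in> dom c'" "x \<in> dom c''"
  shows "transition_deriv c c'' x = transition_deriv c c' x * transition_deriv c' c'' x"
proof -
  let ?O = "coord c ` (dom c \<inter> (dom c' \<inter> dom c''))"
  have O: "chart_open ?O" using c by (intro chart_open_image) (auto intro: chart_openin)
  have xO: "coord c x \<in> ?O" using x by blast
  have D1: "((\<lambda>w. coord c' (param c w)) has_field_derivative transition_deriv c c' x) (at (coord c x) within ?O)"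
    by (rule DERIV_subset[OF transition_deriv_has_derivative[OF c(1,2) x(1,2)]]) auto
  have "(\<lambda>w. coord c' (param c w)) ` ?O \<subseteq> coord c' ` (dom c' \<inter> dom c'')" using c by auto
  then have D2: "((\<lambda>w. coord c'' (param c' w)) has_field_derivative transition_deriv c' c'' x)
     (at ((\<lambda>w. coord c' (param c w)) (coord c x)) within (\<lambda>w. coord c' (param c w)) ` ?O)"
    using DERIV_subset[OF transition_deriv_has_derivative[OF c(2,3) x(2,3)]] x c by simp
  have "((\<lambda>w. coord c'' (param c w)) has_field_derivative transition_deriv c' c'' x * transition_deriv c c' x) (at (coord c x) within ?O)"
    by (rule has_field_derivative_transform_within[OF DERIV_image_chain[OF D2 D1] zero_less_one xO])
       (use c in auto)
  moreover have "((\<lambda>w. coord c'' (param c w)) has_field_derivative transition_deriv c c'' x) (at (coord c x) within ?O)"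
    by (rule DERIV_subset[OF transition_deriv_has_derivative[OF c(1,3) x(1,3)]]) auto
  ultimately show ?thesis
    using chart_open_field_derivative_unique[OF O xO] by (metis mult.commute)
qed

lemma transition_deriv_self: "c \<in> A \<Longrightarrow> x \<in> dom c \<Longrightarrow> transition_deriv c c x = 1"
proof (rule transition_deriv_eqI)
  assume "c \<in> A" "x \<in> dom c"
  then show "((\<lambda>w. coord c (param c w)) has_field_derivative 1) (at (coord c x) within coord c ` (dom c \<inter> dom c))"
    by (intro has_field_derivative_transform_within[OF DERIV_ident zero_less_one]) auto
qed auto

lemma transition_deriv_inverse:
  assumes "c \<in> A" "c' \<in> A" "x \<in> dom c" "x \<in> dom c'"
  shows "transition_deriv c c' x * transition_deriv c' c x = 1" "transition_deriv c c' x \<noteq> 0"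
  using transition_deriv_cocycle[of c c' c x] transition_deriv_self assms by auto

text \<open>Invariance of the boundary: a change of coordinates is an injective holomorphic map near an interior point,
so by the open mapping theorem it takes interior points to interior points.\<close>

lemma boundary_iff:
  assumes "c \<in> A" "x \<in> dom c"
  shows "x \<in> surface_boundary A \<longleftrightarrow> coord c x \<notin> interior (img c)"
proof
  assume "coord c x \<notin> interior (img c)"
  then show "x \<in> surface_boundary A" using assms by (auto simp: surface_boundary_def)
next
  assume "x \<in> surface_boundary A"
  then obtain c' where c': "c' \<in> A" "x \<in> dom c'" "coord c' x \<notin> interior (img c')"
    by (auto simp: surface_boundary_def)
  obtain V g where V: "open V" "coord c x \<in> V" "g holomorphic_on V"
    and g: "\<And>w. w \<in> V \<inter> img c \<Longrightarrow> param c w \<in> dom c' \<and> g w = coord c' (param c w)"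
    using transition_extends[OF assms(1) c'(1) assms(2) c'(2)] by blast
  show "coord c x \<notin> interior (img c)"
  proof
    assume x: "coord c x \<in> interior (img c)"
    let ?U = "V \<inter> interior (img c)"
    have U: "?U \<subseteq> V \<inter> img c" using interior_subset by blast
    have "open (g ` ?U)"
    proof (rule open_mapping_thm3)
      show "inj_on g ?U"
      proof (rule inj_onI)
        fix a b assume ab: "a \<in> ?U" "b \<in> ?U" "g a = g b"
        then have "a \<in> V \<inter> img c" "b \<in> V \<inter> img c" using U by blast+
        moreover from this have "param c a = param c b"
          using g[of a] g[of b] coord_inj[OF c'(1)] ab(3) by (metis inj_onD)
        ultimately show "a = b" by (metis IntD2 coord_param)
      qed
      show "g holomorphic_on ?U" using V holomorphic_on_subset by blast
    qed (use V in auto)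
    moreover have "g ` ?U \<subseteq> img c'" using U g by auto
    moreover have "coord c' x \<in> g ` ?U"
      using g[of "coord c x"] V x assms by (intro image_eqI[of _ _ "coord c x"]) auto
    ultimately show False using c'(3) interior_maximal by blast
  qed
qed

section \<open>Smooth functions on the surface\<close>

text \<open>Smoothness at a point, read in the chart \<open>c\<close>; by \<open>smooth_at_transfer\<close> the chart does not matter.\<close>

definition smooth_at :: "'a chart \<Rightarrow> ('a \<Rightarrow> 'b::real_normed_vector) \<Rightarrow> 'a \<Rightarrow> bool" where
  "smooth_at c f x \<longleftrightarrow> smooth_germ (img c) (\<lambda>w. f (param c w)) (coord c x)"

lemma smooth_at_cong:
  assumes "smooth_at c f x" "c \<in> A" "openin X U" "x \<in> U" "x \<in> dom c" "\<And>y. y \<in> U \<inter> dom c \<Longrightarrow> f y = g y"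
  shows "smooth_at c g x"
proof -
  obtain T where T: "open T" "coord c ` (dom c \<inter> U) = img c \<inter> T"
    using openin_image_obtain[OF assms(2,3)] .
  show ?thesis unfolding smooth_at_def
  proof (rule smooth_germ_cong[OF assms(1)[unfolded smooth_at_def] T(1)])
    show "coord c x \<in> T" using T assms by blast
    show "w \<in> img c \<and> f (param c w) = g (param c w)" if w: "w \<in> T \<inter> img c" for w
    proof -
      have "w \<in> coord c ` (dom c \<inter> U)" using T w by blast
      then obtain y where "y \<in> dom c \<inter> U" "w = coord c y" by blast
      then show ?thesis using assms(2,6) by simp
    qed
  qed
qed

lemma smooth_at_transfer:
  fixes f :: "'a \<Rightarrow> complex"
  assumes c: "c \<in> A" "c' \<in> A" "x \<in> dom c" "x \<in> dom c'" and f: "smooth_at c' f x"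
  shows "smooth_at c f x"
proof -
  obtain V g where V: "open V" "coord c x \<in> V" "g holomorphic_on V"
    and g: "\<And>w. w \<in> V \<inter> img c \<Longrightarrow> param c w \<in> dom c' \<and> g w = coord c' (param c w)"
    using transition_extends[OF c] by blast
  have gx: "g (coord c x) = coord c' x" using g[of "coord c x"] V c by auto
  have "smooth_germ (img c) (\<lambda>w. f (param c' (g w))) (coord c x)"
    by (rule smooth_germ_compose[OF _ V, of "img c'" "\<lambda>w. f (param c' w)"])
       (use f g gx in \<open>auto simp: smooth_at_def\<close>)
  then show ?thesis unfolding smooth_at_def
    by (rule smooth_germ_cong[OF _ V(1,2)]) (use g c in auto)
qed

lemma smooth_at_transfer_real:
  fixes f :: "'a \<Rightarrow> real"
  assumes c: "c \<in> A" "c' \<in> A" "x \<in> dom c" "x \<in> dom c'" and f: "smooth_at c' f x"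
  shows "smooth_at c f x"
proof -
  have "smooth_at c' (\<lambda>y. complex_of_real (f y)) x"
    using f smooth_germ_of_real unfolding smooth_at_def by blast
  from smooth_at_transfer[OF c this] show ?thesis
    unfolding smooth_at_def by (auto dest: smooth_germ_bounded_linear[OF bounded_linear_Re])
qed

lemma smooth_at_tderiv:
  assumes c: "c \<in> A" "c' \<in> A" "x \<in> dom c" "x \<in> dom c'"
  shows "smooth_at c (transition_deriv c c') x"
proof -
  obtain V g where V: "open V" "coord c x \<in> V" "g holomorphic_on V"
    and g: "\<And>w. w \<in> V \<inter> img c \<Longrightarrow> deriv g w = transition_deriv c c' (param c w)"
    using transition_extends_deriv[OF c] by metis
  have "smooth_germ (img c) (deriv g) (coord c x)"
    by (rule smooth_germ_holomorphic[OF V(1,2)]) (use V holomorphic_deriv in blast)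
  then show ?thesis unfolding smooth_at_def
    by (rule smooth_germ_cong[OF _ V(1,2)]) (use g in auto)
qed

definition smooth_function :: "('a \<Rightarrow> real) \<Rightarrow> bool" where
  "smooth_function f \<longleftrightarrow> (\<forall>c\<in>A. \<forall>x\<in>dom c. smooth_at c f x)"

lemma smooth_function_iff: "smooth_function f \<longleftrightarrow> (\<forall>c\<in>A. smooth_on (img c) (\<lambda>w. f (param c w)))"
  unfolding smooth_function_def smooth_at_def smooth_on_germ by auto

section \<open>Partitions of unity\<close>

text \<open>A plateau function in a chart, extended by 0. A small closed disc about a boundary point of a half-plane
chart meets the image of the chart in a closed half disc, so the support is compact in any case;
as the surface is Hausdorff, the support is closed and the extension by 0 is smooth.\<close>

lemma bump_exists:
  assumes c: "c \<in> A" "x0 \<in> dom c" and U: "openin X U" "x0 \<in> U"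
  obtains \<phi> K N where "smooth_function \<phi>" "\<And>x. 0 \<le> \<phi> x" "\<And>x. \<phi> x \<le> 1" "compactin X K" "K \<subseteq> U \<inter> dom c"
    "\<And>x. x \<notin> K \<Longrightarrow> \<phi> x = 0" "openin X N" "x0 \<in> N" "\<And>x. x \<in> N \<Longrightarrow> \<phi> x = 1"
proof -
  obtain T where T: "open T" "coord c ` (dom c \<inter> U) = img c \<inter> T"
    using openin_image_obtain[OF c(1) U(1)] .
  define z0 where "z0 = coord c x0"
  have z0: "z0 \<in> img c" "z0 \<in> T" using T c U by (auto simp: z0_def)
  obtain V where V: "open V" "z0 \<in> V" "\<And>r. cball z0 r \<subseteq> V \<Longrightarrow> closed (cball z0 r \<inter> img c)"
  proof (cases "open (img c)")
    case True
    show ?thesis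
    proof (rule that[of "img c"])
      show "closed (cball z0 r \<inter> img c)" if "cball z0 r \<subseteq> img c" for r
        using that by (metis closed_cball inf.absorb1)
    qed (use True z0 in auto)
  next
    case False
    then obtain S where S: "open S" "img c = half_plane \<inter> S"
      using img_chart_open[OF c(1)] by (auto simp: chart_open_def openin_open)
    show ?thesis
    proof (rule that[of S])
      show "closed (cball z0 r \<inter> img c)" if "cball z0 r \<subseteq> S" for r
      proof -
        have "cball z0 r \<inter> img c = cball z0 r \<inter> half_plane" using that S by blast
        then show ?thesis by (simp add: closed_Int closed_half_plane)
      qed
    qed (use S z0 in auto)
  qed
  have "open (V \<inter> T)" "z0 \<in> V \<inter> T" using V T z0 by auto
  then obtain r where r: "r > 0" "cball z0 r \<subseteq> V \<inter> T" using open_contains_cball by blast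
  define K where "K = {x \<in> dom c. coord c x \<in> cball z0 r}"
  define \<phi> where "\<phi> = (\<lambda>x. if x \<in> dom c then plateau z0 r (coord c x) else 0)"
  have "coord c ` K = cball z0 r \<inter> img c" by (auto simp: K_def)
  then have "compact (coord c ` K)" using V(3)[of r] r(2) by (metis Int_lower1 bounded_cball bounded_subset compact_eq_bounded_closed le_inf_iff)
  then have K: "compactin X K" using compact_image[of c K] c by (auto simp: K_def)
  have KU: "K \<subseteq> U \<inter> dom c"
  proof
    fix x assume x: "x \<in> K"
    then have "coord c x \<in> coord c ` (dom c \<inter> U)" using T r(2) by (auto simp: K_def)
    then show "x \<in> U \<inter> dom c" using x coord_inj[OF c(1)] by (auto simp: K_def dest: inj_onD)
  qed
  have \<phi>0: "\<phi> x = 0" if "x \<notin> K" for x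
    using that plateau_props(5)[OF r(1), of "coord c x" z0]
    by (auto simp: \<phi>_def K_def dist_norm norm_minus_commute)
  have s: "smooth_function \<phi>"
    unfolding smooth_function_def
  proof (intro ballI)
    fix c' x assume c': "c' \<in> A" "x \<in> dom c'"
    show "smooth_at c' \<phi> x"
    proof (cases "x \<in> dom c")
      case True
      have "smooth_germ (img c) (plateau z0 r) (coord c x)"
        by (rule smooth_germ_Ck[OF open_UNIV]) (use plateau_props(1)[OF r(1)] in auto)
      then have "smooth_at c \<phi> x" unfolding smooth_at_def
        by (rule smooth_germ_cong[OF _ open_UNIV]) (auto simp: \<phi>_def)
      then show ?thesis using smooth_at_transfer_real c' c True by blast
    next
      case False
      have "smooth_at c' (\<lambda>_. 0::real) x" by (simp add: smooth_at_def smooth_germ_const)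
      then show ?thesis
        by (rule smooth_at_cong[OF _ c'(1) openin_Compl[OF compactin_closedin[OF K]]])
           (use c'(2) False KU dom_subset[OF c'(1)] \<phi>0 in auto)
    qed
  qed
  show ?thesis
  proof (rule that[OF s _ _ K KU \<phi>0])
    show "openin X {x \<in> dom c. coord c x \<in> ball z0 (r/2)}" by (rule openin_preimage) (use c in auto)
    show "x0 \<in> {x \<in> dom c. coord c x \<in> ball z0 (r/2)}" using c r by (simp add: z0_def)
    show "\<phi> x = 1" if "x \<in> {x \<in> dom c. coord c x \<in> ball z0 (r/2)}" for x
      using that plateau_props(4)[OF r(1), of "coord c x" z0] by (auto simp: \<phi>_def dist_norm norm_minus_commute)
  qed (use plateau_props(2,3)[OF r(1)] in \<open>auto simp: \<phi>_def\<close>)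
qed

text \<open>Finitely many bumps suffice by compactness, and dividing by their sum normalises them. The partition
is a set of pairs, so it must be checked that the division does not identify two bumps; they all vanish
off the surface, hence are determined by their quotients.\<close>

theorem partition_exists: "\<exists>P. partition_of_unity X A P"
proof -
  define Q where "Q = (\<lambda>p N. fst p \<in> A \<and> smooth_function (snd p) \<and> (\<forall>x. 0 \<le> snd p x) \<and>
     (\<exists>K. compactin X K \<and> K \<subseteq> dom (fst p) \<and> (\<forall>x. x \<notin> K \<longrightarrow> snd p x = 0)) \<and> openin X N \<and>
     (\<forall>x\<in>N. snd p x = (1::real)))"
  have "\<forall>x\<in>topspace X. \<exists>p N. Q p N \<and> x \<in> N"
  proof
    fix x assume x: "x \<in> topspace X"
    then obtain c where c: "c \<in> A" "x \<in> dom c" using cover by blast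
    from bump_exists[OF c openin_topspace x] obtain \<phi> K N where "smooth_function \<phi>" "\<And>x. 0 \<le> \<phi> x" "compactin X K"
      "K \<subseteq> dom c" "\<And>x. x \<notin> K \<Longrightarrow> \<phi> x = 0" "openin X N" "x \<in> N" "\<And>x. x \<in> N \<Longrightarrow> \<phi> x = 1"
      by (metis le_inf_iff)
    then have "Q (c, \<phi>) N \<and> x \<in> N" unfolding Q_def using c by auto
    then show "\<exists>p N. Q p N \<and> x \<in> N" by blast
  qed
  then obtain p N where pN: "\<And>x. x \<in> topspace X \<Longrightarrow> Q (p x) (N x) \<and> x \<in> N x" by metis
  have "\<exists>F. finite F \<and> F \<subseteq> N ` topspace X \<and> topspace X \<subseteq> \<Union>F"
  proof (rule compactinD[of X "topspace X"])
    show "compactin X (topspace X)" using compact by (simp add: compact_space_def)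
    show "openin X U" if "U \<in> N ` topspace X" for U using that pN by (auto simp: Q_def)
  qed (use pN in blast)
  then obtain F where F: "finite F" "F \<subseteq> topspace X" "topspace X \<subseteq> \<Union>(N ` F)"
    by (metis finite_subset_image)
  define P0 where "P0 = p ` F"
  define S where "S = (\<lambda>x. \<Sum>q\<in>P0. snd q x)"
  have P0: "finite P0" "\<And>q. q \<in> P0 \<Longrightarrow> \<exists>N. Q q N" using F pN unfolding P0_def by blast+
  have nn: "0 \<le> snd q x" if "q \<in> P0" for q x using P0(2)[OF that] by (auto simp: Q_def)
  have S1: "S x \<ge> 1" if x: "x \<in> topspace X" for x
  proof -
    obtain y where y: "y \<in> F" "x \<in> N y" using F x by blast
    then have "snd (p y) x = 1" using pN[of y] F by (auto simp: Q_def)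
    moreover have "snd (p y) x \<le> S x"
      unfolding S_def by (rule member_le_sum) (use y P0 nn in \<open>auto simp: P0_def\<close>)
    ultimately show ?thesis by simp
  qed
  have out: "snd q x = 0" if q: "q \<in> P0" "x \<notin> topspace X" for q x
  proof -
    obtain K where "compactin X K" "\<forall>x. x \<notin> K \<longrightarrow> snd q x = 0" using P0(2)[OF q(1)] by (auto simp: Q_def)
    then show ?thesis using q(2) compactin_subset_topspace by blast
  qed
  let ?f = "\<lambda>q. (fst q, \<lambda>x. snd q x / S x)"
  have inj: "inj_on ?f P0"
  proof (rule inj_onI)
    fix q q' assume q: "q \<in> P0" "q' \<in> P0" "?f q = ?f q'"
    have "snd q x = snd q' x" for x
    proof (cases "x \<in> topspace X")
      case True
      have "snd (?f q) x = snd (?f q') x" by (simp only: q(3))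
      then have "snd q x / S x = snd q' x / S x" by simp
      then show ?thesis using S1[OF True] by simp
    qed (use out q in auto)
    then have "snd q = snd q'" by (rule ext)
    moreover have "fst q = fst q'" using arg_cong[OF q(3), of fst] by simp
    ultimately show "q = q'" by (simp only: prod_eq_iff)
  qed
  have sS: "smooth_at c S x" if "c \<in> A" "x \<in> dom c" for c x
  proof -
    have "smooth_at c (snd q) x" if "q \<in> P0" for q
      using P0(2)[OF that] \<open>c \<in> A\<close> \<open>x \<in> dom c\<close> by (auto simp: Q_def smooth_function_def)
    then show ?thesis unfolding smooth_at_def S_def by (intro smooth_germ_sum)
  qed
  have "partition_of_unity X A (?f ` P0)"
    unfolding partition_of_unity_def
  proof (intro conjI ballI)
    show "finite (?f ` P0)" using P0 by simp
  next
    fix cr assume "cr \<in> ?f ` P0"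
    then obtain q where q: "q \<in> P0" "cr = ?f q" by blast
    obtain K where K: "fst q \<in> A" "smooth_function (snd q)" "compactin X K" "K \<subseteq> dom (fst q)" "\<And>x. x \<notin> K \<Longrightarrow> snd q x = 0"
      using P0(2)[OF q(1)] by (auto simp: Q_def)
    have "X closure_of {x \<in> topspace X. snd q x / S x \<noteq> 0} \<subseteq> K"
      by (rule closure_of_minimal) (use K compactin_closedin in auto)
    moreover have "0 \<le> snd q x / S x" if "x \<in> topspace X" for x
      using S1[OF that] nn[OF q(1), of x] by simp
    moreover have "smooth_on (img c') (\<lambda>w. snd q (param c' w) / S (param c' w))" if c': "c' \<in> A" for c'
      unfolding smooth_on_germ
    proof
      fix w assume w: "w \<in> img c'"
      then obtain x where x: "x \<in> dom c'" "w = coord c' x" by blast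
      have "S (param c' w) \<noteq> 0" using S1[of x] x c' dom_subset by fastforce
      then show "smooth_germ (img c') (\<lambda>w. snd q (param c' w) / S (param c' w)) w"
        using K(2) sS[OF c' x(1)] c' x w
        by (intro smooth_germ_divide) (auto simp: smooth_function_def smooth_at_def)
    qed
    ultimately show "case cr of (c, \<rho>) \<Rightarrow> c \<in> A \<and> (\<forall>x\<in>topspace X. 0 \<le> \<rho> x) \<and>
        X closure_of {x \<in> topspace X. \<rho> x \<noteq> 0} \<subseteq> dom c \<and> (\<forall>c'\<in>A. smooth_on (img c') (\<lambda>w. \<rho> (param c' w)))"
      using K q(2) by auto
  next
    fix x assume x: "x \<in> topspace X"
    have "(\<Sum>(c, \<rho>)\<in>?f ` P0. \<rho> x) = (\<Sum>q\<in>P0. snd q x / S x)"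
      by (subst sum.reindex[OF inj]) simp
    also have "\<dots> = (\<Sum>q\<in>P0. snd q x) / S x" by (rule sum_divide_distrib[symmetric])
    also have "\<dots> = S x / S x" by (simp only: S_def)
    also have "\<dots> = 1" using S1[OF x] by simp
    finally show "(\<Sum>(c, \<rho>)\<in>?f ` P0. \<rho> x) = 1" .
  qed
  then show ?thesis by blast
qed

lemma some_partition: "partition_of_unity X A (some_partition X A)"
  unfolding some_partition_def using partition_exists by (rule someI_ex)

section \<open>Densities and their integrals\<close>

text \<open>The surface carries no measure; measurability is expressed through the charts.\<close>

definition borel_in :: "'a set \<Rightarrow> bool" where
  "borel_in E \<longleftrightarrow> (\<forall>c\<in>A. coord c ` (dom c \<inter> E) \<in> sets borel)"

lemma borel_inD: "borel_in E \<Longrightarrow> c \<in> A \<Longrightarrow> coord c ` (dom c \<inter> E) \<in> sets borel"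
  unfolding borel_in_def by blast

lemma borel_in_open: "openin X U \<Longrightarrow> borel_in U"
  unfolding borel_in_def using chart_open_borel chart_open_image by blast

lemma borel_in_Diff:
  assumes "borel_in E" "borel_in F"
  shows "borel_in (E - F)"
  unfolding borel_in_def
proof
  fix c assume c: "c \<in> A"
  have "coord c ` (dom c \<inter> (E - F)) = coord c ` (dom c \<inter> E) - coord c ` (dom c \<inter> F)"
    using coord_inj[OF c] by (auto dest: inj_onD)
  then show "coord c ` (dom c \<inter> (E - F)) \<in> sets borel"
    using borel_inD[OF assms(1) c] borel_inD[OF assms(2) c] by (simp add: sets.Diff)
qed

lemma borel_in_Int: "borel_in E \<Longrightarrow> borel_in F \<Longrightarrow> borel_in (E \<inter> F)"
  using borel_in_Diff[of E "E - F"] borel_in_Diff[of E F] by (simp add: Diff_Diff_Int)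

lemma borel_in_UN:
  assumes "finite I" "\<And>i. i \<in> I \<Longrightarrow> borel_in (E i)"
  shows "borel_in (\<Union>i\<in>I. E i)"
  unfolding borel_in_def
proof
  fix c assume c: "c \<in> A"
  have "coord c ` (dom c \<inter> (\<Union>i\<in>I. E i)) = (\<Union>i\<in>I. coord c ` (dom c \<inter> E i))" by blast
  then show "coord c ` (dom c \<inter> (\<Union>i\<in>I. E i)) \<in> sets borel"
    using borel_inD[OF assms(2) c] assms(1) by (auto intro!: sets.finite_UN)
qed

lemma borel_in_topspace: "borel_in (topspace X)"
  by (rule borel_in_open) simp

lemma borel_in_closed:
  assumes "closedin X K"
  shows "borel_in K"
proof -
  have "K = topspace X - (topspace X - K)" using closedin_subset[OF assms] by blast
  then show ?thesis
    using borel_in_Diff[OF borel_in_topspace borel_in_open[OF openin_Compl[OF assms]]] by simp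
qed

lemma borel_in_ball: "c \<in> A \<Longrightarrow> borel_in (coordinate_ball c \<epsilon>)"
proof -
  assume c: "c \<in> A"
  have "coordinate_ball c \<epsilon> = dom c - {x \<in> dom c. coord c x \<in> - cball 0 \<epsilon>}"
    by (auto simp: coordinate_ball_def)
  moreover have "borel_in {x \<in> dom c. coord c x \<in> - cball 0 \<epsilon>}"
    by (intro borel_in_open openin_preimage c open_Compl closed_cball)
  ultimately show ?thesis using borel_in_Diff[OF borel_in_open[OF chart_openin[OF c]]] by simp
qed

text \<open>What integration uses of a $(1,1)$-form: measurable coefficients that transform with the factor $d\bar d = |d|^2$.\<close>

definition density_on :: "'a set \<Rightarrow> 'a form \<Rightarrow> bool" where
  "density_on E \<eta> \<longleftrightarrow> borel_in E \<and>
     (\<forall>c\<in>A. \<forall>c'\<in>A. \<forall>x\<in>dom c \<inter> dom c' \<inter> E. \<eta> c x = of_real ((cmod (transition_deriv c c' x))\<^sup>2) * \<eta> c' x) \<and>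
     (\<forall>c\<in>A. (\<lambda>w. indicator (coord c ` (dom c \<inter> E)) w *\<^sub>R \<eta> c (param c w)) \<in> borel_measurable borel)"

lemma density_on_borel: "density_on E \<eta> \<Longrightarrow> borel_in E"
  unfolding density_on_def by blast

lemma density_on_law:
  "density_on E \<eta> \<Longrightarrow> c \<in> A \<Longrightarrow> c' \<in> A \<Longrightarrow> x \<in> dom c \<Longrightarrow> x \<in> dom c' \<Longrightarrow> x \<in> E \<Longrightarrow>
    \<eta> c x = of_real ((cmod (transition_deriv c c' x))\<^sup>2) * \<eta> c' x"
  unfolding density_on_def by blast

lemma density_on_measurable:
  "density_on E \<eta> \<Longrightarrow> c \<in> A \<Longrightarrow>
    (\<lambda>w. indicator (coord c ` (dom c \<inter> E)) w *\<^sub>R \<eta> c (param c w)) \<in> borel_measurable borel"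
  unfolding density_on_def by blast

lemma density_on_subset:
  assumes "density_on E \<eta>" "borel_in E'" "E' \<subseteq> E"
  shows "density_on E' \<eta>"
  unfolding density_on_def
proof (intro conjI ballI assms(2))
  fix c assume c: "c \<in> A"
  note [measurable] = borel_inD[OF assms(2) c] density_on_measurable[OF assms(1) c]
  have "(\<lambda>w. indicator (coord c ` (dom c \<inter> E')) w *\<^sub>R (indicator (coord c ` (dom c \<inter> E)) w *\<^sub>R \<eta> c (param c w)))
     \<in> borel_measurable borel" by measurable
  moreover have "(\<lambda>w. indicator (coord c ` (dom c \<inter> E')) w *\<^sub>R (indicator (coord c ` (dom c \<inter> E)) w *\<^sub>R \<eta> c (param c w)))
     = (\<lambda>w. indicator (coord c ` (dom c \<inter> E')) w *\<^sub>R \<eta> c (param c w))"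
    using assms(3) by (force simp: indicator_def fun_eq_iff)
  ultimately show "(\<lambda>w. indicator (coord c ` (dom c \<inter> E')) w *\<^sub>R \<eta> c (param c w)) \<in> borel_measurable borel" by simp
next
  fix c c' x assume "c \<in> A" "c' \<in> A" "x \<in> dom c \<inter> dom c' \<inter> E'"
  then show "\<eta> c x = of_real ((cmod (transition_deriv c c' x))\<^sup>2) * \<eta> c' x"
    using density_on_law[OF assms(1), of c c' x] assms(3) by blast
qed

lemma density_on_add:
  assumes "density_on E \<eta>" "density_on E \<theta>"
  shows "density_on E (\<lambda>c x. \<eta> c x + \<theta> c x)"
  unfolding density_on_def
proof (intro conjI ballI density_on_borel[OF assms(1)])
  fix c assume c: "c \<in> A"
  note [measurable] = density_on_measurable[OF assms(1) c] density_on_measurable[OF assms(2) c]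
  show "(\<lambda>w. indicator (coord c ` (dom c \<inter> E)) w *\<^sub>R (\<eta> c (param c w) + \<theta> c (param c w))) \<in> borel_measurable borel"
    unfolding scaleR_add_right by measurable
next
  fix c c' x assume "c \<in> A" "c' \<in> A" "x \<in> dom c \<inter> dom c' \<inter> E"
  then show "\<eta> c x + \<theta> c x = of_real ((cmod (transition_deriv c c' x))\<^sup>2) * (\<eta> c' x + \<theta> c' x)"
    using density_on_law[OF assms(1), of c c' x] density_on_law[OF assms(2), of c c' x]
    by (simp add: distrib_left)
qed

lemma density_on_scale:
  fixes f :: "'a \<Rightarrow> real"
  assumes "density_on E \<eta>" "\<And>c. c \<in> A \<Longrightarrow> continuous_on (img c) (\<lambda>w. f (param c w))"
  shows "density_on E (\<lambda>c x. of_real (f x) * \<eta> c x)"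
  unfolding density_on_def
proof (intro conjI ballI density_on_borel[OF assms(1)])
  fix c assume c: "c \<in> A"
  have [measurable]: "(\<lambda>w. indicator (img c) w *\<^sub>R f (param c w)) \<in> borel_measurable borel"
    by (rule borel_measurable_continuous_on_indicator) (use assms(2) c chart_open_borel img_chart_open in auto)
  note [measurable] = density_on_measurable[OF assms(1) c]
  have "(\<lambda>w. of_real (indicator (img c) w *\<^sub>R f (param c w)) * (indicator (coord c ` (dom c \<inter> E)) w *\<^sub>R \<eta> c (param c w)))
     \<in> borel_measurable borel" by measurable
  moreover have "(\<lambda>w. of_real (indicator (img c) w *\<^sub>R f (param c w)) * (indicator (coord c ` (dom c \<inter> E)) w *\<^sub>R \<eta> c (param c w)))
     = (\<lambda>w. indicator (coord c ` (dom c \<inter> E)) w *\<^sub>R (of_real (f (param c w)) * \<eta> c (param c w)))"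
    by (auto simp: indicator_def fun_eq_iff)
  ultimately show "(\<lambda>w. indicator (coord c ` (dom c \<inter> E)) w *\<^sub>R (of_real (f (param c w)) * \<eta> c (param c w))) \<in> borel_measurable borel"
    by simp
next
  fix c c' x assume *: "c \<in> A" "c' \<in> A" "x \<in> dom c \<inter> dom c' \<inter> E"
  then show "of_real (f x) * \<eta> c x = of_real ((cmod (transition_deriv c c' x))\<^sup>2) * (of_real (f x) * \<eta> c' x)"
    using density_on_law[OF assms(1), of c c' x] by simp
qed

text \<open>The coefficients of a $(1,1)$-form transform exactly like the integrand in the change of variables formula.\<close>

lemma density_chart_change:
  assumes \<eta>: "density_on E \<eta>" and c: "c \<in> A" "c' \<in> A" and E: "E \<subseteq> dom c" "E \<subseteq> dom c'"
  shows "set_integrable lborel (coord c ` E) (\<lambda>w. \<eta> c (param c w)) \<longleftrightarrow>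
         set_integrable lborel (coord c' ` E) (\<lambda>w. \<eta> c' (param c' w))" (is ?A)
    and "(LINT w:coord c ` E|lborel. \<eta> c (param c w)) = (LINT w:coord c' ` E|lborel. \<eta> c' (param c' w))" (is ?B)
proof -
  let ?S = "coord c ` E" and ?g = "\<lambda>w. coord c' (param c w)"
  have e: "dom c \<inter> E = E" "dom c' \<inter> E = E" using E by auto
  have gS: "?g ` ?S = coord c' ` E" using E c by (force simp: image_image)
  have eq: "of_real ((cmod (transition_deriv c c' (param c w)))\<^sup>2) * \<eta> c' (param c' (?g w)) = \<eta> c (param c w)" if w: "w \<in> ?S" for w
  proof -
    obtain x where x: "x \<in> E" "w = coord c x" using w by blast
    then have xd: "x \<in> dom c" "x \<in> dom c'" using E by blast+
    then have "param c w = x" "param c' (?g w) = x" using c x by simp_all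
    then show ?thesis using density_on_law[OF \<eta> c xd x(1)] by simp
  qed
  have ind: "(\<lambda>w. indicator ?S w *\<^sub>R (of_real ((cmod (transition_deriv c c' (param c w)))\<^sup>2) * \<eta> c' (param c' (?g w)))) =
    (\<lambda>w. indicator ?S w *\<^sub>R \<eta> c (param c w))"
    using eq by (auto simp: indicator_def fun_eq_iff)
  have S: "?S \<in> sets borel" using borel_inD[OF density_on_borel[OF \<eta>] c(1)] e by simp
  have der: "(?g has_field_derivative transition_deriv c c' (param c w)) (at w within ?S)" if w: "w \<in> ?S" for w
  proof -
    obtain x where x: "x \<in> E" "w = coord c x" using w by blast
    then have p: "x \<in> dom c" "x \<in> dom c'" using E by blast+
    then have px: "param c w = x" using c x by simp
    have sub: "?S \<subseteq> coord c ` (dom c \<inter> dom c')" using E by blast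
    show ?thesis
      unfolding px unfolding x(2) by (rule DERIV_subset[OF transition_deriv_has_derivative[OF c p] sub])
  qed
  have inj: "inj_on ?g ?S"
  proof (rule inj_onI)
    fix a b assume "a \<in> ?S" "b \<in> ?S" and ab: "?g a = ?g b"
    then obtain x y where xy: "x \<in> E" "a = coord c x" "y \<in> E" "b = coord c y" by blast
    then have xd: "x \<in> dom c" "x \<in> dom c'" "y \<in> dom c" "y \<in> dom c'" using E by blast+
    then have "coord c' x = coord c' y" using ab xy c by simp
    then have "x = y" using xd(2,4) coord_inj[OF c(2)] by (simp add: inj_on_eq_iff)
    then show "a = b" using xy by simp
  qed
  have m1: "(\<lambda>w. indicator (?g ` ?S) w *\<^sub>R \<eta> c' (param c' w)) \<in> borel_measurable borel"
    using density_on_measurable[OF \<eta> c(2)] e gS by simp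
  have m2: "(\<lambda>w. indicator ?S w *\<^sub>R (of_real ((cmod (transition_deriv c c' (param c w)))\<^sup>2) * \<eta> c' (param c' (?g w)))) \<in> borel_measurable borel"
    unfolding ind using density_on_measurable[OF \<eta> c(1)] e by simp
  note cov = complex_change_of_variables[OF S der inj m1 m2]
  show ?A using cov(1) unfolding gS set_integrable_def ind by simp
  show ?B using cov(2) unfolding gS set_lebesgue_integral_def ind by simp
qed

definition locally_integrable :: "'a set \<Rightarrow> 'a form \<Rightarrow> bool" where
  "locally_integrable E \<eta> \<longleftrightarrow> (\<forall>x\<in>topspace X. \<exists>U c. openin X U \<and> x \<in> U \<and> c \<in> A \<and> U \<subseteq> dom c \<and>
     set_integrable lborel (coord c ` (U \<inter> E)) (\<lambda>w. \<eta> c (param c w)))"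

definition integrable_form :: "'a set \<Rightarrow> 'a form \<Rightarrow> bool" where
  "integrable_form E \<eta> \<longleftrightarrow> density_on E \<eta> \<and> locally_integrable E \<eta>"

text \<open>Local integrability may be tested in any chart, so near each point the chart can be chosen to suit the
form. Finitely many such neighbourhoods cover a compact set.\<close>

lemma integrable_on_compact:
  assumes \<eta>: "integrable_form E \<eta>" and c: "c \<in> A" and K: "compactin X K" "K \<subseteq> dom c"
  shows "set_integrable lborel (coord c ` (K \<inter> E)) (\<lambda>w. \<eta> c (param c w))"
proof -
  have d: "density_on E \<eta>" and l: "locally_integrable E \<eta>" using \<eta> by (auto simp: integrable_form_def)
  define Q where "Q = (\<lambda>U. openin X U \<and> (\<exists>c'\<in>A. U \<subseteq> dom c' \<and>
     set_integrable lborel (coord c' ` (U \<inter> E)) (\<lambda>w. \<eta> c' (param c' w))))"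
  have "\<exists>F. finite F \<and> F \<subseteq> Collect Q \<and> K \<subseteq> \<Union>F"
  proof (rule compactinD[OF K(1)])
    show "openin X U" if "U \<in> Collect Q" for U using that by (auto simp: Q_def)
    show "K \<subseteq> \<Union>(Collect Q)"
    proof
      fix x assume "x \<in> K"
      then have "x \<in> topspace X" using K(1) compactin_subset_topspace by blast
      then obtain U c' where "openin X U" "x \<in> U" "c' \<in> A" "U \<subseteq> dom c'"
        "set_integrable lborel (coord c' ` (U \<inter> E)) (\<lambda>w. \<eta> c' (param c' w))"
        using l unfolding locally_integrable_def by blast
      then show "x \<in> \<Union>(Collect Q)" unfolding Q_def by blast
    qed
  qed
  then obtain F where F: "finite F" "F \<subseteq> Collect Q" "K \<subseteq> \<Union>F" by blast
  have U: "set_integrable lborel (coord c ` (dom c \<inter> (U \<inter> E))) (\<lambda>w. \<eta> c (param c w))"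
    and Ub: "coord c ` (dom c \<inter> (U \<inter> E)) \<in> sets borel" if UF: "U \<in> F" for U
  proof -
    obtain c' where c': "openin X U" "c' \<in> A" "U \<subseteq> dom c'"
      "set_integrable lborel (coord c' ` (U \<inter> E)) (\<lambda>w. \<eta> c' (param c' w))"
      using UF F(2) unfolding Q_def by blast
    let ?E = "dom c \<inter> (U \<inter> E)"
    have b: "borel_in ?E"
      by (intro borel_in_Int borel_in_open chart_openin c c' density_on_borel[OF d])
    have dE: "density_on ?E \<eta>" by (rule density_on_subset[OF d b]) blast
    show "coord c ` ?E \<in> sets borel"
      using borel_inD[OF b c] by (simp add: Int_assoc[symmetric])
    have "coord c' ` ?E \<in> sets borel"
    proof -
      have "dom c' \<inter> ?E = ?E" using c'(3) by blast
      then show ?thesis using borel_inD[OF b c'(2)] by (simp only:)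
    qed
    then have "set_integrable lborel (coord c' ` ?E) (\<lambda>w. \<eta> c' (param c' w))"
      by (intro set_integrable_subset[OF c'(4)]) auto
    then show "set_integrable lborel (coord c ` ?E) (\<lambda>w. \<eta> c (param c w))"
      using density_chart_change(1)[OF dE c c'(2)] c'(3) by blast
  qed
  have "set_integrable lborel (\<Union>U\<in>F. coord c ` (dom c \<inter> (U \<inter> E))) (\<lambda>w. \<eta> c (param c w))"
    by (rule set_integrable_UN) (use F U Ub in auto)
  moreover have "coord c ` (K \<inter> E) \<in> sets lborel"
  proof -
    have "borel_in (K \<inter> E)"
      by (intro borel_in_Int borel_in_closed compactin_closedin K density_on_borel[OF d])
    moreover have "dom c \<inter> (K \<inter> E) = K \<inter> E" using K by blast
    ultimately show ?thesis using borel_inD[of "K \<inter> E" c] c by simp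
  qed
  moreover have "coord c ` (K \<inter> E) \<subseteq> (\<Union>U\<in>F. coord c ` (dom c \<inter> (U \<inter> E)))" using F(3) K(2) by blast
  ultimately show ?thesis by (rule set_integrable_subset)
qed

lemma smooth_function_continuous:
  assumes "smooth_function f" "c \<in> A"
  shows "continuous_on (img c) (\<lambda>w. f (param c w))"
  using assms smooth_on_continuous unfolding smooth_function_iff by blast

text \<open>The integrand may vanish off the compact set either because the cutoff does or because the form does.
Both cases occur: the first for the terms of the partition of unity, the second for a form supported in
a chart.\<close>

lemma integrable_cutoff:
  fixes f :: "'a \<Rightarrow> real"
  assumes \<eta>: "integrable_form E \<eta>" and c: "c \<in> A" and K: "compactin X K" "K \<subseteq> dom c"
    and f: "smooth_function f" "\<And>x. x \<in> topspace X \<Longrightarrow> \<bar>f x\<bar> \<le> 1"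
    and zero: "\<And>x. x \<in> dom c \<inter> E - K \<Longrightarrow> f x = 0 \<or> \<eta> c x = 0"
  shows "set_integrable lborel (coord c ` (dom c \<inter> E)) (\<lambda>w. of_real (f (param c w)) * \<eta> c (param c w))"
  unfolding set_integrable_def
proof (rule Bochner_Integration.integrable_bound)
  show "integrable lborel (\<lambda>w. indicator (coord c ` (K \<inter> E)) w *\<^sub>R \<eta> c (param c w))"
    using integrable_on_compact[OF \<eta> c K] by (simp add: set_integrable_def)
  have d: "density_on E \<eta>" using \<eta> by (auto simp: integrable_form_def)
  show "(\<lambda>w. indicator (coord c ` (dom c \<inter> E)) w *\<^sub>R (of_real (f (param c w)) * \<eta> c (param c w))) \<in> borel_measurable lborel"
    using density_on_measurable[OF density_on_scale[OF d smooth_function_continuous[OF f(1)]] c] by simp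
  have "norm (indicator (coord c ` (dom c \<inter> E)) w *\<^sub>R (of_real (f (param c w)) * \<eta> c (param c w)))
      \<le> norm (indicator (coord c ` (K \<inter> E)) w *\<^sub>R \<eta> c (param c w))" for w
  proof (cases "w \<in> coord c ` (dom c \<inter> E)")
    case True
    then obtain x where x: "x \<in> dom c" "x \<in> E" "w = coord c x" by blast
    then have p: "param c w = x" using c by simp
    show ?thesis
    proof (cases "x \<in> K")
      case True
      then have "w \<in> coord c ` (K \<inter> E)" using x by blast
      moreover have "norm (of_real (f x) * \<eta> c x) \<le> norm (\<eta> c x)"
        using f(2)[of x] x dom_subset[OF c] by (simp add: norm_mult mult_left_le_one_le subset_iff)
      ultimately show ?thesis using \<open>w \<in> coord c ` (dom c \<inter> E)\<close> p by simp
    next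
      case False
      then show ?thesis using zero[of x] x p by auto
    qed
  qed simp
  then show "AE w in lborel. norm (indicator (coord c ` (dom c \<inter> E)) w *\<^sub>R (of_real (f (param c w)) * \<eta> c (param c w)))
      \<le> norm (indicator (coord c ` (K \<inter> E)) w *\<^sub>R \<eta> c (param c w))" by simp
qed

section \<open>The integral over the surface\<close>

abbreviation PU :: "('a chart \<times> ('a \<Rightarrow> real)) set" where "PU \<equiv> some_partition X A"

lemma PU_finite: "finite PU"
  and PU_sum: "x \<in> topspace X \<Longrightarrow> (\<Sum>q\<in>PU. snd q x) = 1"
  and PU_chart: "q \<in> PU \<Longrightarrow> fst q \<in> A"
  and PU_nonneg: "q \<in> PU \<Longrightarrow> x \<in> topspace X \<Longrightarrow> 0 \<le> snd q x"
  and PU_smooth: "q \<in> PU \<Longrightarrow> smooth_function (snd q)"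
  and PU_closure: "q \<in> PU \<Longrightarrow> X closure_of {x \<in> topspace X. snd q x \<noteq> 0} \<subseteq> dom (fst q)"
  using some_partition unfolding partition_of_unity_def smooth_function_iff by (auto simp: split_beta)

lemma PU_support:
  assumes q: "q \<in> PU"
  obtains K where "compactin X K" "K \<subseteq> dom (fst q)" "\<And>x. x \<in> topspace X - K \<Longrightarrow> snd q x = 0"
proof (rule that[of "X closure_of {x \<in> topspace X. snd q x \<noteq> 0}"])
  show "snd q x = 0" if x: "x \<in> topspace X - X closure_of {x \<in> topspace X. snd q x \<noteq> 0}" for x
    using x closure_of_subset[of "{x \<in> topspace X. snd q x \<noteq> 0}" X] by blast
qed (use PU_closure[OF q] closedin_compactin in auto)

lemma PU_abs_le_1:
  assumes "q \<in> PU" "x \<in> topspace X"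
  shows "\<bar>snd q x\<bar> \<le> 1"
  using member_le_sum[of q PU "\<lambda>q. snd q x"] PU_finite PU_sum[OF assms(2)] PU_nonneg assms by simp

lemma PU_integrable:
  assumes "integrable_form E \<eta>" "q \<in> PU"
  shows "set_integrable lborel (coord (fst q) ` (dom (fst q) \<inter> E)) (\<lambda>w. of_real (snd q (param (fst q) w)) * \<eta> (fst q) (param (fst q) w))"
proof -
  obtain K where K: "compactin X K" "K \<subseteq> dom (fst q)" "\<And>x. x \<in> topspace X - K \<Longrightarrow> snd q x = 0"
    using PU_support[OF assms(2)] by blast
  note c = PU_chart[OF assms(2)]
  show ?thesis
    by (rule integrable_cutoff[OF assms(1) c K(1,2) PU_smooth[OF assms(2)] PU_abs_le_1[OF assms(2)]])
       (use K(3) dom_subset[OF c] in auto)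
qed

lemma surface_integral_alt:
  "surface_integral X A S \<omega> = (\<Sum>q\<in>PU. - 2 * \<i> * (LINT w:coord (fst q) ` (dom (fst q) \<inter> S)|lborel.
     of_real (snd q (param (fst q) w)) * \<omega> (fst q) (param (fst q) w)))"
  unfolding surface_integral_def by (simp add: split_beta)

lemma surface_integral_cong:
  assumes "\<And>c x. c \<in> A \<Longrightarrow> x \<in> dom c \<inter> S \<Longrightarrow> \<omega> c x = \<omega>' c x"
  shows "surface_integral X A S \<omega> = surface_integral X A S \<omega>'"
proof -
  have "(LINT w:coord (fst q) ` (dom (fst q) \<inter> S)|lborel. of_real (snd q (param (fst q) w)) * \<omega> (fst q) (param (fst q) w))
    = (LINT w:coord (fst q) ` (dom (fst q) \<inter> S)|lborel. of_real (snd q (param (fst q) w)) * \<omega>' (fst q) (param (fst q) w))"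
    if q: "q \<in> PU" for q
    unfolding set_lebesgue_integral_def
  proof (rule Bochner_Integration.integral_cong[OF refl])
    fix w
    have "\<omega> (fst q) (param (fst q) w) = \<omega>' (fst q) (param (fst q) w)" if w: "w \<in> coord (fst q) ` (dom (fst q) \<inter> S)"
    proof -
      obtain x where x: "x \<in> dom (fst q) \<inter> S" "w = coord (fst q) x" using w by blast
      then have "param (fst q) w = x" using PU_chart[OF q] by simp
      then show ?thesis using assms[OF PU_chart[OF q] x(1)] by simp
    qed
    then show "indicator (coord (fst q) ` (dom (fst q) \<inter> S)) w *\<^sub>R (of_real (snd q (param (fst q) w)) * \<omega> (fst q) (param (fst q) w)) =
      indicator (coord (fst q) ` (dom (fst q) \<inter> S)) w *\<^sub>R (of_real (snd q (param (fst q) w)) * \<omega>' (fst q) (param (fst q) w))"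
      by (auto simp: indicator_def)
  qed
  then show ?thesis unfolding surface_integral_alt by (simp cong: sum.cong)
qed

lemma surface_integral_add:
  assumes "integrable_form E \<eta>" "integrable_form E \<theta>"
  shows "surface_integral X A E (\<lambda>c x. \<eta> c x + \<theta> c x) = surface_integral X A E \<eta> + surface_integral X A E \<theta>"
  unfolding surface_integral_alt sum.distrib[symmetric]
proof (rule sum.cong[OF refl])
  fix q assume q: "q \<in> PU"
  show "- 2 * \<i> * (LINT w:coord (fst q) ` (dom (fst q) \<inter> E)|lborel.
       of_real (snd q (param (fst q) w)) * (\<eta> (fst q) (param (fst q) w) + \<theta> (fst q) (param (fst q) w))) =
     - 2 * \<i> * (LINT w:coord (fst q) ` (dom (fst q) \<inter> E)|lborel. of_real (snd q (param (fst q) w)) * \<eta> (fst q) (param (fst q) w)) +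
     - 2 * \<i> * (LINT w:coord (fst q) ` (dom (fst q) \<inter> E)|lborel. of_real (snd q (param (fst q) w)) * \<theta> (fst q) (param (fst q) w))"
    unfolding distrib_left set_integral_add(2)[OF PU_integrable[OF assms(1) q] PU_integrable[OF assms(2) q]] ..
qed

lemma integrable_form_zero:
  assumes "borel_in E"
  shows "integrable_form E (\<lambda>c x. 0)"
  unfolding integrable_form_def
proof
  show "density_on E (\<lambda>c x. 0)" using assms by (auto simp: density_on_def)
  show "locally_integrable E (\<lambda>c x. 0)"
    unfolding locally_integrable_def
  proof
    fix x assume "x \<in> topspace X"
    then obtain c where "c \<in> A" "x \<in> dom c" using cover by blast
    then show "\<exists>U c. openin X U \<and> x \<in> U \<and> c \<in> A \<and> U \<subseteq> dom c \<and> set_integrable lborel (coord c ` (U \<inter> E)) (\<lambda>w. 0::complex)"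
      by (intro exI[of _ "dom c"] exI[of _ c]) (auto simp: chart_openin set_integrable_def)
  qed
qed

lemma integrable_form_add:
  assumes "integrable_form E \<eta>" "integrable_form E \<theta>"
  shows "integrable_form E (\<lambda>c x. \<eta> c x + \<theta> c x)"
  unfolding integrable_form_def
proof
  show "density_on E (\<lambda>c x. \<eta> c x + \<theta> c x)"
    using assms density_on_add by (auto simp: integrable_form_def)
  show "locally_integrable E (\<lambda>c x. \<eta> c x + \<theta> c x)"
    unfolding locally_integrable_def
  proof
    fix x assume "x \<in> topspace X"
    then obtain c where c: "c \<in> A" "x \<in> dom c" using cover by blast
    from bump_exists[OF c openin_topspace] \<open>x \<in> topspace X\<close>
    obtain \<phi> :: "'a \<Rightarrow> real" and K N where K: "compactin X K" "K \<subseteq> topspace X \<inter> dom c" "openin X N" "x \<in> N"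
      "\<And>y. y \<notin> K \<Longrightarrow> \<phi> y = 0" "\<And>y. y \<in> N \<Longrightarrow> \<phi> y = 1" by metis
    have NK: "N \<subseteq> K" using K(5,6) by force
    have d: "density_on E \<eta>" using assms(1) by (auto simp: integrable_form_def)
    have "borel_in (N \<inter> E)" by (intro borel_in_Int borel_in_open K density_on_borel[OF d])
    moreover have "dom c \<inter> (N \<inter> E) = N \<inter> E" using NK K by blast
    ultimately have b: "coord c ` (N \<inter> E) \<in> sets lborel" using borel_inD[of "N \<inter> E" c] c by simp
    have KE: "coord c ` (N \<inter> E) \<subseteq> coord c ` (K \<inter> E)" using NK by blast
    have Kd: "K \<subseteq> dom c" using K by blast
    have "set_integrable lborel (coord c ` (N \<inter> E)) (\<lambda>w. \<eta> c (param c w) + \<theta> c (param c w))"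
      by (intro set_integral_add(1) set_integrable_subset[OF integrable_on_compact[OF _ c(1) K(1) Kd] b KE] assms)
    then show "\<exists>U c. openin X U \<and> x \<in> U \<and> c \<in> A \<and> U \<subseteq> dom c \<and>
       set_integrable lborel (coord c ` (U \<inter> E)) (\<lambda>w. \<eta> c (param c w) + \<theta> c (param c w))"
      using K NK c by blast
  qed
qed

lemma surface_integral_zero: "surface_integral X A E (\<lambda>c x. 0) = 0"
  by (simp add: surface_integral_alt set_lebesgue_integral_def)

lemma surface_integral_sum:
  assumes "finite I" "borel_in E" "\<And>i. i \<in> I \<Longrightarrow> integrable_form E (\<eta> i)"
  shows "integrable_form E (\<lambda>c x. \<Sum>i\<in>I. \<eta> i c x) \<and>
    surface_integral X A E (\<lambda>c x. \<Sum>i\<in>I. \<eta> i c x) = (\<Sum>i\<in>I. surface_integral X A E (\<eta> i))"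
  using assms(1,3)
proof (induction I)
  case empty
  then show ?case using integrable_form_zero[OF assms(2)] surface_integral_zero by simp
next
  case (insert i I)
  then have "integrable_form E (\<eta> i)" "integrable_form E (\<lambda>c x. \<Sum>i\<in>I. \<eta> i c x)" by auto
  from integrable_form_add[OF this] surface_integral_add[OF this] insert show ?case by simp
qed

text \<open>The integral of a form with compact support in one chart can be computed there: each term of the partition
of unity is moved to that chart, and the terms add up to the form. In particular the value is independent
of the chosen partition.\<close>

theorem surface_integral_in_chart:
  assumes \<eta>: "integrable_form E \<eta>" and c0: "c0 \<in> A" and K: "compactin X K" "K \<subseteq> dom c0"
    and zero: "\<And>c x. c \<in> A \<Longrightarrow> x \<in> dom c \<inter> E - K \<Longrightarrow> \<eta> c x = 0"
  shows "surface_integral X A E \<eta> = - 2 * \<i> * (LINT w:coord c0 ` (dom c0 \<inter> E)|lborel. \<eta> c0 (param c0 w))"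
proof -
  have d: "density_on E \<eta>" using \<eta> by (simp add: integrable_form_def)
  have bE: "borel_in E" by (rule density_on_borel[OF d])
  have inj0: "inj_on (coord c0) (dom c0)" by (rule coord_inj[OF c0])
  have i0: "set_integrable lborel (coord c0 ` (dom c0 \<inter> E)) (\<lambda>w. of_real (snd q (param c0 w)) * \<eta> c0 (param c0 w))"
    if q: "q \<in> PU" for q
    by (rule integrable_cutoff[OF \<eta> c0 K PU_smooth[OF q] PU_abs_le_1[OF q]]) (use zero c0 in auto)
  have tm: "(LINT w:coord (fst q) ` (dom (fst q) \<inter> E)|lborel. of_real (snd q (param (fst q) w)) * \<eta> (fst q) (param (fst q) w))
    = (LINT w:coord c0 ` (dom c0 \<inter> E)|lborel. of_real (snd q (param c0 w)) * \<eta> c0 (param c0 w))" if q: "q \<in> PU" for q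
  proof -
    let ?c = "fst q" and ?\<rho> = "snd q"
    note c = PU_chart[OF q]
    let ?E = "dom ?c \<inter> dom c0 \<inter> E"
    have bE': "borel_in ?E" by (intro borel_in_Int borel_in_open chart_openin c c0 bE)
    have dE: "density_on ?E (\<lambda>c x. of_real (?\<rho> x) * \<eta> c x)"
      by (rule density_on_subset[OF density_on_scale[OF d smooth_function_continuous[OF PU_smooth[OF q]]] bE']) simp_all
    obtain L where L: "compactin X L" "L \<subseteq> dom ?c" "\<And>x. x \<in> topspace X - L \<Longrightarrow> ?\<rho> x = 0"
      using PU_support[OF q] by blast
    have "(LINT w:coord ?c ` (dom ?c \<inter> E)|lborel. of_real (?\<rho> (param ?c w)) * \<eta> ?c (param ?c w)) =
       (LINT w:coord ?c ` ?E|lborel. of_real (?\<rho> (param ?c w)) * \<eta> ?c (param ?c w))"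
      unfolding set_lebesgue_integral_def
    proof (rule Bochner_Integration.integral_cong[OF refl])
      fix w
      show "indicator (coord ?c ` (dom ?c \<inter> E)) w *\<^sub>R (of_real (?\<rho> (param ?c w)) * \<eta> ?c (param ?c w)) =
        indicator (coord ?c ` ?E) w *\<^sub>R (of_real (?\<rho> (param ?c w)) * \<eta> ?c (param ?c w))"
      proof (cases "w \<in> coord ?c ` (dom ?c \<inter> E) - coord ?c ` ?E")
        case True
        then obtain x where x: "x \<in> dom ?c" "x \<in> E" "w = coord ?c x" "x \<notin> dom c0" by blast
        then have "x \<notin> K" using K(2) by blast
        then have "\<eta> ?c x = 0" using zero[OF c, of x] x by blast
        then show ?thesis using x c by simp
      next
        case False
        moreover have "coord ?c ` ?E \<subseteq> coord ?c ` (dom ?c \<inter> E)" by blast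
        ultimately show ?thesis by (auto simp: indicator_def)
      qed
    qed
    also have "\<dots> = (LINT w:coord c0 ` ?E|lborel. of_real (?\<rho> (param c0 w)) * \<eta> c0 (param c0 w))"
      by (rule density_chart_change(2)[OF dE c c0]) auto
    also have "\<dots> = (LINT w:coord c0 ` (dom c0 \<inter> E)|lborel. of_real (?\<rho> (param c0 w)) * \<eta> c0 (param c0 w))"
      unfolding set_lebesgue_integral_def
    proof (rule Bochner_Integration.integral_cong[OF refl])
      fix w
      show "indicator (coord c0 ` ?E) w *\<^sub>R (of_real (?\<rho> (param c0 w)) * \<eta> c0 (param c0 w)) =
        indicator (coord c0 ` (dom c0 \<inter> E)) w *\<^sub>R (of_real (?\<rho> (param c0 w)) * \<eta> c0 (param c0 w))"
      proof (cases "w \<in> coord c0 ` (dom c0 \<inter> E) - coord c0 ` ?E")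
        case True
        then obtain x where x: "x \<in> dom c0" "x \<in> E" "w = coord c0 x" "x \<notin> dom ?c" by blast
        then have "?\<rho> x = 0" using L(3)[of x] L(2) dom_subset[OF c0] by blast
        then show ?thesis using x c0 by simp
      next
        case False
        moreover have "coord c0 ` ?E \<subseteq> coord c0 ` (dom c0 \<inter> E)" by blast
        ultimately show ?thesis by (auto simp: indicator_def)
      qed
    qed
    finally show ?thesis .
  qed
  have "surface_integral X A E \<eta> = - 2 * \<i> * (\<Sum>q\<in>PU. (LINT w:coord c0 ` (dom c0 \<inter> E)|lborel. of_real (snd q (param c0 w)) * \<eta> c0 (param c0 w)))"
    unfolding surface_integral_alt sum_distrib_left by (rule sum.cong[OF refl]) (simp add: tm)
  also have "(\<Sum>q\<in>PU. (LINT w:coord c0 ` (dom c0 \<inter> E)|lborel. of_real (snd q (param c0 w)) * \<eta> c0 (param c0 w))) =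
     (LINT w|lborel. (\<Sum>q\<in>PU. indicator (coord c0 ` (dom c0 \<inter> E)) w *\<^sub>R (of_real (snd q (param c0 w)) * \<eta> c0 (param c0 w))))"
    unfolding set_lebesgue_integral_def
    by (rule Bochner_Integration.integral_sum[symmetric]) (use i0 in \<open>simp add: set_integrable_def\<close>)
  also have "\<dots> = (LINT w:coord c0 ` (dom c0 \<inter> E)|lborel. \<eta> c0 (param c0 w))"
    unfolding set_lebesgue_integral_def
  proof (rule Bochner_Integration.integral_cong[OF refl])
    fix w
    show "(\<Sum>q\<in>PU. indicator (coord c0 ` (dom c0 \<inter> E)) w *\<^sub>R (of_real (snd q (param c0 w)) * \<eta> c0 (param c0 w))) =
       indicator (coord c0 ` (dom c0 \<inter> E)) w *\<^sub>R \<eta> c0 (param c0 w)"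
    proof (cases "w \<in> coord c0 ` (dom c0 \<inter> E)")
      case True
      then obtain x where x: "x \<in> dom c0" "w = coord c0 x" by blast
      then have "(\<Sum>q\<in>PU. snd q (param c0 w)) = 1" using PU_sum[of x] dom_subset[OF c0] c0 by auto
      then have "(\<Sum>q\<in>PU. of_real (snd q (param c0 w)) * \<eta> c0 (param c0 w)) = \<eta> c0 (param c0 w)"
        unfolding sum_distrib_right[symmetric] of_real_sum[symmetric] by simp
      then show ?thesis using True by simp
    qed simp
  qed
  finally show ?thesis .
qed

section \<open>Forms in charts\<close>

text \<open>Off a closed set, the conditions on the coefficients of a form are pointwise: the transformation law with
the derivative of the change of coordinates, and smoothness at each point.\<close>

lemma smooth_form_off_iff:
  assumes D: "closedin X D"
  shows "smooth_form_off A p q D \<eta> \<longleftrightarrow>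
    (\<forall>c\<in>A. \<forall>c'\<in>A. \<forall>x\<in>dom c \<inter> dom c' - D. \<eta> c x = \<eta> c' x * transition_deriv c c' x ^ p * cnj (transition_deriv c c' x) ^ q) \<and>
    (\<forall>c\<in>A. \<forall>x\<in>dom c - D. smooth_at c (\<eta> c) x)" (is "?L \<longleftrightarrow> ?R1 \<and> ?R2")
proof -
  have s: "smooth_on (coord c ` (dom c - D)) (\<lambda>w. \<eta> c (param c w)) \<longleftrightarrow> (\<forall>x\<in>dom c - D. smooth_at c (\<eta> c) x)"
    if c: "c \<in> A" for c
  proof -
    have e: "dom c - D = dom c \<inter> (topspace X - D)" using dom_subset[OF c] by blast
    obtain T where T: "open T" "coord c ` (dom c - D) = img c \<inter> T"
      using openin_image_obtain[OF c openin_Compl[OF D]] unfolding e by blast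
    have "smooth_germ (coord c ` (dom c - D)) (\<lambda>w. \<eta> c (param c w)) w \<longleftrightarrow> smooth_germ (img c) (\<lambda>w. \<eta> c (param c w)) w"
      if w: "w \<in> coord c ` (dom c - D)" for w
    proof
      assume "smooth_germ (coord c ` (dom c - D)) (\<lambda>w. \<eta> c (param c w)) w"
      then show "smooth_germ (img c) (\<lambda>w. \<eta> c (param c w)) w"
        by (rule smooth_germ_cong[OF _ T(1)]) (use T(2) w in blast)+
    next
      assume "smooth_germ (img c) (\<lambda>w. \<eta> c (param c w)) w"
      then show "smooth_germ (coord c ` (dom c - D)) (\<lambda>w. \<eta> c (param c w)) w"
        by (rule smooth_germ_mono) blast
    qed
    then show ?thesis unfolding smooth_on_germ smooth_at_def by auto
  qed
  have l: "(\<forall>d. ((\<lambda>w. coord c' (param c w)) has_field_derivative d)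
            (at (coord c x) within coord c ` (dom c \<inter> dom c')) \<longrightarrow>
        \<eta> c x = \<eta> c' x * d ^ p * cnj d ^ q) \<longleftrightarrow> \<eta> c x = \<eta> c' x * transition_deriv c c' x ^ p * cnj (transition_deriv c c' x) ^ q"
    if c: "c \<in> A" "c' \<in> A" and x: "x \<in> dom c \<inter> dom c' - D" for c c' x
  proof -
    have xd: "x \<in> dom c" "x \<in> dom c'" using x by blast+
    show ?thesis
      using transition_deriv_has_derivative[OF c xd] transition_deriv_eqI[OF c xd] by blast
  qed
  show ?thesis unfolding smooth_form_off_def
  proof (rule arg_cong2[where f = "(\<and>)"])
    show "(\<forall>c\<in>A. \<forall>c'\<in>A. \<forall>x\<in>dom c \<inter> dom c' - D. \<forall>d. ((\<lambda>w. coord c' (param c w)) has_field_derivative d)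
            (at (coord c x) within coord c ` (dom c \<inter> dom c')) \<longrightarrow> \<eta> c x = \<eta> c' x * d ^ p * cnj d ^ q) = ?R1"
      by (intro ball_cong refl l)
    show "(\<forall>c\<in>A. smooth_on (coord c ` (dom c - D)) (\<lambda>w. \<eta> c (param c w))) = ?R2"
      by (intro ball_cong refl s)
  qed
qed

lemma form_law:
  assumes "closedin X D" "smooth_form_off A p q D \<eta>" "c \<in> A" "c' \<in> A" "x \<in> dom c" "x \<in> dom c'" "x \<notin> D"
  shows "\<eta> c x = \<eta> c' x * transition_deriv c c' x ^ p * cnj (transition_deriv c c' x) ^ q"
  using assms(2)[unfolded smooth_form_off_iff[OF assms(1)]] assms(3-) by blast

lemma form_germ:
  assumes "closedin X D" "smooth_form_off A p q D \<eta>" "c \<in> A" "x \<in> dom c" "x \<notin> D"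
  shows "smooth_at c (\<eta> c) x"
  using assms(2)[unfolded smooth_form_off_iff[OF assms(1)]] assms(3-) by blast

lemma formI:
  assumes "closedin X D" "\<And>c c' x. c \<in> A \<Longrightarrow> c' \<in> A \<Longrightarrow> x \<in> dom c \<Longrightarrow> x \<in> dom c' \<Longrightarrow> x \<notin> D \<Longrightarrow>
    \<eta> c x = \<eta> c' x * transition_deriv c c' x ^ p * cnj (transition_deriv c c' x) ^ q"
    "\<And>c x. c \<in> A \<Longrightarrow> x \<in> dom c \<Longrightarrow> x \<notin> D \<Longrightarrow> smooth_at c (\<eta> c) x"
  shows "smooth_form_off A p q D \<eta>"
  unfolding smooth_form_off_iff[OF assms(1)] using assms(2,3) by blast

definition scale_form :: "('a \<Rightarrow> real) \<Rightarrow> 'a form \<Rightarrow> 'a form" where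
  "scale_form f \<beta> = (\<lambda>c x. of_real (f x) * \<beta> c x)"

lemma smooth_at_fmul:
  assumes "smooth_function f" "c \<in> A" "x \<in> dom c" "smooth_at c (\<beta> c) x"
  shows "smooth_at c (scale_form f \<beta> c) x"
  using assms unfolding smooth_at_def scale_form_def smooth_function_def
  by (intro smooth_germ_mult smooth_germ_of_real) auto

lemma form_scale_form:
  assumes "closedin X D" "smooth_function f" "smooth_form_off A p q D \<beta>"
  shows "smooth_form_off A p q D (scale_form f \<beta>)"
proof (rule formI[OF assms(1)])
  fix c c' x assume *: "c \<in> A" "c' \<in> A" "x \<in> dom c" "x \<in> dom c'" "x \<notin> D"
  show "scale_form f \<beta> c x = scale_form f \<beta> c' x * transition_deriv c c' x ^ p * cnj (transition_deriv c c' x) ^ q"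
    unfolding scale_form_def form_law[OF assms(1,3) *] by (simp add: mult.assoc)
next
  fix c x assume *: "c \<in> A" "x \<in> dom c" "x \<notin> D"
  show "smooth_at c (scale_form f \<beta> c) x"
    by (rule smooth_at_fmul[where \<beta> = \<beta>, OF assms(2) *(1,2) form_germ[OF assms(1,3) *]])
qed

text \<open>The values of a form at its poles are irrelevant. If it vanishes near them, including at them, it is smooth
everywhere.\<close>

lemma form_extend_zero:
  assumes D: "closedin X D" and \<beta>: "smooth_form_off A p q D \<beta>"
    and zero: "\<And>p. p \<in> D \<Longrightarrow> \<exists>N. openin X N \<and> p \<in> N \<and> (\<forall>c\<in>A. \<forall>x\<in>N \<inter> dom c. \<beta> c x = 0)"
  shows "smooth_form_off A p q {} \<beta>"
proof (rule formI)
  fix c c' x assume *: "c \<in> A" "c' \<in> A" "x \<in> dom c" "x \<in> dom c'"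
  show "\<beta> c x = \<beta> c' x * transition_deriv c c' x ^ p * cnj (transition_deriv c c' x) ^ q"
  proof (cases "x \<in> D")
    case True
    then obtain N where N: "x \<in> N" "\<forall>c\<in>A. \<forall>x\<in>N \<inter> dom c. \<beta> c x = 0" using zero by blast
    then have "\<beta> c x = 0" "\<beta> c' x = 0" using * by blast+
    then show ?thesis by simp
  qed (rule form_law[OF D \<beta> *])
next
  fix c x assume *: "c \<in> A" "x \<in> dom c"
  show "smooth_at c (\<beta> c) x"
  proof (cases "x \<in> D")
    case True
    then obtain N where N: "openin X N" "x \<in> N" "\<forall>c\<in>A. \<forall>x\<in>N \<inter> dom c. \<beta> c x = 0" using zero by blast
    have "smooth_at c (\<lambda>_. 0 :: complex) x" by (simp add: smooth_at_def smooth_germ_const)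
    then show ?thesis
      by (rule smooth_at_cong[OF _ *(1) N(1,2) *(2)]) (use N(3) *(1) in force)
  qed (rule form_germ[OF D \<beta> *])
qed simp

section \<open>The holomorphic differential\<close>

lemma hol_d_has_dz:
  assumes "c \<in> A" "x \<in> dom c" "smooth_at c (\<beta> c) x"
  shows "has_dz (\<lambda>w. \<beta> c (param c w)) (hol_d \<beta> c x) (coord c x) (img c)"
  unfolding hol_d_def
  by (rule smooth_germ_has_dz[OF img_chart_open[OF assms(1)] _ assms(3)[unfolded smooth_at_def]]) (use assms in blast)

lemma hol_d_eqI:
  assumes "c \<in> A" "x \<in> dom c" "has_dz (\<lambda>w. \<beta> c (param c w)) d (coord c x) (img c)"
  shows "hol_d \<beta> c x = d"
  unfolding hol_d_def
  by (rule has_dz_imp_dz_deriv[OF img_chart_open[OF assms(1)] _ assms(3)]) (use assms in blast)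

lemma has_dz_near:
  assumes c: "c \<in> A" "x \<in> dom c" and N: "openin X N" "x \<in> N"
    and eq: "\<And>y. y \<in> N \<inter> dom c \<Longrightarrow> f y = g y"
    and f: "has_dz (\<lambda>w. f (param c w)) d (coord c x) (img c)"
  shows "has_dz (\<lambda>w. g (param c w)) d (coord c x) (img c)"
proof -
  obtain T where T: "open T" "coord c ` (dom c \<inter> N) = img c \<inter> T"
    using openin_image_obtain[OF c(1) N(1)] .
  show ?thesis
  proof (rule has_dz_transform[OF f T(1)])
    show "f (param c w) = g (param c w)" if w: "w \<in> T \<inter> img c" for w
    proof -
      have "w \<in> coord c ` (dom c \<inter> N)" using w T(2) by blast
      then obtain y where "y \<in> dom c" "y \<in> N" "w = coord c y" by blast
      then show ?thesis using eq[of y] c(1) by simp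
    qed
  qed (use c N T in blast)+
qed

lemma hol_d_near_zero:
  assumes "c \<in> A" "x \<in> dom c" "openin X N" "x \<in> N" "\<And>y. y \<in> N \<inter> dom c \<Longrightarrow> \<beta> c y = 0"
  shows "hol_d \<beta> c x = 0"
  by (rule hol_d_eqI[OF assms(1,2)], rule has_dz_near[where f = "\<lambda>_. 0", OF assms(1-4)])
     (use assms(5) has_dz_const in auto)

lemma hol_d_sum:
  assumes "c \<in> A" "x \<in> dom c" "\<And>i. i \<in> I \<Longrightarrow> smooth_at c (\<beta> i c) x"
  shows "hol_d (\<lambda>c x. \<Sum>i\<in>I. \<beta> i c x) c x = (\<Sum>i\<in>I. hol_d (\<beta> i) c x)"
  by (rule hol_d_eqI[OF assms(1,2)], rule has_dz_sum) (use hol_d_has_dz[OF assms(1,2)] assms(3) in blast)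

lemma hol_d_add:
  assumes "c \<in> A" "x \<in> dom c" "smooth_at c (\<beta> c) x" "smooth_at c (\<gamma> c) x"
  shows "hol_d (\<lambda>c x. \<beta> c x + \<gamma> c x) c x = hol_d \<beta> c x + hol_d \<gamma> c x"
  by (rule hol_d_eqI[OF assms(1,2)], rule has_dz_add) (use hol_d_has_dz[OF assms(1,2)] assms(3,4) in blast)+

lemma hol_d_cong:
  assumes "c \<in> A" "x \<in> dom c" "openin X N" "x \<in> N" "\<And>y. y \<in> N \<inter> dom c \<Longrightarrow> \<beta> c y = \<gamma> c y" "smooth_at c (\<beta> c) x"
  shows "hol_d \<gamma> c x = hol_d \<beta> c x"
  by (rule hol_d_eqI[OF assms(1,2)], rule has_dz_near[OF assms(1-5)])
     (use hol_d_has_dz[where \<beta> = \<beta>, OF assms(1,2,6)] in auto)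

text \<open>$\partial_z\bigl(g(\tau(z))\,\overline{\tau'(z)}\bigr) = (\partial g)(\tau(z))\,\tau'(z)\,\overline{\tau'(z)}$, because the
second factor is antiholomorphic.\<close>

theorem hol_d_form:
  assumes D: "closedin X D" and \<beta>: "smooth_form_off A 0 1 D \<beta>"
  shows "smooth_form_off A 1 1 D (hol_d \<beta>)"
proof (rule formI[OF D])
  fix c c' x assume c: "c \<in> A" "c' \<in> A" and x: "x \<in> dom c" "x \<in> dom c'" "x \<notin> D"
  obtain V g where V: "open V" "coord c x \<in> V" "g holomorphic_on V"
    and g: "\<And>w. w \<in> V \<inter> img c \<Longrightarrow> param c w \<in> dom c'" "\<And>w. w \<in> V \<inter> img c \<Longrightarrow> g w = coord c' (param c w)"
    and dg: "\<And>w. w \<in> V \<inter> img c \<Longrightarrow> deriv g w = transition_deriv c c' (param c w)"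
    using transition_extends_deriv[OF c x(1,2)] by metis
  obtain T where T: "open T" "coord c ` (dom c \<inter> (topspace X - D)) = img c \<inter> T"
    using openin_image_obtain[OF c(1) openin_Compl[OF D]] .
  let ?z = "coord c x" and ?W = "img c \<inter> (V \<inter> T)" and ?t = "transition_deriv c c' x"
  have zW: "?z \<in> ?W" using V T x dom_subset[OF c(1)] by blast
  have gz: "g ?z = coord c' x" "deriv g ?z = ?t" using g(2)[of ?z] dg[of ?z] zW c x by auto
  have "smooth_at c' (\<beta> c') x" by (rule form_germ[OF D \<beta> c(2) x(2,3)])
  from hol_d_has_dz[where \<beta> = \<beta>, OF c(2) x(2) this]
  have "has_dz (\<lambda>w. \<beta> c' (param c' w)) (hol_d \<beta> c' x) (g ?z) (g ` ?W)"
    unfolding gz by (rule has_dz_subset) (use g in auto)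
  moreover have "(g has_field_derivative ?t) (at ?z within ?W)"
    using holomorphic_derivI[OF V(3,1,2)] gz(2) by (simp add: has_field_derivative_at_within)
  ultimately have 1: "has_dz (\<lambda>w. \<beta> c' (param c' (g w))) (hol_d \<beta> c' x * ?t) ?z ?W"
    by (rule has_dz_compose)
  have "(deriv g has_field_derivative deriv (deriv g) ?z) (at ?z within ?W)"
    using holomorphic_derivI[OF holomorphic_deriv[OF V(3,1)] V(1,2)] by (simp add: has_field_derivative_at_within)
  from has_dz_mult[OF 1 has_dz_cnj_field_derivative[OF this]]
  have "has_dz (\<lambda>w. \<beta> c' (param c' (g w)) * cnj (deriv g w)) (hol_d \<beta> c' x * ?t * cnj ?t) ?z ?W"
    by (simp add: gz)
  then have "has_dz (\<lambda>w. \<beta> c (param c w)) (hol_d \<beta> c' x * ?t * cnj ?t) ?z ?W"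
  proof (rule has_dz_transform[OF _ open_UNIV _ zW])
    fix w assume "w \<in> UNIV \<inter> ?W"
    then have w: "w \<in> V \<inter> img c" "w \<in> coord c ` (dom c \<inter> (topspace X - D))" using T by blast+
    then obtain y where y: "y \<in> dom c" "y \<notin> D" "w = coord c y" by blast
    then have p: "param c w = y" using c by simp
    have "y \<in> dom c'" using g(1)[OF w(1)] p by simp
    then show "\<beta> c' (param c' (g w)) * cnj (deriv g w) = \<beta> c (param c w)"
      using g(2)[OF w(1)] dg[OF w(1)] p c form_law[OF D \<beta> c y(1) _ y(2)] by simp
  qed simp
  then have "has_dz (\<lambda>w. \<beta> c (param c w)) (hol_d \<beta> c' x * ?t * cnj ?t) ?z (img c)"
    by (rule has_dz_localize) (use V T zW in auto)
  then show "hol_d \<beta> c x = hol_d \<beta> c' x * transition_deriv c c' x ^ 1 * cnj (transition_deriv c c' x) ^ 1"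
    using hol_d_eqI[OF c(1) x(1)] by simp
next
  fix c x assume c: "c \<in> A" "x \<in> dom c" "x \<notin> D"
  have "smooth_germ (img c) (dz_deriv (img c) (\<lambda>w. \<beta> c (param c w))) (coord c x)"
    by (rule smooth_germ_dz_deriv[OF img_chart_open[OF c(1)] _ form_germ[OF D \<beta> c, unfolded smooth_at_def]]) (use c in blast)
  then show "smooth_at c (hol_d \<beta> c) x"
    unfolding smooth_at_def hol_d_def by (rule smooth_germ_cong[OF _ open_UNIV]) auto
qed

section \<open>Integrability of forms\<close>

lemma form_density:
  assumes D: "closedin X D" and \<eta>: "smooth_form_off A 1 1 D \<eta>"
  shows "density_on (topspace X - D) \<eta>"
  unfolding density_on_def
proof (intro conjI ballI)
  show "borel_in (topspace X - D)" by (intro borel_in_open openin_Compl D)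
next
  fix c c' x assume c: "c \<in> A" "c' \<in> A" "x \<in> dom c \<inter> dom c' \<inter> (topspace X - D)"
  then have "\<eta> c x = \<eta> c' x * transition_deriv c c' x ^ 1 * cnj (transition_deriv c c' x) ^ 1"
    by (intro form_law[OF D \<eta>]) auto
  also have "\<dots> = (transition_deriv c c' x * cnj (transition_deriv c c' x)) * \<eta> c' x" by simp
  also have "transition_deriv c c' x * cnj (transition_deriv c c' x) = of_real ((cmod (transition_deriv c c' x))\<^sup>2)"
    by (rule complex_norm_square[symmetric])
  finally show "\<eta> c x = of_real ((cmod (transition_deriv c c' x))\<^sup>2) * \<eta> c' x" .
next
  fix c assume c: "c \<in> A"
  have e: "dom c - D = dom c \<inter> (topspace X - D)" using dom_subset[OF c] by blast
  have "smooth_on (coord c ` (dom c - D)) (\<lambda>w. \<eta> c (param c w))"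
    using \<eta> c by (auto simp: smooth_form_off_def)
  from smooth_on_continuous[OF this]
  have "continuous_on (coord c ` (dom c \<inter> (topspace X - D))) (\<lambda>w. \<eta> c (param c w))" by (simp only: e)
  then show "(\<lambda>w. indicator (coord c ` (dom c \<inter> (topspace X - D))) w *\<^sub>R \<eta> c (param c w)) \<in> borel_measurable borel"
    by (intro borel_measurable_continuous_on_indicator chart_open_borel chart_open_image c openin_Compl D)
qed

lemma compact_neighbourhood:
  assumes c: "c \<in> A" "x \<in> dom c" and U: "openin X U" "x \<in> U"
  obtains K N where "compactin X K" "K \<subseteq> U \<inter> dom c" "openin X N" "x \<in> N" "N \<subseteq> K"
proof -
  obtain \<phi> :: "'a \<Rightarrow> real" and K N where *: "compactin X K" "K \<subseteq> U \<inter> dom c" "openin X N" "x \<in> N"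
      "\<And>y. y \<notin> K \<Longrightarrow> \<phi> y = 0" "\<And>y. y \<in> N \<Longrightarrow> \<phi> y = 1"
    using bump_exists[OF c U] by metis
  have "N \<subseteq> K" using *(5,6) by force
  then show ?thesis using that * by blast
qed

lemma form_integrable:
  assumes D: "closedin X D" and \<eta>: "smooth_form_off A 1 1 D \<eta>" and E: "borel_in E" "E \<subseteq> topspace X - D"
    and loc: "\<And>p. p \<in> D \<Longrightarrow> \<exists>U c. openin X U \<and> p \<in> U \<and> c \<in> A \<and> U \<subseteq> dom c \<and>
       set_integrable lborel (coord c ` (U \<inter> E)) (\<lambda>w. \<eta> c (param c w))"
  shows "integrable_form E \<eta>"
  unfolding integrable_form_def
proof
  show "density_on E \<eta>" by (rule density_on_subset[OF form_density[OF D \<eta>] E])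
  show "locally_integrable E \<eta>"
    unfolding locally_integrable_def
  proof
    fix x assume x: "x \<in> topspace X"
    show "\<exists>U c. openin X U \<and> x \<in> U \<and> c \<in> A \<and> U \<subseteq> dom c \<and> set_integrable lborel (coord c ` (U \<inter> E)) (\<lambda>w. \<eta> c (param c w))"
    proof (cases "x \<in> D")
      case True
      then show ?thesis using loc by blast
    next
      case False
      obtain c where c: "c \<in> A" "x \<in> dom c" using x cover by blast
      obtain K N where K: "compactin X K" "K \<subseteq> (topspace X - D) \<inter> dom c" "openin X N" "x \<in> N" "N \<subseteq> K"
        using compact_neighbourhood[OF c openin_Compl[OF D]] x False by blast
      have "compact (coord c ` K)" using compact_image[OF c(1), of K] K by blast
      moreover have "continuous_on (coord c ` K) (\<lambda>w. \<eta> c (param c w))"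
      proof (rule continuous_on_subset[OF smooth_on_continuous])
        show "smooth_on (coord c ` (dom c - D)) (\<lambda>w. \<eta> c (param c w))"
          using \<eta> c by (auto simp: smooth_form_off_def)
      qed (use K in blast)
      ultimately have "set_integrable lborel (coord c ` K) (\<lambda>w. \<eta> c (param c w))"
        unfolding set_integrable_def by (rule borel_integrable_compact)
      moreover have "coord c ` (N \<inter> E) \<in> sets lborel"
      proof -
        have "dom c \<inter> (N \<inter> E) = N \<inter> E" using K by blast
        then show ?thesis
          using borel_inD[OF borel_in_Int[OF borel_in_open[OF K(3)] E(1)] c(1)] by simp
      qed
      moreover have "coord c ` (N \<inter> E) \<subseteq> coord c ` K" using K by blast
      ultimately have "set_integrable lborel (coord c ` (N \<inter> E)) (\<lambda>w. \<eta> c (param c w))"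
        by (rule set_integrable_subset)
      then show ?thesis using K c by blast
    qed
  qed
qed

text \<open>In the chart in which the simple pole is visible the coefficient is bounded by a multiple of $1/|z|$.\<close>

lemma log_form_integrable:
  assumes D: "closedin X D" and \<eta>: "\<eta> \<in> forms_log X A D"
  shows "integrable_form (topspace X - D) \<eta>"
proof (rule form_integrable[OF D])
  show s: "smooth_form_off A 1 1 D \<eta>" using \<eta> by (auto simp: forms_log_def forms_pole_def)
  show b: "borel_in (topspace X - D)" by (intro borel_in_open openin_Compl D)
  fix p assume p: "p \<in> D"
  then have "pole_le X A D \<eta> p 1" using \<eta> by (auto simp: forms_log_def)
  then obtain c V a where c: "coordinate_at A p c" "openin X V" "p \<in> V" "V \<subseteq> dom c" "smooth_on (coord c ` V) a"
     "\<forall>x\<in>V - D. \<eta> c x = a (coord c x) / coord c x ^ 1" unfolding pole_le_def by blast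
  have cA: "c \<in> A" "p \<in> dom c" using c(1) by (auto simp: coordinate_at_def)
  obtain K N where K: "compactin X K" "K \<subseteq> V \<inter> dom c" "openin X N" "p \<in> N" "N \<subseteq> K"
    using compact_neighbourhood[OF cA c(2,3)] by blast
  have cK: "compact (coord c ` K)" using compact_image[OF cA(1), of K] K by blast
  obtain r where r: "r > 0" "coord c ` K \<subseteq> cball 0 r"
  proof -
    obtain r0 where "\<forall>w\<in>coord c ` K. norm w \<le> r0"
      using compact_imp_bounded[OF cK] unfolding bounded_iff by blast
    then show ?thesis by (intro that[of "max r0 1"]) (auto simp: le_max_iff_disj)
  qed
  have "continuous_on (coord c ` K) a"
    by (rule continuous_on_subset[OF smooth_on_continuous[OF c(5)]]) (use K in blast)
  then have "compact (a ` coord c ` K)" using cK compact_continuous_image by blast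
  then obtain M where M: "\<And>z. z \<in> coord c ` K \<Longrightarrow> norm (a z) \<le> M"
  proof -
    obtain M where "\<forall>w\<in>a ` coord c ` K. norm w \<le> M"
      using compact_imp_bounded[OF \<open>compact (a ` coord c ` K)\<close>] unfolding bounded_iff by blast
    then show ?thesis by (intro that[of M]) blast
  qed
  let ?S = "coord c ` (N \<inter> (topspace X - D))"
  have e: "dom c \<inter> (N \<inter> (topspace X - D)) = N \<inter> (topspace X - D)" using K by blast
  have bN: "borel_in (N \<inter> (topspace X - D))" by (intro borel_in_Int borel_in_open K b[unfolded borel_in_def, folded borel_in_def])
  have "set_integrable lborel ?S (\<lambda>w. \<eta> c (param c w))"
    unfolding set_integrable_def
  proof (rule Bochner_Integration.integrable_bound)
    show "integrable lborel (\<lambda>w. M * (indicator (cball 0 r) w *\<^sub>R (1 / norm (w::complex))))"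
      using inverse_norm_integrable[OF r(1)] unfolding set_integrable_def by (rule integrable_mult_right)
    show "(\<lambda>w. indicator ?S w *\<^sub>R \<eta> c (param c w)) \<in> borel_measurable lborel"
      using density_on_measurable[OF density_on_subset[OF form_density[OF D s] bN] cA(1)] e by auto
    have "norm (indicator ?S w *\<^sub>R \<eta> c (param c w)) \<le> norm (M * (indicator (cball 0 r) w *\<^sub>R (1 / norm w)))" for w
    proof (cases "w \<in> ?S")
      case True
      then obtain x where x: "x \<in> N" "x \<notin> D" "w = coord c x" by blast
      then have xK: "x \<in> K" "x \<in> V" "x \<in> dom c" using K by blast+
      then have "\<eta> c x = a w / w" using c(6) x by simp
      moreover have "param c w = x" using x xK cA by simp
      moreover have "norm (a w) \<le> M" using M[of w] x xK by blast
      moreover have "w \<in> cball 0 r" using r(2) x xK by blast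
      moreover have "M \<ge> 0" using \<open>norm (a w) \<le> M\<close> norm_ge_zero order_trans by blast
      ultimately show ?thesis using True by (simp add: norm_divide divide_right_mono)
    qed simp
    then show "AE w in lborel. norm (indicator ?S w *\<^sub>R \<eta> c (param c w)) \<le> norm (M * (indicator (cball 0 r) w *\<^sub>R (1 / norm w)))"
      by simp
  qed
  moreover have "N \<subseteq> dom c" using K by blast
  ultimately show "\<exists>U c. openin X U \<and> p \<in> U \<and> c \<in> A \<and> U \<subseteq> dom c \<and>
       set_integrable lborel (coord c ` (U \<inter> (topspace X - D))) (\<lambda>w. \<eta> c (param c w))"
    using K cA by blast
qed simp

section \<open>Removing coordinate discs\<close>

text \<open>The domain of integration in the theorem: the surface with the coordinate discs about the poles removed.\<close>

definition holed :: "'a set \<Rightarrow> ('a \<Rightarrow> 'a chart) \<Rightarrow> real \<Rightarrow> 'a set" where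
  "holed D z \<epsilon> = topspace X - (\<Union>p\<in>D. coordinate_ball (z p) \<epsilon>)"

lemma holed_facts:
  assumes D: "finite D" "D \<subseteq> topspace X" and z: "\<forall>p\<in>D. coordinate_at A p (z p)" and \<epsilon>: "\<epsilon> > 0"
  shows "borel_in (holed D z \<epsilon>)" "holed D z \<epsilon> \<subseteq> topspace X - D"
    "\<And>p. p \<in> D \<Longrightarrow> \<exists>U c. openin X U \<and> p \<in> U \<and> c \<in> A \<and> U \<subseteq> dom c \<and> U \<inter> holed D z \<epsilon> = {}"
proof -
  have zA: "z p \<in> A" "p \<in> dom (z p)" "coord (z p) p = 0" if "p \<in> D" for p
    using z that by (auto simp: coordinate_at_def)
  show "borel_in (holed D z \<epsilon>)" unfolding holed_def
    by (intro borel_in_Diff borel_in_topspace borel_in_UN D borel_in_ball zA)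
  show "holed D z \<epsilon> \<subseteq> topspace X - D"
    using zA \<epsilon> by (force simp: holed_def coordinate_ball_def)
  fix p assume p: "p \<in> D"
  show "\<exists>U c. openin X U \<and> p \<in> U \<and> c \<in> A \<and> U \<subseteq> dom c \<and> U \<inter> holed D z \<epsilon> = {}"
  proof (intro exI conjI)
    show "openin X {x \<in> dom (z p). coord (z p) x \<in> ball 0 \<epsilon>}" by (rule openin_preimage) (use zA p in auto)
    show "{x \<in> dom (z p). coord (z p) x \<in> ball 0 \<epsilon>} \<inter> holed D z \<epsilon> = {}"
      using p by (force simp: holed_def coordinate_ball_def)
  qed (use zA[OF p] \<epsilon> in auto)
qed

text \<open>The holes contain neighbourhoods of the poles, so the order of the poles does not matter.\<close>

lemma holed_integrable:
  assumes D: "finite D" "D \<subseteq> topspace X" and z: "\<forall>p\<in>D. coordinate_at A p (z p)" and \<epsilon>: "\<epsilon> > 0"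
    and \<eta>: "smooth_form_off A 1 1 D \<eta>"
  shows "integrable_form (holed D z \<epsilon>) \<eta>"
proof (rule form_integrable[OF finite_closedin[OF D] \<eta> holed_facts(1,2)[OF D z \<epsilon>]])
  fix p assume "p \<in> D"
  then obtain U c where "openin X U" "p \<in> U" "c \<in> A" "U \<subseteq> dom c" "U \<inter> holed D z \<epsilon> = {}"
    using holed_facts(3)[OF D z \<epsilon>] by blast
  then show "\<exists>U c. openin X U \<and> p \<in> U \<and> c \<in> A \<and> U \<subseteq> dom c \<and>
       set_integrable lborel (coord c ` (U \<inter> holed D z \<epsilon>)) (\<lambda>w. \<eta> c (param c w))"
    by (intro exI[of _ U] exI[of _ c]) (simp add: set_integrable_def)
qed

lemma eventually_in_holed:
  assumes D: "finite D" "D \<subseteq> topspace X" and z: "\<forall>p\<in>D. coordinate_at A p (z p)" and x: "x \<in> topspace X - D"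
  shows "eventually (\<lambda>\<epsilon>. x \<in> holed D z \<epsilon>) (at_right 0)"
proof -
  have "eventually (\<lambda>\<epsilon>. x \<notin> coordinate_ball (z p) \<epsilon>) (at_right 0)" if p: "p \<in> D" for p
  proof (cases "x \<in> dom (z p)")
    case True
    have zA: "z p \<in> A" "p \<in> dom (z p)" "coord (z p) p = 0" using z p by (auto simp: coordinate_at_def)
    have "x \<noteq> p" using x p by blast
    then have "coord (z p) x \<noteq> 0" using coord_inj[OF zA(1)] True zA(2,3) by (metis inj_onD)
    then have "eventually (\<lambda>\<epsilon>. \<epsilon> \<in> {0<..<norm (coord (z p) x)}) (at_right 0)"
      by (intro eventually_at_right_real) auto
    then show ?thesis by eventually_elim (auto simp: coordinate_ball_def)
  qed (simp add: coordinate_ball_def)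
  then have "eventually (\<lambda>\<epsilon>. \<forall>p\<in>D. x \<notin> coordinate_ball (z p) \<epsilon>) (at_right 0)"
    using D(1) by (simp add: eventually_ball_finite)
  then show ?thesis by eventually_elim (use x in \<open>auto simp: holed_def\<close>)
qed

text \<open>Dominated convergence: each point that is not a pole lies in the domain of integration once the radius is
small, and the poles form a null set.\<close>

theorem holed_limit:
  assumes D: "finite D" "D \<subseteq> topspace X" and z: "\<forall>p\<in>D. coordinate_at A p (z p)"
    and \<eta>: "integrable_form (topspace X - D) \<eta>"
  shows "((\<lambda>\<epsilon>. surface_integral X A (holed D z \<epsilon>) \<eta>) \<longlongrightarrow> surface_integral X A (topspace X) \<eta>) (at_right 0)"
  unfolding surface_integral_alt
proof (intro tendsto_sum tendsto_mult tendsto_const)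
  fix q assume q: "q \<in> PU"
  let ?c = "fst q" and ?E = "topspace X - D"
  note c = PU_chart[OF q]
  let ?h = "\<lambda>w. of_real (snd q (param ?c w)) * \<eta> ?c (param ?c w)"
  let ?f = "\<lambda>w. indicator (coord ?c ` (dom ?c \<inter> ?E)) w *\<^sub>R ?h w"
  have int: "integrable lborel ?f" using PU_integrable[OF \<eta> q] by (simp add: set_integrable_def)
  have lim: "((\<lambda>\<epsilon>. (LINT w:coord ?c ` (dom ?c \<inter> holed D z \<epsilon>)|lborel. ?h w)) \<longlongrightarrow> (LINT w|lborel. ?f w)) (at_right 0)"
  proof (rule tendsto_at_right_sequentially[OF zero_less_one])
    fix S :: "nat \<Rightarrow> real" assume S: "\<And>n. 0 < S n" "S \<longlonglongrightarrow> 0"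
    have fS: "filterlim S (at_right 0) sequentially"
      using S by (intro tendsto_imp_filterlim_at_right) auto
    have hf: "indicator (coord ?c ` (dom ?c \<inter> holed D z (S n))) w *\<^sub>R ?h w =
       indicator (coord ?c ` (dom ?c \<inter> holed D z (S n))) w *\<^sub>R ?f w" for n w
    proof -
      have "coord ?c ` (dom ?c \<inter> holed D z (S n)) \<subseteq> coord ?c ` (dom ?c \<inter> ?E)"
        using holed_facts(2)[OF D z S(1)[of n]] by blast
      then show ?thesis by (auto simp: indicator_def)
    qed
    show "(\<lambda>n. (LINT w:coord ?c ` (dom ?c \<inter> holed D z (S n))|lborel. ?h w)) \<longlonglongrightarrow> (LINT w|lborel. ?f w)"
      unfolding set_lebesgue_integral_def
    proof (rule integral_dominated_convergence[where w = "\<lambda>w. norm (?f w)"])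
      show "?f \<in> borel_measurable lborel" using int by auto
      show "(\<lambda>w. indicator (coord ?c ` (dom ?c \<inter> holed D z (S n))) w *\<^sub>R ?h w) \<in> borel_measurable lborel" for n
      proof -
        have [measurable]: "coord ?c ` (dom ?c \<inter> holed D z (S n)) \<in> sets lborel"
          using borel_inD[OF holed_facts(1)[OF D z S(1)] c] by simp
        have [measurable]: "?f \<in> borel_measurable lborel" using int by auto
        show ?thesis unfolding hf by measurable
      qed
      show "integrable lborel (\<lambda>w. norm (?f w))" using int by (rule integrable_norm)
      show "AE w in lborel. norm (indicator (coord ?c ` (dom ?c \<inter> holed D z (S n))) w *\<^sub>R ?h w) \<le> norm (?f w)" for n
        unfolding hf by (auto simp: indicator_def)
      have "(\<lambda>n. indicator (coord ?c ` (dom ?c \<inter> holed D z (S n))) w *\<^sub>R ?h w) \<longlonglongrightarrow> ?f w" for w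
      proof (cases "w \<in> coord ?c ` (dom ?c \<inter> ?E)")
        case True
        then obtain x where x: "x \<in> dom ?c" "x \<in> ?E" "w = coord ?c x" by blast
        have "eventually (\<lambda>n. x \<in> holed D z (S n)) sequentially"
          by (rule eventually_compose_filterlim[OF eventually_in_holed[OF D z x(2)] fS])
        then have "eventually (\<lambda>n. indicator (coord ?c ` (dom ?c \<inter> holed D z (S n))) w *\<^sub>R ?h w = ?f w) sequentially"
          by eventually_elim (use x True in \<open>auto simp: indicator_def\<close>)
        then show ?thesis by (rule tendsto_eventually)
      next
        case False
        then show ?thesis unfolding hf by simp
      qed
      then show "AE w in lborel. (\<lambda>n. indicator (coord ?c ` (dom ?c \<inter> holed D z (S n))) w *\<^sub>R ?h w) \<longlonglongrightarrow> ?f w" by simp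
    qed
  qed
  have "(LINT w|lborel. ?f w) = (LINT w:coord ?c ` (dom ?c \<inter> topspace X)|lborel. ?h w)"
    unfolding set_lebesgue_integral_def
  \<comment> \<open>The coefficients at the poles are arbitrary, but the poles form a null set.\<close>
  proof (rule integral_discrete_difference[where X = "coord ?c ` D"])
    show "countable (coord ?c ` D)" using D by (simp add: countable_finite)
    fix w assume "w \<notin> coord ?c ` D"
    then have "w \<in> coord ?c ` (dom ?c \<inter> ?E) \<longleftrightarrow> w \<in> coord ?c ` (dom ?c \<inter> topspace X)" by blast
    then show "?f w = indicator (coord ?c ` (dom ?c \<inter> topspace X)) w *\<^sub>R ?h w" by (simp add: indicator_def)
  qed auto
  with lim show "((\<lambda>\<epsilon>. (LINT w:coord ?c ` (dom ?c \<inter> holed D z \<epsilon>)|lborel. ?h w)) \<longlongrightarrow>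
      (LINT w:coord ?c ` (dom ?c \<inter> topspace X)|lborel. ?h w)) (at_right 0)" by simp
qed

section \<open>Stokes' theorem for smooth forms\<close>

lemma PU_sum_form:
  assumes "c \<in> A" "y \<in> dom c"
  shows "(\<Sum>q\<in>PU. scale_form (snd q) \<beta> c y) = \<beta> c y"
proof -
  have "y \<in> topspace X" using assms dom_subset by blast
  then show ?thesis
    using PU_sum[of y] unfolding scale_form_def sum_distrib_right[symmetric] of_real_sum[symmetric] by simp
qed

text \<open>$\beta$ is the sum of the forms $\rho\beta$ over the partition of unity. The integral of each
$\partial(\rho\beta)$ can be computed in the chart that contains the support of $\rho$, where Stokes is known; the
result is the corresponding term of the boundary integral.\<close>

theorem stokes_smooth:
  assumes \<beta>: "smooth_form_off A 0 1 {} \<beta>"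
  shows "surface_integral X A (topspace X) (hol_d \<beta>) = boundary_integral X A \<beta>"
proof -
  have D: "closedin X {}" by simp
  let ?b = "\<lambda>q. scale_form (snd q) \<beta>"
  have bf: "smooth_form_off A 0 1 {} (?b q)" if "q \<in> PU" for q
    by (rule form_scale_form[OF D PU_smooth[OF that] \<beta>])
  have int: "integrable_form (topspace X) (hol_d (?b q))" if "q \<in> PU" for q
    by (rule form_integrable[OF D hol_d_form[OF D bf[OF that]] borel_in_topspace]) auto
  have "surface_integral X A (topspace X) (hol_d \<beta>) = surface_integral X A (topspace X) (\<lambda>c x. \<Sum>q\<in>PU. hol_d (?b q) c x)"
  proof (rule surface_integral_cong)
    fix c x assume c: "c \<in> A" and "x \<in> dom c \<inter> topspace X"
    then have x: "x \<in> dom c" by blast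
    have g: "smooth_at c (?b q c) x" if "q \<in> PU" for q by (rule form_germ[OF D bf[OF that] c x]) simp
    have "hol_d \<beta> c x = hol_d (\<lambda>c x. \<Sum>q\<in>PU. ?b q c x) c x"
    proof (rule hol_d_cong[OF c x chart_openin[OF c] x])
      show "(\<Sum>q\<in>PU. ?b q c y) = \<beta> c y" if "y \<in> dom c \<inter> dom c" for y
        by (rule PU_sum_form) (use c that in auto)
      show "smooth_at c (\<lambda>x. \<Sum>q\<in>PU. ?b q c x) x"
        unfolding smooth_at_def by (rule smooth_germ_sum) (use g in \<open>simp add: smooth_at_def\<close>)
    qed
    also have "\<dots> = (\<Sum>q\<in>PU. hol_d (?b q) c x)" by (rule hol_d_sum[where \<beta> = ?b, OF c x g])
    finally show "hol_d \<beta> c x = (\<Sum>q\<in>PU. hol_d (?b q) c x)" .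
  qed
  also have "\<dots> = (\<Sum>q\<in>PU. surface_integral X A (topspace X) (hol_d (?b q)))"
    by (rule surface_integral_sum[THEN conjunct2, OF PU_finite borel_in_topspace int])
  also have "\<dots> = (\<Sum>q\<in>PU. (LINT t:{t. complex_of_real t \<in> coord (fst q) ` (dom (fst q) \<inter> surface_boundary A)}|lborel.
            of_real (snd q (param (fst q) (of_real t))) * \<beta> (fst q) (param (fst q) (of_real t))))"
  proof (rule sum.cong[OF refl])
    fix q assume q: "q \<in> PU"
    let ?c = "fst q"
    note c = PU_chart[OF q]
    obtain K where K: "compactin X K" "K \<subseteq> dom ?c" "\<And>x. x \<in> topspace X - K \<Longrightarrow> snd q x = 0"
      using PU_support[OF q] by blast
    let ?g = "\<lambda>w. ?b q ?c (param ?c w)"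
    have e: "dom ?c \<inter> topspace X = dom ?c" using dom_subset[OF c] by blast
    have b0: "?b q c' y = 0" if "y \<in> topspace X - K" for c' y using K(3)[OF that] by (simp add: scale_form_def)
    have "surface_integral X A (topspace X) (hol_d (?b q)) =
       - 2 * \<i> * (LINT w:coord ?c ` (dom ?c \<inter> topspace X)|lborel. hol_d (?b q) ?c (param ?c w))"
    proof (rule surface_integral_in_chart[OF int[OF q] c K(1,2)])
      fix c' x assume c': "c' \<in> A" and x: "x \<in> dom c' \<inter> topspace X - K"
      show "hol_d (?b q) c' x = 0"
        by (rule hol_d_near_zero[OF c' _ openin_Compl[OF compactin_closedin[OF K(1)]]]) (use x b0 in auto)
    qed
    also have "(LINT w:coord ?c ` (dom ?c \<inter> topspace X)|lborel. hol_d (?b q) ?c (param ?c w)) =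
       (LINT w:img ?c|lborel. dz_deriv (img ?c) ?g w)"
      unfolding e set_lebesgue_integral_def hol_d_def
      by (rule Bochner_Integration.integral_cong) (auto simp: indicator_def)
    also have "- 2 * \<i> * \<dots> = (LINT t:{t. complex_of_real t \<in> img ?c \<and> complex_of_real t \<notin> interior (img ?c)}|lborel. ?g (of_real t))"
    proof (rule stokes_chart[OF img_chart_open[OF c]])
      show "smooth_on (img ?c) ?g"
        unfolding smooth_on_germ using form_germ[OF D bf[OF q] c] by (auto simp: smooth_at_def)
      show "compact (coord ?c ` K)" using compact_image[OF c K(2)] K(1) by blast
      show "?g w = 0" if "w \<in> img ?c - coord ?c ` K" for w
      proof -
        obtain x where x: "x \<in> dom ?c" "w = coord ?c x" "x \<notin> K" using \<open>w \<in> img ?c - coord ?c ` K\<close> by blast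
        then have "?b q ?c x = 0" using b0[of x ?c] dom_subset[OF c] by blast
        then show ?thesis using x c by simp
      qed
    qed (use K in blast)
    also have "{t. complex_of_real t \<in> img ?c \<and> complex_of_real t \<notin> interior (img ?c)} =
       {t. complex_of_real t \<in> coord ?c ` (dom ?c \<inter> surface_boundary A)}"
    proof (rule Collect_cong)
      fix t
      have "w \<in> coord ?c ` (dom ?c \<inter> surface_boundary A) \<longleftrightarrow> w \<in> img ?c \<and> w \<notin> interior (img ?c)" for w
      proof
        assume "w \<in> coord ?c ` (dom ?c \<inter> surface_boundary A)"
        then obtain x where "x \<in> dom ?c" "x \<in> surface_boundary A" "w = coord ?c x" by blast
        then show "w \<in> img ?c \<and> w \<notin> interior (img ?c)" using boundary_iff[OF c, of x] by blast
      next
        assume w: "w \<in> img ?c \<and> w \<notin> interior (img ?c)"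
        then obtain x where "x \<in> dom ?c" "w = coord ?c x" by blast
        then show "w \<in> coord ?c ` (dom ?c \<inter> surface_boundary A)" using boundary_iff[OF c, of x] w by blast
      qed
      then show "(complex_of_real t \<in> img ?c \<and> complex_of_real t \<notin> interior (img ?c)) =
        (complex_of_real t \<in> coord ?c ` (dom ?c \<inter> surface_boundary A))" by blast
    qed
    finally show "surface_integral X A (topspace X) (hol_d (?b q)) =
       (LINT t:{t. complex_of_real t \<in> coord ?c ` (dom ?c \<inter> surface_boundary A)}|lborel.
            of_real (snd q (param ?c (of_real t))) * \<beta> ?c (param ?c (of_real t)))"
      by (simp add: scale_form_def)
  qed
  also have "\<dots> = boundary_integral X A \<beta>"
    unfolding boundary_integral_def by (simp add: split_beta)
  finally show ?thesis .
qed

section \<open>Stokes' theorem for forms with poles\<close>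

text \<open>The order of a pole does not depend on the coordinate: if $z'$ and $z$ are coordinates centred at the
same point then $z' = z\,u(z)$ with $u$ holomorphic and nonvanishing, by the removable singularity theorem.
As the pole is an interior point, the numerator is defined on a full disc.\<close>

lemma pole_in_coordinate:
  assumes D: "closedin X D" and \<beta>: "smooth_form_off A p q D \<beta>" and pole: "pole_le X A D \<beta> x0 N"
    and c: "coordinate_at A x0 c" and x0: "x0 \<in> D" "x0 \<notin> surface_boundary A"
  obtains r h where "r > 0" "ball 0 r \<subseteq> img c" "\<And>k. Ck k (ball 0 r) h"
    "\<And>x. x \<in> dom c - D \<Longrightarrow> coord c x \<in> ball 0 r \<Longrightarrow> \<beta> c x = h (coord c x) / coord c x ^ N"
proof -
  obtain c' V a where c': "coordinate_at A x0 c'" "openin X V" "x0 \<in> V" "V \<subseteq> dom c'" "smooth_on (coord c' ` V) a"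
     "\<forall>x\<in>V - D. \<beta> c' x = a (coord c' x) / coord c' x ^ N" using pole unfolding pole_le_def by blast
  have cA: "c \<in> A" "x0 \<in> dom c" "coord c x0 = 0" using c by (auto simp: coordinate_at_def)
  have cA': "c' \<in> A" "x0 \<in> dom c'" "coord c' x0 = 0" using c'(1) by (auto simp: coordinate_at_def)
  obtain V1 g where V1: "open V1" "coord c x0 \<in> V1" "g holomorphic_on V1"
    and g: "\<And>w. w \<in> V1 \<inter> img c \<Longrightarrow> param c w \<in> dom c'" "\<And>w. w \<in> V1 \<inter> img c \<Longrightarrow> g w = coord c' (param c w)"
    and dg: "\<And>w. w \<in> V1 \<inter> img c \<Longrightarrow> deriv g w = transition_deriv c c' (param c w)"
    using transition_extends_deriv[OF cA(1) cA'(1) cA(2) cA'(2)] by metis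
  have im0: "0 \<in> V1 \<inter> img c" using V1(2) cA by (metis IntI imageI)
  have p0: "param c 0 = x0" using cA by (metis param_coord)
  have g0: "g 0 = 0" "deriv g 0 \<noteq> 0"
    using g(2)[OF im0] dg[OF im0] p0 cA' transition_deriv_inverse(2)[OF cA(1) cA'(1) cA(2) cA'(2)] by simp_all
  \<comment> \<open>The removable singularity of the quotient of the two coordinates.\<close>
  define u where "u = (\<lambda>w. if w = 0 then deriv g 0 else (g w - g 0) / (w - 0))"
  have uh: "u holomorphic_on V1" unfolding u_def by (rule pole_lemma_open[OF V1(3,1)])
  have gu: "g w = w * u w" for w unfolding u_def using g0 by simp
  obtain U a' where U: "open U" "0 \<in> U" "\<forall>k. Ck k U a'" "\<forall>w\<in>U \<inter> coord c' ` V. a' w = a w"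
  proof -
    have "0 \<in> coord c' ` V" using cA'(3) c'(3) by (metis imageI)
    from c'(5)[unfolded smooth_on_def, rule_format, OF this] that show ?thesis by auto
  qed
  obtain T where T: "open T" "coord c ` (dom c \<inter> V) = img c \<inter> T"
    using openin_image_obtain[OF cA(1) c'(2)] .
  have T0: "0 \<in> T"
  proof -
    have "coord c x0 \<in> coord c ` (dom c \<inter> V)" using cA(2) c'(3) by blast
    then show ?thesis using T(2) cA(3) by simp
  qed
  have int0: "0 \<in> interior (img c)" using boundary_iff[OF cA(1,2)] x0(2) cA(3) by simp
  have cg: "continuous_on V1 g" "continuous_on V1 u" using V1(3) uh holomorphic_on_imp_continuous_on by blast+
  let ?O = "(V1 \<inter> g -` U) \<inter> (V1 \<inter> u -` (- {0})) \<inter> interior (img c) \<inter> T"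
  have "open ?O"
    by (intro open_Int continuous_open_preimage cg V1(1) U(1) T(1) open_interior) auto
  moreover have "0 \<in> ?O" using im0 g0 U(2) int0 T0 by (auto simp: u_def)
  ultimately obtain r where r: "r > 0" "ball 0 r \<subseteq> ?O" using open_contains_ball by blast
  define h where "h = (\<lambda>w. a' (g w) * deriv g w ^ p * cnj (deriv g w) ^ q / u w ^ N)"
  have rV: "ball 0 r \<subseteq> V1" using r by blast
  show ?thesis
  proof (rule that[of r h])
    show "ball 0 r \<subseteq> img c" using r interior_subset by blast
    show "Ck k (ball 0 r) h" for k
    proof -
      have hol: "g holomorphic_on ball 0 r" "u holomorphic_on ball 0 r" "deriv g holomorphic_on ball 0 r"
        using holomorphic_on_subset[OF V1(3) rV] holomorphic_on_subset[OF uh rV]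
          holomorphic_on_subset[OF holomorphic_deriv[OF V1(3,1)] rV] by blast+
      have 1: "Ck k (ball 0 r) (\<lambda>w. a' (g w))"
        by (rule Ck_compose_holomorphic[OF open_ball hol(1), of U]) (use r U in auto)
      have 2: "Ck k (ball 0 r) u" "Ck k (ball 0 r) (deriv g)" using hol Ck_holomorphic open_ball by blast+
      show ?thesis unfolding h_def
        by (intro Ck_divide Ck_mult Ck_power Ck_cnj 1 2) (use r in auto)
    qed
    show "\<beta> c x = h (coord c x) / coord c x ^ N" if x: "x \<in> dom c - D" "coord c x \<in> ball 0 r" for x
    proof -
      let ?w = "coord c x"
      have w: "?w \<in> V1 \<inter> img c" "g ?w \<in> U" "?w \<in> T" using x r(2) by blast+
      have px: "param c ?w = x" using x cA by simp
      have "?w \<in> coord c ` (dom c \<inter> V)" using T(2) w x by blast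
      then obtain y where "y \<in> dom c \<inter> V" "?w = coord c y" by blast
      then have xV: "x \<in> V" using coord_inj[OF cA(1)] x by (metis DiffD1 IntD1 IntD2 inj_onD)
      have xd: "x \<in> dom c" "x \<in> dom c'" "x \<notin> D" using xV c'(4) x by blast+
      have gw: "g ?w = coord c' x" "deriv g ?w = transition_deriv c c' x" using g(2)[OF w(1)] dg[OF w(1)] px by simp_all
      have "\<beta> c x = \<beta> c' x * transition_deriv c c' x ^ p * cnj (transition_deriv c c' x) ^ q"
        by (rule form_law[OF D \<beta> cA(1) cA'(1) xd])
      also have "\<beta> c' x = a (coord c' x) / coord c' x ^ N" using c'(6) xV xd by blast
      also have "a (coord c' x) = a' (g ?w)" using U(4) w(2) xV gw by auto
      also have "coord c' x ^ N = (?w * u ?w) ^ N" using gu[of ?w] gw by simp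
      finally show ?thesis unfolding h_def gw(2) by (simp add: power_mult_distrib)
    qed
  qed (rule r(1))
qed

lemma coordinate_ball_shrinks:
  assumes c: "coordinate_at A p c" and U: "openin X U" "p \<in> U"
  shows "eventually (\<lambda>\<epsilon>. coordinate_ball c \<epsilon> \<subseteq> U) (at_right 0)"
proof -
  have cA: "c \<in> A" "p \<in> dom c" "coord c p = 0" using c by (auto simp: coordinate_at_def)
  obtain T where T: "open T" "coord c ` (dom c \<inter> U) = img c \<inter> T"
    using openin_image_obtain[OF cA(1) U(1)] .
  have "coord c p \<in> coord c ` (dom c \<inter> U)" using cA(2) U(2) by blast
  then have "0 \<in> T" using T(2) cA(3) by simp
  then obtain r where r: "r > 0" "ball 0 r \<subseteq> T" using T(1) open_contains_ball by blast
  have "eventually (\<lambda>\<epsilon>. \<epsilon> \<in> {0<..<r}) (at_right 0)" by (rule eventually_at_right_real[OF r(1)])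
  then show ?thesis
  proof eventually_elim
    case (elim \<epsilon>)
    show ?case
    proof
      fix x assume "x \<in> coordinate_ball c \<epsilon>"
      then have x: "x \<in> dom c" "norm (coord c x) \<le> \<epsilon>" by (auto simp: coordinate_ball_def)
      then have "coord c x \<in> coord c ` (dom c \<inter> U)" using T(2) r elim by auto
      then obtain y where "y \<in> dom c \<inter> U" "coord c x = coord c y" by blast
      then show "x \<in> U" using coord_inj[OF cA(1)] x(1) by (metis IntD1 IntD2 inj_onD)
    qed
  qed
qed

lemma isolating_bump:
  assumes D: "finite D" "D \<subseteq> topspace X" "p \<in> D" and c: "c \<in> A" "p \<in> dom c" "coord c p = 0" and r: "r > 0"
  obtains \<phi> K N where "smooth_function \<phi>" "compactin X K" "K \<subseteq> dom c" "K \<inter> (D - {p}) = {}" "coord c ` K \<subseteq> ball 0 r"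
    "\<And>x. x \<notin> K \<Longrightarrow> \<phi> x = 0" "openin X N" "p \<in> N" "N \<subseteq> K" "\<And>x. x \<in> N \<Longrightarrow> \<phi> x = 1"
proof -
  define U where "U = {x \<in> dom c. coord c x \<in> ball 0 r} \<inter> (topspace X - (D - {p}))"
  have "closedin X (D - {p})" using D by (intro finite_closedin) auto
  then have U: "openin X U" unfolding U_def by (intro openin_Int openin_preimage c openin_Compl) auto
  have pU: "p \<in> U" using c r D by (auto simp: U_def)
  obtain \<phi> :: "'a \<Rightarrow> real" and K N where \<phi>: "smooth_function \<phi>" "compactin X K" "K \<subseteq> U \<inter> dom c"
    "\<And>x. x \<notin> K \<Longrightarrow> \<phi> x = 0" "openin X N" "p \<in> N" "\<And>x. x \<in> N \<Longrightarrow> \<phi> x = 1"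
    using bump_exists[OF c(1,2) U pU] by metis
  show ?thesis
    by (rule that[OF \<phi>(1,2) _ _ _ \<phi>(4-6) _ \<phi>(7)]) (use \<phi>(3,4,7) in \<open>force simp: U_def\<close>)+
qed

lemma isolated_neighbourhood:
  assumes D: "finite D" "D \<subseteq> topspace X" "p \<in> D" and N: "openin X N" "p \<in> N"
    and K: "\<And>p'. p' \<in> D \<Longrightarrow> compactin X (K p')" "\<And>p'. p' \<in> D \<Longrightarrow> K p' \<inter> (D - {p'}) = {}"
  obtains V where "openin X V" "p \<in> V" "V \<subseteq> N" "\<And>p'. p' \<in> D - {p} \<Longrightarrow> V \<inter> K p' = {}"
proof (rule that[of "N \<inter> (topspace X - (\<Union>p'\<in>D - {p}. K p'))"])
  have "closedin X (\<Union>p'\<in>D - {p}. K p')"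
    using D(1) K(1) by (intro closedin_Union) (auto simp: compactin_closedin)
  then show "openin X (N \<inter> (topspace X - (\<Union>p'\<in>D - {p}. K p')))" by (intro openin_Int openin_Compl N)
  have "p \<notin> K p'" if "p' \<in> D - {p}" for p' using K(2)[of p'] that D(3) by blast
  then show "p \<in> N \<inter> (topspace X - (\<Union>p'\<in>D - {p}. K p'))" using D N(2) by blast
qed blast+

text \<open>A form cut off to a neighbourhood of one pole is $h\,d\bar z/z^n$ with $h$ smooth and compactly supported in
the plane, in the very coordinate that defines the hole. So \<open>punctured_plane_limit\<close> applies once the
other holes are too small to meet the support.\<close>

lemma pole_part_limit:
  assumes D: "finite D" "D \<subseteq> topspace X" "D \<inter> surface_boundary A = {}"
    and \<beta>: "\<beta> \<in> forms_pole X A 0 1 D" and z: "\<forall>p\<in>D. coordinate_at A p (z p)" and p: "p \<in> D"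
  obtains \<phi> N K where "smooth_function \<phi>" "compactin X K" "\<And>x. x \<notin> K \<Longrightarrow> \<phi> x = 0" "K \<inter> (D - {p}) = {}" "K \<inter> surface_boundary A = {}"
    "openin X N" "p \<in> N" "\<And>x. x \<in> N \<Longrightarrow> \<phi> x = 1"
    "((\<lambda>\<epsilon>. surface_integral X A (holed D z \<epsilon>) (hol_d (scale_form \<phi> \<beta>))) \<longlongrightarrow> 0) (at_right 0)"
proof -
  have cD: "closedin X D" by (rule finite_closedin[OF D(1,2)])
  have \<beta>': "smooth_form_off A 0 1 D \<beta>" using \<beta> by (simp add: forms_pole_def)
  obtain n where n: "pole_le X A D \<beta> p n" using \<beta> p by (auto simp: forms_pole_def)
  have cp: "coordinate_at A p (z p)" using z p by blast
  define c where "c = z p"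
  have c: "c \<in> A" "p \<in> dom c" "coord c p = 0" using cp by (auto simp: coordinate_at_def c_def)
  have pb: "p \<notin> surface_boundary A" using D(3) p by blast
  obtain r h where r: "r > 0" "ball 0 r \<subseteq> img c" and h: "\<And>k. Ck k (ball 0 r) h"
    "\<And>x. x \<in> dom c - D \<Longrightarrow> coord c x \<in> ball 0 r \<Longrightarrow> \<beta> c x = h (coord c x) / coord c x ^ n"
    using pole_in_coordinate[OF cD \<beta>' n cp p pb] unfolding c_def by metis
  obtain \<phi> :: "'a \<Rightarrow> real" and K N where \<phi>: "smooth_function \<phi>" "compactin X K" and Kd: "K \<subseteq> dom c"
    and KD: "K \<inter> (D - {p}) = {}" and KB: "coord c ` K \<subseteq> ball 0 r"
    and \<phi>0: "\<And>x. x \<notin> K \<Longrightarrow> \<phi> x = 0" and N: "openin X N" "p \<in> N" "\<And>x. x \<in> N \<Longrightarrow> \<phi> x = 1"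
    using isolating_bump[OF D(1,2) p c r(1)] by metis
  have cK: "compact (coord c ` K)" using compact_image[OF c(1) Kd] \<phi>(2) by blast
  have oK: "open (- (coord c ` K))" using cK by (simp add: compact_imp_closed open_Compl)
  have Kb: "K \<inter> surface_boundary A = {}"
  proof -
    have "x \<notin> surface_boundary A" if x: "x \<in> K" for x
    proof -
      have "coord c x \<in> ball 0 r" "x \<in> dom c" using x KB Kd by blast+
      then have "coord c x \<in> interior (img c)" using r(2) interior_maximal[OF r(2) open_ball] by blast
      then show ?thesis using boundary_iff[OF c(1) \<open>x \<in> dom c\<close>] by blast
    qed
    then show ?thesis by blast
  qed
  define H where "H = (\<lambda>w. if w \<in> ball 0 r then of_real (\<phi> (param c w)) * h w else 0)"
  have H0: "H w = 0" if w: "w \<notin> coord c ` K" for w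
  proof (cases "w \<in> ball 0 r")
    case True
    then obtain x where x: "x \<in> dom c" "w = coord c x" using r(2) by blast
    then have "x \<notin> K" using w by blast
    then show ?thesis using \<phi>0 x c by (simp add: H_def)
  qed (simp add: H_def)
  have CkH: "\<forall>k. Ck k UNIV H"
  proof
    fix k
    show "Ck k UNIV H"
    proof (rule Ck_local[OF open_UNIV])
      fix w :: complex
      show "\<exists>U. open U \<and> w \<in> U \<and> Ck k U H"
      proof (cases "w \<in> coord c ` K")
        case True
        have "smooth_on (img c) (\<lambda>w. \<phi> (param c w))" using \<phi>(1) c(1) by (simp add: smooth_function_iff)
        from smooth_on_imp_Ck[OF open_ball r(2) this]
        have "Ck k (ball 0 r) (\<lambda>w. of_real (\<phi> (param c w)) * h w)" by (intro Ck_mult Ck_of_real h(1))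
        then have "Ck k (ball 0 r) H" by (rule Ck_cong[OF open_ball, rotated]) (simp add: H_def)
        then show ?thesis using True KB by (intro exI[of _ "ball 0 r"]) auto
      next
        case False
        have "Ck k (- (coord c ` K)) H" by (rule Ck_cong[OF oK _ Ck_const[of k _ 0]]) (use H0 in auto)
        then show ?thesis using False oK by (intro exI[of _ "- (coord c ` K)"]) auto
      qed
    qed
  qed
  let ?\<gamma> = "hol_d (scale_form \<phi> \<beta>)"
  let ?D = "\<lambda>w. dz_part H w / w ^ n - of_nat n * H w / w ^ (n + 1)"
  have D0: "?D w = 0" if w: "w \<notin> coord c ` K" for w
  proof -
    have "has_dz H 0 w UNIV"
      by (rule has_dz_transform[OF has_dz_const[of 0] oK]) (use w H0 in auto)
    then show ?thesis using has_dz_UNIV_dz_part H0[OF w] by simp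
  qed
  have dH: "?\<gamma> c x = ?D (coord c x)" if x: "x \<in> dom c" "x \<notin> D" for x
  proof (rule hol_d_eqI[OF c(1) x(1)])
    have "coord c x \<noteq> 0" using x p c coord_inj[OF c(1)] by (metis inj_onD)
    moreover have "has_dz H (dz_part H (coord c x)) (coord c x) (img c)"
      by (rule Ck_has_dz[OF open_UNIV]) (use CkH in auto)
    ultimately have "has_dz (\<lambda>w. H w / w ^ n) (?D (coord c x)) (coord c x) (img c)"
      by (intro has_dz_divide_power)
    then have "has_dz (\<lambda>w. H (coord c (param c w)) / coord c (param c w) ^ n) (?D (coord c x)) (coord c x) (img c)"
      by (rule has_dz_transform[OF _ open_UNIV]) (use x in auto)
    then show "has_dz (\<lambda>w. scale_form \<phi> \<beta> c (param c w)) (?D (coord c x)) (coord c x) (img c)"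
    proof (rule has_dz_near[OF c(1) x(1) openin_Compl[OF cD], where f = "\<lambda>y. H (coord c y) / coord c y ^ n", rotated 2])
      show "x \<in> topspace X - D" using x dom_subset[OF c(1)] by blast
      show "H (coord c y) / coord c y ^ n = scale_form \<phi> \<beta> c y" if y: "y \<in> (topspace X - D) \<inter> dom c" for y
      proof (cases "coord c y \<in> ball 0 r")
        case True
        then have "H (coord c y) = of_real (\<phi> y) * h (coord c y)" using y c by (simp add: H_def)
        moreover have "\<beta> c y = h (coord c y) / coord c y ^ n" using h(2)[of y] y True by blast
        ultimately show ?thesis by (simp add: scale_form_def)
      next
        case False
        then have "y \<notin> K" using KB by blast
        then show ?thesis using False \<phi>0[of y] by (simp add: H_def scale_form_def)
      qed
    qed
  qed
  have form: "smooth_form_off A 1 1 D ?\<gamma>" by (rule hol_d_form[OF cD form_scale_form[OF cD \<phi>(1) \<beta>']])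
  have g0: "?\<gamma> c' x = 0" if "c' \<in> A" "x \<in> dom c'" "x \<notin> K" for c' x
  proof (rule hol_d_near_zero[OF that(1,2) openin_Compl[OF compactin_closedin[OF \<phi>(2)]]])
    show "x \<in> topspace X - K" using that dom_subset[OF that(1)] by blast
    show "scale_form \<phi> \<beta> c' y = 0" if "y \<in> (topspace X - K) \<inter> dom c'" for y
      using \<phi>0[of y] that by (simp add: scale_form_def)
  qed
  \<comment> \<open>The discs about the other poles eventually miss the support.\<close>
  have ev: "eventually (\<lambda>\<epsilon>. \<forall>p'\<in>D - {p}. coordinate_ball (z p') \<epsilon> \<subseteq> topspace X - K) (at_right 0)"
  proof -
    have "eventually (\<lambda>\<epsilon>. coordinate_ball (z p') \<epsilon> \<subseteq> topspace X - K) (at_right 0)" if "p' \<in> D - {p}" for p'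
      by (rule coordinate_ball_shrinks[OF _ openin_Compl[OF compactin_closedin[OF \<phi>(2)]]]) (use that z D KD in auto)
    then show ?thesis using D(1) by (simp add: eventually_ball_finite)
  qed
  have pos: "eventually (\<lambda>\<epsilon>::real. \<epsilon> > 0) (at_right 0)" by (simp add: eventually_at_filter)
  have eq: "eventually (\<lambda>\<epsilon>. - 2 * \<i> * (LINT w:{w. \<epsilon> < norm w}|lborel. ?D w) = surface_integral X A (holed D z \<epsilon>) ?\<gamma>) (at_right 0)"
    using ev pos
  proof eventually_elim
    case (elim \<epsilon>)
    note \<epsilon> = elim(2)
    have "surface_integral X A (holed D z \<epsilon>) ?\<gamma> = - 2 * \<i> * (LINT w:coord c ` (dom c \<inter> holed D z \<epsilon>)|lborel. ?\<gamma> c (param c w))"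
      by (rule surface_integral_in_chart[OF holed_integrable[OF D(1,2) z \<epsilon> form] c(1) \<phi>(2) Kd]) (use g0 in auto)
    also have "(LINT w:coord c ` (dom c \<inter> holed D z \<epsilon>)|lborel. ?\<gamma> c (param c w)) = (LINT w:{w. \<epsilon> < norm w}|lborel. ?D w)"
      unfolding set_lebesgue_integral_def
    proof (rule Bochner_Integration.integral_cong[OF refl])
      fix w
      let ?S = "coord c ` (dom c \<inter> holed D z \<epsilon>)"
      show "indicator ?S w *\<^sub>R ?\<gamma> c (param c w) = indicator {w. \<epsilon> < norm w} w *\<^sub>R ?D w"
      proof (cases "w \<in> coord c ` K")
        case True
        then obtain x where x: "x \<in> K" "w = coord c x" by blast
        then have xd: "x \<in> dom c" "param c w = x" using Kd c by auto
        have "w \<in> ?S \<longleftrightarrow> x \<in> holed D z \<epsilon>"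
        proof
          assume "w \<in> ?S"
          then obtain y where y: "y \<in> dom c" "y \<in> holed D z \<epsilon>" "w = coord c y" by blast
          then have "x = y" using coord_inj[OF c(1)] xd(1) x(2) by (metis inj_onD)
          then show "x \<in> holed D z \<epsilon>" using y by simp
        qed (use x xd in blast)
        also have "x \<in> holed D z \<epsilon> \<longleftrightarrow> \<epsilon> < norm w"
        proof -
          have "x \<notin> coordinate_ball (z p') \<epsilon>" if "p' \<in> D - {p}" for p' using elim(1) that x(1) by blast
          moreover have "x \<in> coordinate_ball (z p) \<epsilon> \<longleftrightarrow> norm w \<le> \<epsilon>"
            unfolding c_def[symmetric] coordinate_ball_def using x xd by simp
          moreover have "x \<in> topspace X" using xd dom_subset[OF c(1)] by blast
          ultimately show ?thesis using p unfolding holed_def by (auto simp: not_le)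
        qed
        finally have iff: "w \<in> ?S \<longleftrightarrow> \<epsilon> < norm w" .
        show ?thesis
        proof (cases "\<epsilon> < norm w")
          case True
          then have "x \<in> holed D z \<epsilon>" using \<open>x \<in> holed D z \<epsilon> \<longleftrightarrow> \<epsilon> < norm w\<close> by blast
          then have "x \<notin> D" using holed_facts(2)[OF D(1,2) z \<epsilon>] by blast
          then show ?thesis using dH[OF xd(1)] iff True x xd by (simp add: indicator_def)
        qed (use iff in simp)
      next
        case False
        then have "?D w = 0" by (rule D0)
        moreover have "?\<gamma> c (param c w) = 0" if w: "w \<in> ?S"
        proof -
          obtain x where x: "x \<in> dom c" "w = coord c x" using w by blast
          then have "x \<notin> K" using False by blast
          then show ?thesis using g0[OF c(1) x(1)] x c by simp
        qed
        ultimately show ?thesis by (cases "w \<in> ?S") simp_all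
      qed
    qed
    finally show ?case by simp
  qed
  have "((\<lambda>\<epsilon>. - 2 * \<i> * (LINT w:{w. \<epsilon> < norm w}|lborel. ?D w)) \<longlongrightarrow> - 2 * \<i> * 0) (at_right 0)"
    by (intro tendsto_mult tendsto_const punctured_plane_limit[OF CkH _ r(1)]) (simp add: H_def)
  then have lim: "((\<lambda>\<epsilon>. - 2 * \<i> * (LINT w:{w. \<epsilon> < norm w}|lborel. ?D w)) \<longlongrightarrow> 0) (at_right 0)" by simp
  show ?thesis
    by (rule that[OF \<phi>(1,2) \<phi>0 KD Kb N Lim_transform_eventually[OF lim eq]])
qed

lemma smooth_function_one_minus_sum:
  assumes "\<And>i. i \<in> I \<Longrightarrow> smooth_function (f i)"
  shows "smooth_function (\<lambda>x. 1 - (\<Sum>i\<in>I. f i x))"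
  using assms unfolding smooth_function_def smooth_at_def
  by (intro ballI smooth_germ_diff smooth_germ_const smooth_germ_sum) blast

text \<open>Stokes' theorem holds for forms with poles if the integral over the surface is understood as the limit. The
form is the sum of its parts near the poles, which contribute nothing in the limit, and of a smooth form;
the parts near the poles vanish on the boundary of the surface.\<close>

theorem stokes_pole:
  assumes D: "finite D" "D \<subseteq> topspace X" "D \<inter> surface_boundary A = {}"
    and \<beta>: "\<beta> \<in> forms_pole X A 0 1 D" and z: "\<forall>p\<in>D. coordinate_at A p (z p)"
  shows "((\<lambda>\<epsilon>. surface_integral X A (holed D z \<epsilon>) (hol_d \<beta>)) \<longlongrightarrow> boundary_integral X A \<beta>) (at_right 0)"
proof -
  have cD: "closedin X D" by (rule finite_closedin[OF D(1,2)])
  have \<beta>': "smooth_form_off A 0 1 D \<beta>" using \<beta> by (simp add: forms_pole_def)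
  define Q where "Q = (\<lambda>p \<phi> N K. smooth_function \<phi> \<and> compactin X K \<and> (\<forall>x. x \<notin> K \<longrightarrow> \<phi> x = (0::real)) \<and> K \<inter> (D - {p}) = {} \<and>
    K \<inter> surface_boundary A = {} \<and> openin X N \<and> p \<in> N \<and> (\<forall>x\<in>N. \<phi> x = 1) \<and>
    ((\<lambda>\<epsilon>. surface_integral X A (holed D z \<epsilon>) (hol_d (scale_form \<phi> \<beta>))) \<longlongrightarrow> 0) (at_right 0))"
  have "\<forall>p\<in>D. \<exists>\<phi> N K. Q p \<phi> N K"
  proof
    fix p assume p: "p \<in> D"
    show "\<exists>\<phi> N K. Q p \<phi> N K"
    proof (rule pole_part_limit[OF D \<beta> z p])
      fix \<phi> N K
      assume *: "smooth_function \<phi>" "compactin X K" "\<And>x. x \<notin> K \<Longrightarrow> \<phi> x = 0" "K \<inter> (D - {p}) = {}" "K \<inter> surface_boundary A = {}"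
        "openin X N" "p \<in> N" "\<And>x. x \<in> N \<Longrightarrow> \<phi> x = 1"
        "((\<lambda>\<epsilon>. surface_integral X A (holed D z \<epsilon>) (hol_d (scale_form \<phi> \<beta>))) \<longlongrightarrow> 0) (at_right 0)"
      have "Q p \<phi> N K" unfolding Q_def
        by (intro conjI allI impI ballI *(1,2,4,5,6,7,9)) (erule *(3) *(8))+
      then show "\<exists>\<phi> N K. Q p \<phi> N K" by blast
    qed
  qed
  then obtain \<phi> N K where Q: "\<And>p. p \<in> D \<Longrightarrow> Q p (\<phi> p) (N p) (K p)" by metis
  define \<psi> where "\<psi> = (\<lambda>x. 1 - (\<Sum>p\<in>D. \<phi> p x))"
  have \<psi>: "smooth_function \<psi>" unfolding \<psi>_def by (rule smooth_function_one_minus_sum) (use Q in \<open>simp add: Q_def\<close>)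
  let ?\<beta>0 = "scale_form \<psi> \<beta>"
  have f0: "smooth_form_off A 0 1 {} ?\<beta>0"
  proof (rule form_extend_zero[OF cD form_scale_form[OF cD \<psi> \<beta>']])
    fix p assume p: "p \<in> D"
    have KQ: "compactin X (K p')" "K p' \<inter> (D - {p'}) = {}" if "p' \<in> D" for p' using Q[OF that] by (simp_all add: Q_def)
    have "openin X (N p)" "p \<in> N p" using Q[OF p] by (simp_all add: Q_def)
    then obtain V where V: "openin X V" "p \<in> V" "V \<subseteq> N p" "\<And>p'. p' \<in> D - {p} \<Longrightarrow> V \<inter> K p' = {}"
      using isolated_neighbourhood[OF D(1,2) p _ _ KQ] by metis
    have "?\<beta>0 c x = 0" if "x \<in> V" for c x
    proof -
      have "\<phi> p' x = 0" if "p' \<in> D - {p}" for p'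
      proof -
        have "x \<notin> K p'" using \<open>x \<in> V\<close> V(4)[OF that] by blast
        then show ?thesis using Q[of p'] that by (simp add: Q_def)
      qed
      then have "(\<Sum>p'\<in>D - {p}. \<phi> p' x) = 0" by simp
      moreover have "\<phi> p x = 1" using Q[OF p] that V(3) by (auto simp: Q_def)
      ultimately have "\<psi> x = 0" unfolding \<psi>_def using sum.remove[OF D(1) p, of "\<lambda>p. \<phi> p x"] by simp
      then show ?thesis by (simp add: scale_form_def)
    qed
    then show "\<exists>N. openin X N \<and> p \<in> N \<and> (\<forall>c\<in>A. \<forall>x\<in>N \<inter> dom c. ?\<beta>0 c x = 0)" using V(1,2) by blast
  qed
  have d0: "smooth_form_off A 1 1 {} (hol_d ?\<beta>0)" by (rule hol_d_form[OF _ f0]) simp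
  have int0: "integrable_form E (hol_d ?\<beta>0)" if "borel_in E" "E \<subseteq> topspace X" for E
    by (rule form_integrable[OF _ d0 that(1)]) (use that in auto)
  have bD: "borel_in (topspace X - D)" by (intro borel_in_open openin_Compl cD)
  have fp: "smooth_form_off A 0 1 D (scale_form (\<phi> p) \<beta>)" if "p \<in> D" for p
    by (rule form_scale_form[OF cD _ \<beta>']) (use Q[OF that] in \<open>simp add: Q_def\<close>)
  have pt: "hol_d \<beta> c x = hol_d ?\<beta>0 c x + (\<Sum>p\<in>D. hol_d (scale_form (\<phi> p) \<beta>) c x)"
    if c: "c \<in> A" and x: "x \<in> dom c" "x \<notin> D" for c x
  proof -
    have g: "smooth_at c (scale_form (\<phi> p) \<beta> c) x" if "p \<in> D" for p by (rule form_germ[OF cD fp[OF that] c x])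
    have g0: "smooth_at c (?\<beta>0 c) x" by (rule form_germ[OF _ f0 c x(1)]) auto
    have gs: "smooth_at c (\<lambda>x. \<Sum>p\<in>D. scale_form (\<phi> p) \<beta> c x) x"
      unfolding smooth_at_def by (rule smooth_germ_sum) (use g in \<open>simp add: smooth_at_def\<close>)
    have gt: "smooth_at c (\<lambda>x. ?\<beta>0 c x + (\<Sum>p\<in>D. scale_form (\<phi> p) \<beta> c x)) x"
      using smooth_germ_add[OF g0[unfolded smooth_at_def] gs[unfolded smooth_at_def]] by (simp add: smooth_at_def)
    have "hol_d \<beta> c x = hol_d (\<lambda>c x. ?\<beta>0 c x + (\<Sum>p\<in>D. scale_form (\<phi> p) \<beta> c x)) c x"
    proof (rule hol_d_cong[where \<beta> = "\<lambda>c x. ?\<beta>0 c x + (\<Sum>p\<in>D. scale_form (\<phi> p) \<beta> c x)", OF c x(1) chart_openin[OF c] x(1) _ gt])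
      show "?\<beta>0 c y + (\<Sum>p\<in>D. scale_form (\<phi> p) \<beta> c y) = \<beta> c y" for y
        unfolding scale_form_def \<psi>_def sum_distrib_right[symmetric] of_real_sum[symmetric]
        by (simp add: left_diff_distrib)
    qed
    also have "\<dots> = hol_d ?\<beta>0 c x + hol_d (\<lambda>c x. \<Sum>p\<in>D. scale_form (\<phi> p) \<beta> c x) c x"
      by (rule hol_d_add[where \<beta> = ?\<beta>0 and \<gamma> = "\<lambda>c x. \<Sum>p\<in>D. scale_form (\<phi> p) \<beta> c x", OF c x(1) g0 gs])
    also have "hol_d (\<lambda>c x. \<Sum>p\<in>D. scale_form (\<phi> p) \<beta> c x) c x = (\<Sum>p\<in>D. hol_d (scale_form (\<phi> p) \<beta>) c x)"
      by (rule hol_d_sum[where \<beta> = "\<lambda>p. scale_form (\<phi> p) \<beta>", OF c x(1) g])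
    finally show ?thesis .
  qed
  have eq: "surface_integral X A (holed D z \<epsilon>) (hol_d ?\<beta>0) + (\<Sum>p\<in>D. surface_integral X A (holed D z \<epsilon>) (hol_d (scale_form (\<phi> p) \<beta>)))
     = surface_integral X A (holed D z \<epsilon>) (hol_d \<beta>)" if \<epsilon>: "\<epsilon> > 0" for \<epsilon>
  proof -
    note hf = holed_facts(1,2)[OF D(1,2) z \<epsilon>]
    have i: "integrable_form (holed D z \<epsilon>) (hol_d (scale_form (\<phi> p) \<beta>))" if "p \<in> D" for p
      by (rule holed_integrable[OF D(1,2) z \<epsilon> hol_d_form[OF cD fp[OF that]]])
    have i0: "integrable_form (holed D z \<epsilon>) (hol_d ?\<beta>0)" using hf by (intro int0) auto
    note s = surface_integral_sum[where \<eta> = "\<lambda>p. hol_d (scale_form (\<phi> p) \<beta>)", OF D(1) hf(1) i]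
    have "surface_integral X A (holed D z \<epsilon>) (hol_d \<beta>) =
      surface_integral X A (holed D z \<epsilon>) (\<lambda>c x. hol_d ?\<beta>0 c x + (\<Sum>p\<in>D. hol_d (scale_form (\<phi> p) \<beta>) c x))"
    proof (rule surface_integral_cong)
      fix c x assume "c \<in> A" "x \<in> dom c \<inter> holed D z \<epsilon>"
      then show "hol_d \<beta> c x = hol_d ?\<beta>0 c x + (\<Sum>p\<in>D. hol_d (scale_form (\<phi> p) \<beta>) c x)"
        using hf(2) by (intro pt) auto
    qed
    also have "\<dots> = surface_integral X A (holed D z \<epsilon>) (hol_d ?\<beta>0) +
        surface_integral X A (holed D z \<epsilon>) (\<lambda>c x. \<Sum>p\<in>D. hol_d (scale_form (\<phi> p) \<beta>) c x)"
      by (rule surface_integral_add[OF i0 s[THEN conjunct1]])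
    also have "surface_integral X A (holed D z \<epsilon>) (\<lambda>c x. \<Sum>p\<in>D. hol_d (scale_form (\<phi> p) \<beta>) c x) =
       (\<Sum>p\<in>D. surface_integral X A (holed D z \<epsilon>) (hol_d (scale_form (\<phi> p) \<beta>)))"
      by (rule s[THEN conjunct2])
    finally show ?thesis by simp
  qed
  have b: "surface_integral X A (topspace X) (hol_d ?\<beta>0) = boundary_integral X A \<beta>"
  proof -
    have \<psi>1: "\<psi> x = 1" if "x \<in> surface_boundary A" for x
    proof -
      have "\<phi> p x = 0" if "p \<in> D" for p using Q[OF that] \<open>x \<in> surface_boundary A\<close> unfolding Q_def by blast
      then show ?thesis by (simp add: \<psi>_def)
    qed
    have "boundary_integral X A ?\<beta>0 = boundary_integral X A \<beta>"
      unfolding boundary_integral_def split_beta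
    proof (rule sum.cong[OF refl], unfold set_lebesgue_integral_def, rule Bochner_Integration.integral_cong[OF refl])
      fix q t assume q: "q \<in> PU"
      let ?S = "{t. complex_of_real t \<in> coord (fst q) ` (dom (fst q) \<inter> surface_boundary A)}"
      have "?\<beta>0 (fst q) (param (fst q) (of_real t)) = \<beta> (fst q) (param (fst q) (of_real t))" if t: "t \<in> ?S"
      proof -
        obtain x where x: "x \<in> dom (fst q)" "x \<in> surface_boundary A" "of_real t = coord (fst q) x" using t by blast
        then have "param (fst q) (of_real t) = x" using PU_chart[OF q] by simp
        then show ?thesis using \<psi>1[OF x(2)] by (simp add: scale_form_def)
      qed
      then show "indicator ?S t *\<^sub>R (of_real (snd q (param (fst q) (of_real t))) * ?\<beta>0 (fst q) (param (fst q) (of_real t))) =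
        indicator ?S t *\<^sub>R (of_real (snd q (param (fst q) (of_real t))) * \<beta> (fst q) (param (fst q) (of_real t)))"
        by (cases "t \<in> ?S") simp_all
    qed
    then show ?thesis using stokes_smooth[OF f0] by simp
  qed
  have "((\<lambda>\<epsilon>. surface_integral X A (holed D z \<epsilon>) (hol_d ?\<beta>0) + (\<Sum>p\<in>D. surface_integral X A (holed D z \<epsilon>) (hol_d (scale_form (\<phi> p) \<beta>))))
     \<longlongrightarrow> surface_integral X A (topspace X) (hol_d ?\<beta>0) + (\<Sum>p\<in>D. 0)) (at_right 0)"
    by (intro tendsto_add tendsto_sum holed_limit[OF D(1,2) z int0[OF bD]]) (use Q in \<open>auto simp: Q_def\<close>)
  then have lim: "((\<lambda>\<epsilon>. surface_integral X A (holed D z \<epsilon>) (hol_d ?\<beta>0) + (\<Sum>p\<in>D. surface_integral X A (holed D z \<epsilon>) (hol_d (scale_form (\<phi> p) \<beta>))))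
     \<longlongrightarrow> boundary_integral X A \<beta>) (at_right 0)" unfolding b by simp
  have "eventually (\<lambda>\<epsilon>::real. \<epsilon> > 0) (at_right 0)" by (simp add: eventually_at_filter)
  then have "eventually (\<lambda>\<epsilon>. surface_integral X A (holed D z \<epsilon>) (hol_d ?\<beta>0) + (\<Sum>p\<in>D. surface_integral X A (holed D z \<epsilon>) (hol_d (scale_form (\<phi> p) \<beta>)))
     = surface_integral X A (holed D z \<epsilon>) (hol_d \<beta>)) (at_right 0)" by eventually_elim (rule eq)
  from Lim_transform_eventually[OF lim this] show ?thesis .
qed

theorem holed_limit_decomposition:
  assumes D: "finite D" "D \<subseteq> topspace X" "D \<inter> surface_boundary A = {}" and z: "\<forall>p\<in>D. coordinate_at A p (z p)"
    and \<alpha>: "\<alpha> \<in> forms_log X A D" and \<beta>: "\<beta> \<in> forms_pole X A 0 1 D"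
    and \<omega>: "\<forall>c\<in>A. \<forall>x\<in>dom c - D. \<omega> c x = \<alpha> c x + hol_d \<beta> c x"
  shows "((\<lambda>\<epsilon>. surface_integral X A (holed D z \<epsilon>) \<omega>) \<longlongrightarrow>
    surface_integral X A (topspace X) \<alpha> + boundary_integral X A \<beta>) (at_right 0)"
proof -
  have cD: "closedin X D" by (rule finite_closedin[OF D(1,2)])
  have \<beta>': "smooth_form_off A 0 1 D \<beta>" using \<beta> by (simp add: forms_pole_def)
  have \<alpha>': "smooth_form_off A 1 1 D \<alpha>" using \<alpha> by (simp add: forms_log_def forms_pole_def)
  have lim: "((\<lambda>\<epsilon>. surface_integral X A (holed D z \<epsilon>) \<alpha> + surface_integral X A (holed D z \<epsilon>) (hol_d \<beta>)) \<longlongrightarrow>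
    surface_integral X A (topspace X) \<alpha> + boundary_integral X A \<beta>) (at_right 0)"
    by (intro tendsto_add holed_limit[OF D(1,2) z log_form_integrable[OF cD \<alpha>]] stokes_pole[OF D \<beta> z])
  have "eventually (\<lambda>\<epsilon>::real. \<epsilon> > 0) (at_right 0)" by (simp add: eventually_at_filter)
  then have "eventually (\<lambda>\<epsilon>. surface_integral X A (holed D z \<epsilon>) \<alpha> + surface_integral X A (holed D z \<epsilon>) (hol_d \<beta>) =
     surface_integral X A (holed D z \<epsilon>) \<omega>) (at_right 0)"
  proof eventually_elim
    case (elim \<epsilon>)
    have "surface_integral X A (holed D z \<epsilon>) \<omega> = surface_integral X A (holed D z \<epsilon>) (\<lambda>c x. \<alpha> c x + hol_d \<beta> c x)"
    proof (rule surface_integral_cong)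
      fix c x assume "c \<in> A" "x \<in> dom c \<inter> holed D z \<epsilon>"
      then show "\<omega> c x = \<alpha> c x + hol_d \<beta> c x"
        using \<omega> holed_facts(2)[OF D(1,2) z elim] by blast
    qed
    also have "\<dots> = surface_integral X A (holed D z \<epsilon>) \<alpha> + surface_integral X A (holed D z \<epsilon>) (hol_d \<beta>)"
      by (intro surface_integral_add holed_integrable[OF D(1,2) z elim] \<alpha>' hol_d_form[OF cD \<beta>'])
    finally show ?case by simp
  qed
  from Lim_transform_eventually[OF lim this] show ?thesis .
qed

section \<open>Existence of the decomposition\<close>

text \<open>The $(0,1)$-form $f\,d\bar z$ in the coordinate $z$ of \<open>c\<close>, extended by 0 and expressed in all charts.\<close>

definition chart_form :: "'a chart \<Rightarrow> ('a \<Rightarrow> complex) \<Rightarrow> 'a form" where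
  "chart_form c f = (\<lambda>c' x. if x \<in> dom c then f x * cnj (transition_deriv c' c x) else 0)"

lemma chart_form_smooth:
  assumes D: "closedin X D" and c: "c \<in> A" and K: "compactin X K" "K \<subseteq> dom c" "\<And>x. x \<notin> K \<Longrightarrow> f x = 0"
    and f: "\<And>x. x \<in> K - D \<Longrightarrow> smooth_at c f x"
  shows "smooth_form_off A 0 1 D (chart_form c f)"
proof (rule formI[OF D])
  fix c1 c2 x assume *: "c1 \<in> A" "c2 \<in> A" "x \<in> dom c1" "x \<in> dom c2" "x \<notin> D"
  show "chart_form c f c1 x = chart_form c f c2 x * transition_deriv c1 c2 x ^ 0 * cnj (transition_deriv c1 c2 x) ^ 1"
    using transition_deriv_cocycle[OF *(1,2) c *(3,4)] by (auto simp: chart_form_def)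
next
  fix c' x assume *: "c' \<in> A" "x \<in> dom c'" "x \<notin> D"
  show "smooth_at c' (chart_form c f c') x"
  proof (cases "x \<in> K")
    case True
    then have xc: "x \<in> dom c" using K by blast
    have "smooth_at c f x" using f True * by blast
    from smooth_at_transfer[OF *(1) c *(2) xc this]
    have "smooth_at c' (\<lambda>y. f y * cnj (transition_deriv c' c y)) x"
      using smooth_at_tderiv[OF *(1) c *(2) xc] unfolding smooth_at_def
      by (intro smooth_germ_mult smooth_germ_cnj)
    then show ?thesis
      by (rule smooth_at_cong[OF _ *(1) chart_openin[OF c] xc *(2)]) (simp add: chart_form_def)
  next
    case False
    have "smooth_at c' (\<lambda>_. 0 :: complex) x" by (simp add: smooth_at_def smooth_germ_const)
    then show ?thesis
    proof (rule smooth_at_cong[OF _ *(1) openin_Compl[OF compactin_closedin[OF K(1)]] _ *(2)])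
      show "x \<in> topspace X - K" using False *(2) dom_subset[OF *(1)] by blast
      show "0 = chart_form c f c' y" if "y \<in> (topspace X - K) \<inter> dom c'" for y
        using K(3)[of y] that by (simp add: chart_form_def)
    qed
  qed
qed

text \<open>Near one pole, \<open>pole_reduction\<close> provides a primitive modulo a simple pole. Cutting it off makes
it a global form without changing it near the pole.\<close>

lemma local_primitive:
  assumes D: "finite D" "D \<subseteq> topspace X" "D \<inter> surface_boundary A = {}"
    and \<omega>: "\<omega> \<in> forms_pole X A 1 1 D" and p: "p \<in> D"
  obtains c \<beta> N K n b a1 where "coordinate_at A p c" "smooth_form_off A 0 1 D \<beta>" "compactin X K" "K \<inter> (D - {p}) = {}"
    "\<And>c' x. x \<notin> K \<Longrightarrow> \<beta> c' x = 0" "openin X N" "p \<in> N" "N \<subseteq> dom c"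
    "smooth_on (coord c ` N) b" "smooth_on (coord c ` N) a1"
    "\<And>x. x \<in> N \<Longrightarrow> \<beta> c x = b (coord c x) / coord c x ^ n"
    "\<And>x. x \<in> N - D \<Longrightarrow> \<omega> c x - hol_d \<beta> c x = a1 (coord c x) / coord c x"
proof -
  have cD: "closedin X D" by (rule finite_closedin[OF D(1,2)])
  have \<omega>': "smooth_form_off A 1 1 D \<omega>" using \<omega> by (simp add: forms_pole_def)
  obtain n where n: "pole_le X A D \<omega> p n" using \<omega> p by (auto simp: forms_pole_def)
  then obtain c where cp: "coordinate_at A p c" unfolding pole_le_def by blast
  have c: "c \<in> A" "p \<in> dom c" "coord c p = 0" using cp by (auto simp: coordinate_at_def)
  have pb: "p \<notin> surface_boundary A" using D(3) p by blast
  obtain r h where r: "r > 0" "ball 0 r \<subseteq> img c" and h: "\<And>k. Ck k (ball 0 r) h"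
    "\<And>x. x \<in> dom c - D \<Longrightarrow> coord c x \<in> ball 0 r \<Longrightarrow> \<omega> c x = h (coord c x) / coord c x ^ n"
    using pole_in_coordinate[OF cD \<omega>' n cp p pb] by metis
  obtain b a1 where b: "\<forall>k. Ck k (ball 0 r) b" and a1: "\<forall>k. Ck k (ball 0 r) a1"
    and dz: "\<forall>z\<in>ball 0 r - {0}. has_dz (\<lambda>w. b w / w ^ n) (h z / z ^ n - a1 z / z) z UNIV"
    using pole_reduction[OF open_ball, of 0 r h n] h(1) by blast
  obtain \<phi> :: "'a \<Rightarrow> real" and K N where \<phi>: "smooth_function \<phi>" "compactin X K" and Kd: "K \<subseteq> dom c" "K \<inter> (D - {p}) = {}"
    and KB': "coord c ` K \<subseteq> ball 0 r" and \<phi>0: "\<And>x. x \<notin> K \<Longrightarrow> \<phi> x = 0"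
    and N: "openin X N" "p \<in> N" and NK: "N \<subseteq> K" and \<phi>1: "\<And>x. x \<in> N \<Longrightarrow> \<phi> x = 1"
    using isolating_bump[OF D(1,2) p c r(1)] by metis
  have KB: "coord c x \<in> ball 0 r" if "x \<in> K" for x using KB' that by blast
  define f where "f = (\<lambda>x. of_real (\<phi> x) * (b (coord c x) / coord c x ^ n))"
  define \<beta> where "\<beta> = chart_form c f"
  have nz: "coord c x \<noteq> 0" if "x \<in> dom c" "x \<notin> D" for x
    using that p c coord_inj[OF c(1)] by (metis inj_onD)
  have smooth: "smooth_form_off A 0 1 D \<beta>"
    unfolding \<beta>_def
  proof (rule chart_form_smooth[OF cD c(1) \<phi>(2) Kd(1)])
    show "f x = 0" if "x \<notin> K" for x using \<phi>0[OF that] by (simp add: f_def)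
    show "smooth_at c f x" if x: "x \<in> K - D" for x
    proof -
      have xd: "x \<in> dom c" "x \<notin> D" "coord c x \<in> ball 0 r" using x Kd KB by blast+
      have xi: "coord c x \<in> img c" using xd by blast
      have "smooth_germ (img c) b (coord c x)" by (rule smooth_germ_Ck[OF open_ball xd(3) b])
      moreover have "smooth_germ (img c) (\<lambda>w. w) (coord c x)"
        by (rule smooth_germ_holomorphic[OF open_UNIV]) auto
      moreover have "smooth_germ (img c) (\<lambda>w. \<phi> (param c w)) (coord c x)"
        using \<phi>(1) c(1) xd(1) by (simp add: smooth_function_def smooth_at_def)
      ultimately have "smooth_germ (img c) (\<lambda>w. of_real (\<phi> (param c w)) * (b w / w ^ n)) (coord c x)"
        using xi nz[OF xd(1,2)]
        by (intro smooth_germ_mult smooth_germ_of_real smooth_germ_divide smooth_germ_power) auto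
      then show ?thesis unfolding smooth_at_def
        by (rule smooth_germ_cong[OF _ open_UNIV]) (auto simp: f_def)
    qed
  qed
  have \<beta>N: "\<beta> c x = b (coord c x) / coord c x ^ n" if x: "x \<in> N" for x
  proof -
    have "x \<in> dom c" using x NK Kd by blast
    then show ?thesis using transition_deriv_self[OF c(1)] \<phi>1[OF x] by (simp add: \<beta>_def chart_form_def f_def)
  qed
  have sN: "smooth_on (coord c ` N) g" if "\<forall>k. Ck k (ball 0 r) g" for g :: "complex \<Rightarrow> complex"
    unfolding smooth_on_germ using smooth_germ_Ck[OF open_ball _ that] NK KB by blast
  show ?thesis
  proof (rule that[OF cp smooth \<phi>(2) Kd(2) _ N _ sN[OF b] sN[OF a1] \<beta>N])
    show "\<beta> c' x = 0" if "x \<notin> K" for c' x using \<phi>0[OF that] by (simp add: \<beta>_def chart_form_def f_def)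
    show "N \<subseteq> dom c" using NK Kd by blast
    show "\<omega> c x - hol_d \<beta> c x = a1 (coord c x) / coord c x" if x: "x \<in> N - D" for x
    proof -
      have xd: "x \<in> dom c" "x \<notin> D" "x \<in> N" "coord c x \<in> ball 0 r" using x NK Kd KB by blast+
      let ?d = "h (coord c x) / coord c x ^ n - a1 (coord c x) / coord c x"
      have "has_dz (\<lambda>w. b w / w ^ n) ?d (coord c x) UNIV" using dz xd(4) nz[OF xd(1,2)] by blast
      then have "has_dz (\<lambda>w. b w / w ^ n) ?d (coord c x) (img c)" by (rule has_dz_subset) simp
      then have "has_dz (\<lambda>w. b (coord c (param c w)) / coord c (param c w) ^ n) ?d (coord c x) (img c)"
        by (rule has_dz_transform[OF _ open_UNIV]) (use xd in auto)
      then have "has_dz (\<lambda>w. \<beta> c (param c w)) ?d (coord c x) (img c)"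
        by (rule has_dz_near[OF c(1) xd(1) N(1) xd(3), where f = "\<lambda>y. b (coord c y) / coord c y ^ n", rotated])
           (use \<beta>N in simp)
      from hol_d_eqI[where \<beta> = \<beta>, OF c(1) xd(1) this] have "hol_d \<beta> c x = ?d" .
      moreover have "\<omega> c x = h (coord c x) / coord c x ^ n" using h(2)[of x] xd by blast
      ultimately show ?thesis by simp
    qed
  qed
qed

text \<open>The local primitives are added up. Near each pole only one of them is nonzero, so the difference of $\omega$
and the derivative of the sum has a simple pole there.\<close>

theorem decomposition_exists:
  assumes D: "finite D" "D \<subseteq> topspace X" "D \<inter> surface_boundary A = {}"
    and \<omega>: "\<omega> \<in> forms_pole X A 1 1 D"
  obtains \<alpha> \<beta> where "\<alpha> \<in> forms_log X A D" "\<beta> \<in> forms_pole X A 0 1 D"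
    "\<forall>c\<in>A. \<forall>x\<in>dom c - D. \<omega> c x = \<alpha> c x + hol_d \<beta> c x"
proof -
  have cD: "closedin X D" by (rule finite_closedin[OF D(1,2)])
  have \<omega>': "smooth_form_off A 1 1 D \<omega>" using \<omega> by (simp add: forms_pole_def)
  define Q where "Q = (\<lambda>p \<beta> K. smooth_form_off A 0 1 D \<beta> \<and> compactin X K \<and> K \<inter> (D - {p}) = {} \<and>
    (\<forall>c' x. x \<notin> K \<longrightarrow> \<beta> c' x = 0) \<and>
    (\<exists>c N n b a1. coordinate_at A p c \<and> openin X N \<and> p \<in> N \<and> N \<subseteq> dom c \<and>
       smooth_on (coord c ` N) b \<and> smooth_on (coord c ` N) a1 \<and>
       (\<forall>x\<in>N. \<beta> c x = b (coord c x) / coord c x ^ n) \<and>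
       (\<forall>x\<in>N - D. \<omega> c x - hol_d \<beta> c x = a1 (coord c x) / coord c x)))"
  have "\<forall>p\<in>D. \<exists>\<beta> K. Q p \<beta> K"
  proof
    fix p assume p: "p \<in> D"
    show "\<exists>\<beta> K. Q p \<beta> K"
    proof (rule local_primitive[OF D \<omega> p])
      fix c \<beta> N K n b a1
      assume *: "coordinate_at A p c" "smooth_form_off A 0 1 D \<beta>" "compactin X K" "K \<inter> (D - {p}) = {}"
        "\<And>c' x. x \<notin> K \<Longrightarrow> \<beta> c' x = 0" "openin X N" "p \<in> N" "N \<subseteq> dom c"
        "smooth_on (coord c ` N) b" "smooth_on (coord c ` N) a1"
        "\<And>x. x \<in> N \<Longrightarrow> \<beta> c x = b (coord c x) / coord c x ^ n"
        "\<And>x. x \<in> N - D \<Longrightarrow> \<omega> c x - hol_d \<beta> c x = a1 (coord c x) / coord c x"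
      have "Q p \<beta> K" unfolding Q_def
      proof (intro conjI allI impI *(2-4))
        show "\<beta> c' x = 0" if "x \<notin> K" for c' x using *(5)[OF that] .
        show "\<exists>c N n b a1. coordinate_at A p c \<and> openin X N \<and> p \<in> N \<and> N \<subseteq> dom c \<and>
           smooth_on (coord c ` N) b \<and> smooth_on (coord c ` N) a1 \<and>
           (\<forall>x\<in>N. \<beta> c x = b (coord c x) / coord c x ^ n) \<and>
           (\<forall>x\<in>N - D. \<omega> c x - hol_d \<beta> c x = a1 (coord c x) / coord c x)"
          by (rule exI[of _ c], rule exI[of _ N], rule exI[of _ n], rule exI[of _ b], rule exI[of _ a1])
             (intro conjI ballI *(1,6-12))
      qed
      then show "\<exists>\<beta> K. Q p \<beta> K" by blast
    qed
  qed
  then obtain B K where Q: "\<And>p. p \<in> D \<Longrightarrow> Q p (B p) (K p)" by metis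
  have Bs: "smooth_form_off A 0 1 D (B p)" if "p \<in> D" for p using Q[OF that] by (simp add: Q_def)
  define \<beta> where "\<beta> = (\<lambda>c x. \<Sum>p\<in>D. B p c x)"
  define \<alpha> where "\<alpha> = (\<lambda>c x. \<omega> c x - hol_d \<beta> c x)"
  have \<beta>s: "smooth_form_off A 0 1 D \<beta>"
  proof (rule formI[OF cD])
    fix c c' x assume *: "c \<in> A" "c' \<in> A" "x \<in> dom c" "x \<in> dom c'" "x \<notin> D"
    have "B p c x = B p c' x * transition_deriv c c' x ^ 0 * cnj (transition_deriv c c' x) ^ 1" if "p \<in> D" for p
      by (rule form_law[OF cD Bs[OF that] *])
    then show "\<beta> c x = \<beta> c' x * transition_deriv c c' x ^ 0 * cnj (transition_deriv c c' x) ^ 1"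
      unfolding \<beta>_def sum_distrib_right by (rule sum.cong[OF refl])
  next
    fix c x assume *: "c \<in> A" "x \<in> dom c" "x \<notin> D"
    show "smooth_at c (\<beta> c) x"
      unfolding smooth_at_def \<beta>_def
      by (rule smooth_germ_sum) (use form_germ[OF cD Bs *] in \<open>simp add: smooth_at_def\<close>)
  qed
  note d\<beta> = hol_d_form[OF cD \<beta>s]
  have \<alpha>s: "smooth_form_off A 1 1 D \<alpha>"
  proof (rule formI[OF cD])
    fix c c' x assume *: "c \<in> A" "c' \<in> A" "x \<in> dom c" "x \<in> dom c'" "x \<notin> D"
    show "\<alpha> c x = \<alpha> c' x * transition_deriv c c' x ^ 1 * cnj (transition_deriv c c' x) ^ 1"
      unfolding \<alpha>_def form_law[OF cD \<omega>' *] form_law[OF cD d\<beta> *] by (simp add: left_diff_distrib)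
  next
    fix c x assume *: "c \<in> A" "x \<in> dom c" "x \<notin> D"
    show "smooth_at c (\<alpha> c) x"
      using form_germ[OF cD \<omega>' *] form_germ[OF cD d\<beta> *] unfolding smooth_at_def \<alpha>_def
      by (rule smooth_germ_diff)
  qed
  have poles: "(\<exists>n. pole_le X A D \<beta> p n) \<and> pole_le X A D \<alpha> p 1" if p: "p \<in> D" for p
  proof -
    obtain c N n b a1 where *: "coordinate_at A p c" "openin X N" "p \<in> N" "N \<subseteq> dom c"
       "smooth_on (coord c ` N) b" "smooth_on (coord c ` N) a1"
       "\<forall>x\<in>N. B p c x = b (coord c x) / coord c x ^ n"
       "\<forall>x\<in>N - D. \<omega> c x - hol_d (B p) c x = a1 (coord c x) / coord c x"
      using Q[OF p] unfolding Q_def by blast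
    have c: "c \<in> A" using *(1) by (simp add: coordinate_at_def)
    have KQ: "compactin X (K p')" "K p' \<inter> (D - {p'}) = {}" if "p' \<in> D" for p' using Q[OF that] by (simp_all add: Q_def)
    obtain V where V: "openin X V" and pV: "p \<in> V" and VN: "V \<subseteq> N" "\<And>p'. p' \<in> D - {p} \<Longrightarrow> V \<inter> K p' = {}"
      using isolated_neighbourhood[OF D(1,2) p *(2,3) KQ] by metis
    have \<beta>V: "\<beta> c' x = B p c' x" if "x \<in> V" for c' x
    proof -
      have "B p' c' x = 0" if "p' \<in> D - {p}" for p'
      proof -
        have "x \<notin> K p'" using \<open>x \<in> V\<close> VN(2)[OF that] by blast
        moreover have "\<forall>c' x. x \<notin> K p' \<longrightarrow> B p' c' x = 0" using Q[of p'] that unfolding Q_def by blast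
        ultimately show ?thesis by blast
      qed
      then have "(\<Sum>p'\<in>D - {p}. B p' c' x) = 0" by simp
      then show ?thesis unfolding \<beta>_def using sum.remove[OF D(1) p, of "\<lambda>p. B p c' x"] by simp
    qed
    have Vd: "V \<subseteq> dom c" using *(4) VN(1) by blast
    have sV: "smooth_on (coord c ` V) g" if "smooth_on (coord c ` N) g" for g :: "complex \<Rightarrow> complex"
      unfolding smooth_on_germ
    proof
      fix w assume "w \<in> coord c ` V"
      then have "smooth_germ (coord c ` N) g w" using that VN(1) unfolding smooth_on_germ by blast
      then show "smooth_germ (coord c ` V) g w" by (rule smooth_germ_mono) (use VN(1) in blast)
    qed
    have "pole_le X A D \<beta> p n"
      unfolding pole_le_def
    proof (rule exI[of _ c], rule exI[of _ V], rule exI[of _ b], intro conjI ballI *(1) V pV Vd sV[OF *(5)])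
      show "\<beta> c x = b (coord c x) / coord c x ^ n" if "x \<in> V - D" for x
        using \<beta>V[of x c] *(7) that VN(1) by auto
    qed
    moreover have "pole_le X A D \<alpha> p 1"
      unfolding pole_le_def
    proof (rule exI[of _ c], rule exI[of _ V], rule exI[of _ a1], intro conjI ballI *(1) V pV Vd sV[OF *(6)])
      show "\<alpha> c x = a1 (coord c x) / coord c x ^ 1" if x: "x \<in> V - D" for x
      proof -
        have xd: "x \<in> dom c" "x \<in> V" "x \<notin> D" "x \<in> N - D" using x Vd VN(1) by blast+
        have "hol_d \<beta> c x = hol_d (B p) c x"
          by (rule hol_d_cong[where \<beta> = "B p" and \<gamma> = \<beta>, OF c xd(1) V xd(2) _ form_germ[OF cD Bs[OF p] c xd(1,3)]])
             (use \<beta>V in simp)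
        then show ?thesis using *(8) xd(4) by (simp add: \<alpha>_def)
      qed
    qed
    ultimately show ?thesis by blast
  qed
  show ?thesis
  proof (rule that[of \<alpha> \<beta>])
    show "\<beta> \<in> forms_pole X A 0 1 D" using \<beta>s poles by (simp add: forms_pole_def)
    show "\<alpha> \<in> forms_log X A D" using \<alpha>s poles unfolding forms_log_def forms_pole_def by blast
  qed (simp add: \<alpha>_def)
qed

end

section \<open>The regularized integral as a limit\<close>

theorem theorem2p9:
  fixes X :: "'a topology" and A :: "'a chart set" and D :: "'a set" and \<omega> :: "'a form"
  assumes "riemann_surface_with_boundary X A"
    and "compact_space X"
    and "finite D" and "D \<subseteq> topspace X" and "D \<inter> surface_boundary A = {}"
    and "\<omega> \<in> forms_pole X A 1 1 D"
  shows "(\<forall>z. (\<forall>p\<in>D. coordinate_at A p (z p)) \<longrightarrow>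
            ((\<lambda>\<epsilon>. surface_integral X A (topspace X - (\<Union>p\<in>D. coordinate_ball (z p) \<epsilon>)) \<omega>)
               \<longlongrightarrow> reg_integral X A D \<omega>) (at_right 0)) \<and>
         (\<exists>L. \<forall>z. (\<forall>p\<in>D. coordinate_at A p (z p)) \<longrightarrow>
            ((\<lambda>\<epsilon>. surface_integral X A (topspace X - (\<Union>p\<in>D. coordinate_ball (z p) \<epsilon>)) \<omega>)
               \<longlongrightarrow> L) (at_right 0))"
proof -
  interpret compact_surface X A using assms(1,2) by unfold_locales
  note D = assms(3-5)
  let ?dec = "\<lambda>\<alpha> \<beta>. \<alpha> \<in> forms_log X A D \<and> \<beta> \<in> forms_pole X A 0 1 D \<and>
        (\<forall>c\<in>A. \<forall>x\<in>dom c - D. \<omega> c x = \<alpha> c x + hol_d \<beta> c x)"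
  let ?I = "\<lambda>\<alpha> \<beta>. surface_integral X A (topspace X) \<alpha> + boundary_integral X A \<beta>"
  have lim: "((\<lambda>\<epsilon>. surface_integral X A (holed D z \<epsilon>) \<omega>) \<longlongrightarrow> ?I \<alpha> \<beta>) (at_right 0)"
    if "\<forall>p\<in>D. coordinate_at A p (z p)" "?dec \<alpha> \<beta>" for z \<alpha> \<beta>
    using that by (intro holed_limit_decomposition[OF D]) auto
  obtain \<alpha> \<beta> where dec: "?dec \<alpha> \<beta>" using decomposition_exists[OF D assms(6)] by metis
  have "\<forall>p\<in>D. \<exists>c. coordinate_at A p c"
    using assms(6) unfolding forms_pole_def pole_le_def by blast
  \<comment> \<open>Some choice of coordinates is needed to compare two decompositions through the limit.\<close>
  then obtain z0 where z0: "\<forall>p\<in>D. coordinate_at A p (z0 p)" by metis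
  have "reg_integral X A D \<omega> = ?I \<alpha> \<beta>"
    unfolding reg_integral_def
  proof (rule the_equality)
    show "\<exists>\<alpha>' \<beta>'. \<alpha>' \<in> forms_log X A D \<and> \<beta>' \<in> forms_pole X A 0 1 D \<and>
        (\<forall>c\<in>A. \<forall>x\<in>dom c - D. \<omega> c x = \<alpha>' c x + hol_d \<beta>' c x) \<and> ?I \<alpha> \<beta> = ?I \<alpha>' \<beta>'"
      using dec by blast
  next
    fix r assume "\<exists>\<alpha>' \<beta>'. \<alpha>' \<in> forms_log X A D \<and> \<beta>' \<in> forms_pole X A 0 1 D \<and>
        (\<forall>c\<in>A. \<forall>x\<in>dom c - D. \<omega> c x = \<alpha>' c x + hol_d \<beta>' c x) \<and> r = ?I \<alpha>' \<beta>'"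
    then obtain \<alpha>' \<beta>' where dec': "?dec \<alpha>' \<beta>'" and r: "r = ?I \<alpha>' \<beta>'" by blast
    show "r = ?I \<alpha> \<beta>"
      unfolding r by (rule tendsto_unique[OF _ lim[OF z0 dec'] lim[OF z0 dec]]) simp
  qed
  then have main: "((\<lambda>\<epsilon>. surface_integral X A (topspace X - (\<Union>p\<in>D. coordinate_ball (z p) \<epsilon>)) \<omega>)
               \<longlongrightarrow> reg_integral X A D \<omega>) (at_right 0)" if "\<forall>p\<in>D. coordinate_at A p (z p)" for z
    using lim[OF that dec] by (simp only: holed_def)
  then show ?thesis by blast
qed

end
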